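(* Let $Z$ be a topological vector space and let $Y$ be a complete metrizable topological vector space. If $D$ is a dense linear subspace of $Z$ (with the subspace topology), then $\mathrm{Ext}_{\mathrm{TVS}}(Z,Y)\cong\mathrm{Ext}_{\mathrm{TVS}}(D,Y)$ (isomorphism of abelian groups).
   Context: All topological vector spaces are Hausdorff and over $\mathbb{R}$. An extension of topological vector spaces is a short exact sequence $E:0\to Y\stackrel{\imath}{\to}X\stackrel{\pi}{\to}Z\to 0$ of topological vector spaces in which $\imath,\pi$ are continuous linear maps that are open onto their images. Two extensions $0\to Y\stackrel{\imath}{\to}X\stackrel{\pi}{\to}Z\to 0$ and $0\to Y\stackrel{\imath'}{\to}X'\stackrel{\pi'}{\to}Z\to 0$ are equivalent if there is a continuous linear map $T:X\to X'$ with $T\circ\imath=\imath'$ and $\pi'\circ T=\pi$. $\mathrm{Ext}_{\mathrm{TVS}}(Z,Y)$ is the set of equivalence classes of such extensions. It is an abelian group under the Baer sum: $[E_1]+[E_2]$ is the class of the extension obtained from the product extension $0\to Y\times Y\to X_1\times X_2\to Z\times Z\to 0$ by pulling back along the diagonal $Z\to Z\times Z$ and then pushing out along the addition map $Y\times Y\to Y$ (pull-backs and push-outs taken in topological vector spaces). The zero element is the class of the trivial extension $0\to Y\to Y\times Z\to Z\to 0$. *)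

theory Defs
  imports "HOL-Analysis.Analysis" "HOL-Algebra.Group"
begin

section \<open>Topological vector spaces\<close>

text \<open>
  A topological vector space is an abstract topology whose underlying set is a linear subspace
  of a real vector space type. The linear structure is that of the type, and the type itself
  carries no topology. A dense subspace \<open>D\<close> of \<open>Z\<close> is then \<open>subtopology Z D\<close>.
\<close>

definition tvs :: "'a::real_vector topology \<Rightarrow> bool" where
  "tvs X \<longleftrightarrow>
     subspace (topspace X) \<and>
     Hausdorff_space X \<and>
     continuous_map (prod_topology X X) X (\<lambda>(x, y). x + y) \<and>
     continuous_map (prod_topology euclideanreal X) X (\<lambda>(r, x). r *\<^sub>R x)"

text \<open>Completeness is that of the uniform structure given by translations.\<close>

definition cauchy_filter_tvs :: "'a::real_vector topology \<Rightarrow> 'a filter \<Rightarrow> bool" where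
  "cauchy_filter_tvs X F \<longleftrightarrow>
     F \<noteq> bot \<and> F \<le> principal (topspace X) \<and>
     (\<forall>U. openin X U \<and> 0 \<in> U \<longrightarrow>
        (\<exists>A. (\<forall>\<^sub>F x in F. x \<in> A) \<and> (\<forall>x\<in>A. \<forall>y\<in>A. x - y \<in> U)))"

definition complete_tvs :: "'a::real_vector topology \<Rightarrow> bool" where
  "complete_tvs X \<longleftrightarrow> (\<forall>F. cauchy_filter_tvs X F \<longrightarrow> (\<exists>l. limitin X (\<lambda>x. x) l F))"

definition linear_on :: "'a::real_vector set \<Rightarrow> ('a \<Rightarrow> 'b::real_vector) \<Rightarrow> bool" where
  "linear_on S f \<longleftrightarrow>
     (\<forall>x\<in>S. \<forall>y\<in>S. f (x + y) = f x + f y) \<and> (\<forall>r. \<forall>x\<in>S. f (r *\<^sub>R x) = r *\<^sub>R f x)"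

definition continuous_linear :: "'a::real_vector topology \<Rightarrow> 'b::real_vector topology \<Rightarrow> ('a \<Rightarrow> 'b) \<Rightarrow> bool" where
  "continuous_linear X Y f \<longleftrightarrow> continuous_map X Y f \<and> linear_on (topspace X) f"

definition open_onto_image :: "'a topology \<Rightarrow> 'b topology \<Rightarrow> ('a \<Rightarrow> 'b) \<Rightarrow> bool" where
  "open_onto_image X Y f \<longleftrightarrow> open_map X (subtopology Y (f ` topspace X)) f"


section \<open>Extensions\<close>

text \<open>
  The triple \<open>(X, i, p)\<close> stands for \<open>0 \<rightarrow> Y \<rightarrow> X \<rightarrow> Z \<rightarrow> 0\<close> with maps \<open>i\<close> and \<open>p\<close>. Only the values
  of \<open>i\<close> on \<open>topspace Y\<close> and of \<open>p\<close> on \<open>topspace X\<close> matter.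
\<close>

type_synonym ('y, 'x, 'z) ext = "'x topology \<times> ('y \<Rightarrow> 'x) \<times> ('x \<Rightarrow> 'z)"

definition extension ::
  "'z::real_vector topology \<Rightarrow> 'y::real_vector topology \<Rightarrow> ('y, 'x::real_vector, 'z) ext \<Rightarrow> bool" where
  "extension Z Y = (\<lambda>(X, i, p).
     tvs Y \<and> tvs X \<and> tvs Z \<and>
     continuous_linear Y X i \<and> open_onto_image Y X i \<and>
     continuous_linear X Z p \<and> open_onto_image X Z p \<and>
     inj_on i (topspace Y) \<and>
     i ` topspace Y = {x \<in> topspace X. p x = 0} \<and>
     p ` topspace X = topspace Z)"

definition ext_equiv ::
  "'z::real_vector topology \<Rightarrow> 'y::real_vector topology \<Rightarrow>
   ('y, 'x::real_vector, 'z) ext \<Rightarrow> ('y, 'w::real_vector, 'z) ext \<Rightarrow> bool" where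
  "ext_equiv Z Y = (\<lambda>(X, i, p) (X', i', p').
     \<exists>T. continuous_linear X X' T \<and>
         (\<forall>y\<in>topspace Y. T (i y) = i' y) \<and>
         (\<forall>x\<in>topspace X. p' (T x) = p x))"

definition trivial_ext ::
  "'z::real_vector topology \<Rightarrow> 'y::real_vector topology \<Rightarrow> ('y, 'y \<times> 'z, 'z) ext" where
  "trivial_ext Z Y = (prod_topology Y Z, \<lambda>y. (y, 0), snd)"


section \<open>The Baer sum\<close>

definition product_ext ::
  "('y, 'x, 'z) ext \<Rightarrow> ('v, 'w, 'u) ext \<Rightarrow> ('y \<times> 'v, 'x \<times> 'w, 'z \<times> 'u) ext" where
  "product_ext = (\<lambda>(X1, i1, p1) (X2, i2, p2).
     (prod_topology X1 X2, map_prod i1 i2, map_prod p1 p2))"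

text \<open>The pull-back of an extension of \<open>Z\<close> along a map \<open>f\<close> from \<open>W\<close> to \<open>Z\<close>.\<close>

definition pullback_ext ::
  "'w::real_vector topology \<Rightarrow> ('w \<Rightarrow> 'z) \<Rightarrow> ('y, 'x, 'z) ext \<Rightarrow> ('y, 'x \<times> 'w, 'w) ext" where
  "pullback_ext W f = (\<lambda>(X, i, p).
     (subtopology (prod_topology X W) {(x, w). p x = f w}, \<lambda>y. (i y, 0), snd))"

text \<open>
  The push-out of \<open>(X, i, p)\<close>, an extension by \<open>Y\<close>, along a map \<open>a\<close> from \<open>Y\<close> to \<open>V\<close> has as middle
  space the quotient of \<open>V \<times> X\<close> by the subspace \<open>{(a y, - i y) | y \<in> Y}\<close>. Quotients are
  determined only up to isomorphism, so this is a relation: \<open>q\<close> is the quotient map onto the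
  middle space \<open>P\<close> of the extension \<open>(P, j, r)\<close> by \<open>V\<close>.
\<close>

definition is_pushout_ext ::
  "'y::real_vector topology \<Rightarrow> 'v::real_vector topology \<Rightarrow> ('y \<Rightarrow> 'v) \<Rightarrow>
   ('y, 'x::real_vector, 'z::real_vector) ext \<Rightarrow> ('v, 'p::real_vector, 'z) ext \<Rightarrow> bool" where
  "is_pushout_ext Y V a = (\<lambda>(X, i, p) (P, j, r).
     \<exists>q. linear_on (topspace V \<times> topspace X) q \<and>
         quotient_map (prod_topology V X) P q \<and>
         {w \<in> topspace V \<times> topspace X. q w = 0} = (\<lambda>y. (a y, - i y)) ` topspace Y \<and>
         (\<forall>v\<in>topspace V. j v = q (v, 0)) \<and>
         (\<forall>v\<in>topspace V. \<forall>x\<in>topspace X. r (q (v, x)) = p x))"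

definition is_baer_sum ::
  "'z::real_vector topology \<Rightarrow> 'y::real_vector topology \<Rightarrow>
   ('y, 'x::real_vector, 'z) ext \<Rightarrow> ('y, 'w::real_vector, 'z) ext \<Rightarrow> ('y, 'p::real_vector, 'z) ext \<Rightarrow> bool" where
  "is_baer_sum Z Y E1 E2 E \<longleftrightarrow>
     is_pushout_ext (prod_topology Y Y) Y (\<lambda>(y, y'). y + y')
       (pullback_ext Z (\<lambda>z. (z, z)) (product_ext E1 E2)) E"


section \<open>The group of extensions\<close>

text \<open>
  Middle spaces of unrestricted type do not form a set. As a vector space every extension of \<open>Z\<close>
  by \<open>Y\<close> is isomorphic to \<open>Y \<times> Z\<close>, so it loses no equivalence class to take middle spaces in
  the type \<open>'y \<times> 'z\<close>, with an arbitrary linear subspace as carrier and an arbitrary topology;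
  this is \<open>extension_representative\<close> below.
\<close>

definition ext_rel ::
  "'z::real_vector topology \<Rightarrow> 'y::real_vector topology \<Rightarrow> ('y, 'y \<times> 'z, 'z) ext rel" where
  "ext_rel Z Y = {(E, E'). extension Z Y E \<and> extension Z Y E' \<and> ext_equiv Z Y E E'}"

definition Ext_TVS ::
  "'z::real_vector topology \<Rightarrow> 'y::real_vector topology \<Rightarrow> ('y, 'y \<times> 'z, 'z) ext set monoid" where
  "Ext_TVS Z Y =
     \<lparr>carrier = {E. extension Z Y E} // ext_rel Z Y,
      mult = (\<lambda>a b. \<Union>E1\<in>a. \<Union>E2\<in>b. ext_rel Z Y `` {E. is_baer_sum Z Y E1 E2 E}),
      one = ext_rel Z Y `` {trivial_ext Z Y}\<rparr>"

lemma continuous_map_into_pullback_topology: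
  assumes "continuous_map T X (f \<circ> g)" "g ` topspace T \<subseteq> A"
  shows "continuous_map T (pullback_topology A f X) g"
  using assms by (intro continuous_map_pullback') auto

lemma tvs_pullback_topology:
  fixes f :: "'a::real_vector \<Rightarrow> 'b::real_vector"
  assumes X: "tvs X" and A: "subspace A" and lin: "linear_on A f"
    and bij: "bij_betw f A (topspace X)"
  shows "tvs (pullback_topology A f X)" "topspace (pullback_topology A f X) = A"
    "continuous_map (pullback_topology A f X) X f"
proof -
  let ?P = "pullback_topology A f X"
  show top: "topspace ?P = A"
    using bij by (auto simp: topspace_pullback_topology bij_betw_def)
  show cont: "continuous_map ?P X f"
    using continuous_map_pullback[of X X id A f] by simp
  have "Hausdorff_space ?P"
    using X bij cont top Hausdorff_space_injective_preimage[of X ?P f]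
    by (auto simp: tvs_def bij_betw_def)
  moreover have "continuous_map (prod_topology ?P ?P) ?P (\<lambda>(x, y). x + y)"
  proof (rule continuous_map_into_pullback_topology)
    have "continuous_map (prod_topology ?P ?P) (prod_topology X X) (\<lambda>(x, y). (f x, f y))"
      using cont by (simp add: continuous_map_prod_top)
    then have "continuous_map (prod_topology ?P ?P) X ((\<lambda>(x, y). x + y) \<circ> (\<lambda>(x, y). (f x, f y)))"
      using X unfolding tvs_def by (blast intro: continuous_map_compose)
    then show "continuous_map (prod_topology ?P ?P) X (f \<circ> (\<lambda>(x, y). x + y))"
      by (rule continuous_map_eq) (use lin in \<open>auto simp: linear_on_def top\<close>)
    show "(\<lambda>(x, y). x + y) ` topspace (prod_topology ?P ?P) \<subseteq> A"
      using A by (auto simp: top subspace_def)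
  qed
  moreover have "continuous_map (prod_topology euclideanreal ?P) ?P (\<lambda>(r, x). r *\<^sub>R x)"
  proof (rule continuous_map_into_pullback_topology)
    have "continuous_map (prod_topology euclideanreal ?P) (prod_topology euclideanreal X)
        (\<lambda>(r, x). (id r, f x))"
      using cont by (subst continuous_map_prod_top) simp
    then have "continuous_map (prod_topology euclideanreal ?P) X
        ((\<lambda>(r, x). r *\<^sub>R x) \<circ> (\<lambda>(r, x). (id r, f x)))"
      using X unfolding tvs_def by (blast intro: continuous_map_compose)
    then show "continuous_map (prod_topology euclideanreal ?P) X (f \<circ> (\<lambda>(r, x). r *\<^sub>R x))"
      by (rule continuous_map_eq) (use lin in \<open>auto simp: linear_on_def top\<close>)
    show "(\<lambda>(r, x). r *\<^sub>R x) ` topspace (prod_topology euclideanreal ?P) \<subseteq> A"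
      using A by (auto simp: top subspace_def)
  qed
  ultimately show "tvs ?P"
    using A top by (simp add: tvs_def)
qed

lemma linear_on_sum:
  assumes "linear_on S f" "subspace S" "finite I" "\<And>k. k \<in> I \<Longrightarrow> g k \<in> S"
  shows "f (\<Sum>k\<in>I. c k *\<^sub>R g k) = (\<Sum>k\<in>I. c k *\<^sub>R f (g k))"
  using assms(3,4)
proof (induction I rule: finite_induct)
  case empty
  have "0 \<in> S" using assms(2) by (simp add: subspace_def)
  then have "f (0 *\<^sub>R 0) = 0 *\<^sub>R f 0"
    using assms(1) unfolding linear_on_def by blast
  then show ?case by simp
next
  case (insert k I)
  have "c k *\<^sub>R g k \<in> S" "(\<Sum>k\<in>I. c k *\<^sub>R g k) \<in> S"
    using insert assms(2) by (auto intro: subspace_scale subspace_sum)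
  moreover have "f (c k *\<^sub>R g k) = c k *\<^sub>R f (g k)"
    using insert assms(1) by (auto simp: linear_on_def)
  ultimately show ?case
    using insert assms(1) by (simp add: linear_on_def)
qed

lemma linear_section_exists:
  fixes p :: "'x::real_vector \<Rightarrow> 'z::real_vector"
  assumes S: "subspace S" and R: "subspace R" and lin: "linear_on S p" and surj: "p ` S = R"
  obtains s where "linear s" "\<And>z. z \<in> R \<Longrightarrow> s z \<in> S" "\<And>z. z \<in> R \<Longrightarrow> p (s z) = z"
proof -
  obtain B where B: "B \<subseteq> R" "independent B" "R \<subseteq> span B"
    using maximal_independent_subset[of R] by blast
  have span: "span B = R"
    using B R by (simp add: span_minimal subset_antisym)
  define g where "g = (\<lambda>z. SOME x. x \<in> S \<and> p x = z)"
  have g: "g b \<in> S \<and> p (g b) = b" if "b \<in> B" for b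
    unfolding g_def by (rule someI_ex) (use that B surj in blast)
  obtain s where s: "linear s" "\<And>b. b \<in> B \<Longrightarrow> s b = g b"
    using linear_independent_extend[OF B(2), of g] by blast
  have "s z \<in> S \<and> p (s z) = z" if "z \<in> R" for z
  proof -
    have "z \<in> span B" using that span by simp
    then obtain I c where I: "finite I" "I \<subseteq> B" "z = (\<Sum>b\<in>I. c b *\<^sub>R b)"
      unfolding span_explicit by blast
    have sz: "s z = (\<Sum>b\<in>I. c b *\<^sub>R g b)"
      using I s by (simp add: linear_sum linear_scale subset_iff)
    have "p (s z) = (\<Sum>b\<in>I. c b *\<^sub>R p (g b))"
      unfolding sz using I g by (intro linear_on_sum[OF lin S]) auto
    also have "\<dots> = z"
      using I g by (auto intro!: sum.cong)
    finally have "p (s z) = z" .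
    moreover have "s z \<in> S"
      unfolding sz using I g S by (auto intro!: subspace_sum subspace_scale)
    ultimately show ?thesis by blast
  qed
  with s(1) show thesis using that by blast
qed

proposition extension_representative:
  fixes E :: "('y::real_vector, 'x::real_vector, 'z::real_vector) ext"
  assumes "extension Z Y E"
  shows "\<exists>E' :: ('y, 'y \<times> 'z, 'z) ext. extension Z Y E' \<and> ext_equiv Z Y E E' \<and> ext_equiv Z Y E' E"
proof -
  obtain X i p where E: "E = (X, i, p)" by (cases E)
  let ?X = "topspace X" and ?Y = "topspace Y" and ?Z = "topspace Z"
  have tvs: "tvs Y" "tvs X" "tvs Z"
    and ic: "continuous_map Y X i" and il: "linear_on ?Y i" and io: "open_onto_image Y X i"
    and pc: "continuous_map X Z p" and pl: "linear_on ?X p" and po: "open_onto_image X Z p"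
    and inj: "inj_on i ?Y" and ker: "i ` ?Y = {x \<in> ?X. p x = 0}" and surj: "p ` ?X = ?Z"
    using assms by (auto simp: extension_def continuous_linear_def E)
  have sub: "subspace ?X" "subspace ?Y" "subspace ?Z"
    using tvs by (auto simp: tvs_def)
  obtain s where s: "linear s" "\<And>z. z \<in> ?Z \<Longrightarrow> s z \<in> ?X" "\<And>z. z \<in> ?Z \<Longrightarrow> p (s z) = z"
    using linear_section_exists[OF sub(1) sub(3) pl surj] by blast
  have iX: "i y \<in> ?X" "p (i y) = 0" if "y \<in> ?Y" for y
    using ker that by blast+
  define f where "f = (\<lambda>(y, z). i y + s z)"
  define A where "A = ?Y \<times> ?Z"
  have A: "subspace A"
    unfolding A_def by (rule subspace_Times[OF sub(2,3)])
  have fl: "linear_on A f"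
    using il s(1) by (auto simp: linear_on_def A_def f_def linear_add linear_scale algebra_simps)
  have fX: "f w \<in> ?X" if "w \<in> A" for w
    using that iX s sub by (auto simp: A_def f_def subspace_add)
  have pf: "p (f w) = snd w" if "w \<in> A" for w
    using that iX s pl by (auto simp: A_def f_def linear_on_def)
  have bij: "bij_betw f A ?X"
  proof (rule bij_betw_imageI)
    show "inj_on f A"
    proof (rule inj_onI)
      fix v w assume vw: "v \<in> A" "w \<in> A" "f v = f w"
      then have "snd v = snd w" using pf by metis
      moreover have "i (fst v) = i (fst w)"
        using vw \<open>snd v = snd w\<close> by (simp add: f_def case_prod_beta)
      moreover have "fst v \<in> ?Y" "fst w \<in> ?Y"
        using vw by (auto simp: A_def)
      ultimately show "v = w"
        using inj by (simp add: inj_on_eq_iff prod_eq_iff)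
    qed
    have "x \<in> f ` A" if x: "x \<in> ?X" for x
    proof -
      have px: "p x \<in> ?Z" using x surj by blast
      have sx: "s (p x) \<in> ?X" using s px by blast
      have m: "- s (p x) \<in> ?X" using sx sub(1) by (simp add: subspace_neg)
      have "p (- s (p x)) = - p (s (p x))"
        using pl sx unfolding linear_on_def by (metis scaleR_minus1_left)
      moreover have "p (x + - s (p x)) = p x + p (- s (p x))"
        using pl x m unfolding linear_on_def by blast
      ultimately have "p (x + - s (p x)) = 0"
        using s(3)[OF px] by simp
      then have "x + - s (p x) \<in> i ` ?Y"
        using ker x m sub(1) by (simp add: subspace_add del: add_uminus_conv_diff)
      then obtain y where y: "y \<in> ?Y" "x - s (p x) = i y" by auto
      then have "x = f (y, p x)" by (simp add: f_def algebra_simps)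
      then show ?thesis using y px by (auto simp: A_def)
    qed
    then show "f ` A = ?X" using fX by blast
  qed
  define P where "P = pullback_topology A f X"
  have P: "tvs P" "topspace P = A" "continuous_map P X f"
    unfolding P_def using tvs_pullback_topology[OF tvs(2) A fl bij] by auto
  define h where "h = the_inv_into A f"
  have hf: "h (f w) = w" if "w \<in> A" for w
    using that bij by (simp add: h_def the_inv_into_f_f bij_betw_def)
  have fh: "f (h x) = x" "h x \<in> A" if "x \<in> ?X" for x
    using that bij by (auto simp: h_def f_the_inv_into_f_bij_betw bij_betw_def the_inv_into_into)
  have hc: "continuous_map X P h"
    unfolding P_def
  proof (rule continuous_map_into_pullback_topology)
    show "continuous_map X X (f \<circ> h)"
      by (rule continuous_map_eq[OF continuous_map_id]) (simp add: fh)
  qed (use fh in auto)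
  have hl: "linear_on ?X h"
    unfolding linear_on_def
  proof (intro conjI ballI allI)
    fix x y assume "x \<in> ?X" "y \<in> ?X"
    then have "h (f (h x + h y)) = h (x + y)" "h x + h y \<in> A"
      using fl fh A by (auto simp: linear_on_def subspace_add)
    then show "h (x + y) = h x + h y" using hf by simp
  next
    fix r x assume "x \<in> ?X"
    then have "h (f (r *\<^sub>R h x)) = h (r *\<^sub>R x)" "r *\<^sub>R h x \<in> A"
      using fl fh A by (auto simp: linear_on_def subspace_scale)
    then show "h (r *\<^sub>R x) = r *\<^sub>R h x" using hf by simp
  qed
  have s0: "s 0 = 0" using s(1) by (rule linear_0)
  have fi: "f (y, 0) = i y" for y by (simp add: f_def s0)
  have iA: "(y, 0) \<in> A" if "y \<in> ?Y" for y
    using that sub by (simp add: A_def subspace_0)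
  have jc: "continuous_map Y P (\<lambda>y. (y, 0))"
    unfolding P_def by (rule continuous_map_into_pullback_topology) (use ic iA in \<open>auto simp: fi o_def\<close>)
  have jo: "open_onto_image Y P (\<lambda>y. (y, 0))"
    unfolding open_onto_image_def open_map_def
  proof (intro allI impI)
    fix U assume U: "openin Y U"
    then have "openin (subtopology X (i ` ?Y)) (i ` U)"
      using io by (simp add: open_onto_image_def open_map_def)
    then obtain V where V: "openin X V" "i ` U = V \<inter> i ` ?Y"
      by (auto simp: openin_subtopology)
    have UY: "U \<subseteq> ?Y" using U by (rule openin_subset)
    have "(\<lambda>y. (y, 0)) ` U = (f -` V \<inter> A) \<inter> (\<lambda>y. (y, 0::'z)) ` ?Y"
    proof (intro equalityI subsetI)
      fix w assume "w \<in> (\<lambda>y. (y, 0::'z)) ` U"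
      then show "w \<in> (f -` V \<inter> A) \<inter> (\<lambda>y. (y, 0)) ` ?Y"
        using UY V(2) iA by (auto simp: fi)
    next
      fix w assume "w \<in> (f -` V \<inter> A) \<inter> (\<lambda>y. (y, 0::'z)) ` ?Y"
      then obtain y where y: "w = (y, 0)" "y \<in> ?Y" "i y \<in> V" by (auto simp: fi)
      then have "i y \<in> i ` U" using V(2) by blast
      then have "y \<in> U" using inj UY y by (auto simp: inj_on_def)
      then show "w \<in> (\<lambda>y. (y, 0)) ` U" using y by blast
    qed
    moreover have "openin P (f -` V \<inter> A)"
      unfolding P_def openin_pullback_topology using V(1) by blast
    ultimately show "openin (subtopology P ((\<lambda>y. (y, 0)) ` ?Y)) ((\<lambda>y. (y, 0)) ` U)"
      by (auto simp: openin_subtopology)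
  qed
  have "continuous_map P Z (p \<circ> f)"
    using P(3) pc by (rule continuous_map_compose)
  then have rc: "continuous_map P Z snd"
    by (rule continuous_map_eq) (simp add: P pf)
  have rsurj: "snd ` A = ?Z"
    using sub(2) by (force simp: A_def subspace_def)
  have ro: "open_onto_image P Z snd"
    unfolding open_onto_image_def open_map_def P rsurj
  proof (intro allI impI)
    fix U assume "openin P U"
    then obtain V where V: "openin X V" "U = f -` V \<inter> A"
      unfolding P_def openin_pullback_topology by blast
    have "V \<subseteq> ?X" using V(1) by (rule openin_subset)
    have "f ` U = V"
    proof (intro equalityI subsetI)
      fix x assume "x \<in> V"
      then have "f (h x) = x" "h x \<in> A" using fh \<open>V \<subseteq> ?X\<close> by auto
      then have "h x \<in> U" using \<open>x \<in> V\<close> V(2) by simp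
      then show "x \<in> f ` U" using \<open>f (h x) = x\<close> by (metis imageI)
    qed (simp add: V(2) image_iff, elim bexE, simp)
    moreover have "snd ` U = (\<lambda>w. p (f w)) ` U"
      using V(2) pf by (intro image_cong) auto
    ultimately have "snd ` U = p ` V"
      by (metis image_image)
    moreover have "openin Z (p ` V)"
      using po V(1) by (simp add: open_onto_image_def open_map_def surj)
    ultimately show "openin (subtopology Z ?Z) (snd ` U)" by simp
  qed
  have jker: "(\<lambda>y. (y, 0)) ` ?Y = {w \<in> A. snd w = 0}"
    using sub(3) by (auto simp: A_def subspace_0)
  have "extension Z Y (P, \<lambda>y. (y, 0), snd)"
    using tvs P jc jo rc ro rsurj jker
    by (auto simp: extension_def continuous_linear_def linear_on_def inj_on_def)
  moreover have "ext_equiv Z Y E (P, \<lambda>y. (y, 0), snd)"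
    unfolding ext_equiv_def E prod.case continuous_linear_def
    using hc hl fi hf iA fh pf by (intro exI[of _ h]) metis
  moreover have "ext_equiv Z Y (P, \<lambda>y. (y, 0), snd) E"
    unfolding ext_equiv_def E prod.case continuous_linear_def
    using P fl fi pf by (intro exI[of _ f]) auto
  ultimately show ?thesis by blast
qed

end

theory Submission
  imports Defs "HOL-Algebra.Coset"
begin

text \<open>
  The isomorphism is the restriction of an extension \<open>0 \<rightarrow> Y \<rightarrow> X \<rightarrow> Z \<rightarrow> 0\<close> to \<open>D\<close>, that is
  \<open>0 \<rightarrow> Y \<rightarrow> p\<^sup>-\<^sup>1(D) \<rightarrow> D \<rightarrow> 0\<close> (\<open>restrict_ext\<close>).

  The group structure becomes manageable once Baer sums are described without a push-out: an
  extension \<open>E\<close> is a Baer sum of \<open>E1\<close> and \<open>E2\<close> if and only if there is a continuous linear map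
  \<open>m\<close> from the fibre product of \<open>X1\<close> and \<open>X2\<close> over \<open>Z\<close> to the middle space of \<open>E\<close> that covers
  the identity of \<open>Z\<close> and adds the two copies of \<open>Y\<close> (\<open>is_baer_sum_iff_ext_sum\<close>). Such a map is
  automatically open and onto, by the topological form of the five lemma proved in
  \<open>open_map_onto_middle\<close>. Hence it is a quotient map with known kernel, which makes sums unique up
  to equivalence, and the laws of an abelian group follow by exhibiting suitable maps \<open>m\<close>.
  Restricting \<open>m\<close> shows that restriction is a homomorphism.

  Restriction is injective because \<open>Y\<close> is complete. If the restriction of \<open>E\<close> to \<open>D\<close> splits, there
  is a continuous linear retraction from \<open>p\<^sup>-\<^sup>1(D)\<close> onto \<open>Y\<close>. As \<open>p\<close> is open, \<open>p\<^sup>-\<^sup>1(D)\<close> is dense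
  in \<open>X\<close>, so the retraction extends to \<open>X\<close>, and \<open>E\<close> splits (\<open>trivial_on_dense_imp_trivial\<close>).

  Restriction is surjective because \<open>Y\<close> is metrizable. Let \<open>0 \<rightarrow> Y \<rightarrow> X \<rightarrow> D \<rightarrow> 0\<close> be an
  extension. Countably many neighbourhoods \<open>U k\<close> of zero in \<open>X\<close> describe the topology of \<open>Y\<close>, and
  together with the topology of \<open>D\<close> they describe that of \<open>X\<close> (\<open>U_base_of_topology\<close>). So
  only sequences are needed to reach the missing points of \<open>Z\<close>: there are linear maps \<open>c n\<close> from
  \<open>Z\<close> to \<open>X\<close>, all equal on \<open>D\<close> to one linear section of \<open>p\<close>, such that \<open>c n z\<close> is a Cauchy sequence for the
  \<open>U k\<close> whose image in \<open>D\<close> tends to \<open>z\<close> (\<open>linear_approximation\<close>). On the vector space \<open>Y \<times> Z\<close>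
  the sets of all \<open>(y, z)\<close> with \<open>i y + c n z \<in> U k\<close> for large \<open>n\<close>, intersected with the preimages
  of neighbourhoods in \<open>Z\<close>, are a base at zero of a vector topology that makes \<open>Y \<times> Z\<close> an extension
  of \<open>Z\<close> by \<open>Y\<close>, and its restriction to \<open>D\<close> is the given one (\<open>extension_to_closure\<close>). This replaces
  completions of \<open>X\<close> and \<open>Z\<close>.
\<close>

section \<open>Neighbourhoods of zero\<close>

text \<open>
  Vector topologies are invariant under translation, so linear maps and bases are compared at zero
  only.
\<close>

definition nbhd_zero :: "'a::real_vector topology \<Rightarrow> 'a set \<Rightarrow> bool" where
  "nbhd_zero X U \<longleftrightarrow> (\<exists>W. openin X W \<and> 0 \<in> W \<and> W \<subseteq> U)"

definition balanced_set :: "'a::real_vector set \<Rightarrow> bool" where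
  "balanced_set B \<longleftrightarrow> (\<forall>r. \<forall>x\<in>B. \<bar>r\<bar> \<le> 1 \<longrightarrow> r *\<^sub>R x \<in> B)"

lemma nbhd_zero_mono: "nbhd_zero X U \<Longrightarrow> U \<subseteq> V \<Longrightarrow> nbhd_zero X V"
  unfolding nbhd_zero_def by blast

lemma nbhd_zero_open: "openin X U \<Longrightarrow> 0 \<in> U \<Longrightarrow> nbhd_zero X U"
  unfolding nbhd_zero_def by blast

lemma nbhd_zero_Int: "nbhd_zero X U \<Longrightarrow> nbhd_zero X V \<Longrightarrow> nbhd_zero X (U \<inter> V)"
  unfolding nbhd_zero_def by (meson IntI Int_mono openin_Int)

lemma nbhd_zero_subtopology:
  assumes "nbhd_zero (subtopology X S) U"
  obtains V where "nbhd_zero X V" "V \<inter> S \<subseteq> U"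
  using assms unfolding nbhd_zero_def openin_subtopology by fastforce

lemma nbhd_zero_subtopologyI:
  assumes "nbhd_zero X V" "V \<inter> S \<subseteq> U" "0 \<in> S"
  shows "nbhd_zero (subtopology X S) U"
  using assms unfolding nbhd_zero_def openin_subtopology by blast

lemma tvs_subspace: "tvs X \<Longrightarrow> subspace (topspace X)"
  by (simp add: tvs_def)

lemma linear_onD:
  assumes "linear_on S f" "subspace S"
  shows "x \<in> S \<Longrightarrow> y \<in> S \<Longrightarrow> f (x + y) = f x + f y"
    and "x \<in> S \<Longrightarrow> f (r *\<^sub>R x) = r *\<^sub>R f x"
    and "f 0 = 0"
    and "x \<in> S \<Longrightarrow> f (- x) = - f x"
    and "x \<in> S \<Longrightarrow> y \<in> S \<Longrightarrow> f (x - y) = f x - f y"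
proof -
  show add: "x \<in> S \<Longrightarrow> y \<in> S \<Longrightarrow> f (x + y) = f x + f y" for x y
    using assms by (simp add: linear_on_def)
  show scale: "x \<in> S \<Longrightarrow> f (r *\<^sub>R x) = r *\<^sub>R f x" for x r
    using assms by (simp add: linear_on_def)
  show "f 0 = 0"
    using scale[of 0 0] assms(2) by (simp add: subspace_0)
  show neg: "x \<in> S \<Longrightarrow> f (- x) = - f x" for x
    using scale[of x "-1"] by simp
  show "x \<in> S \<Longrightarrow> y \<in> S \<Longrightarrow> f (x - y) = f x - f y"
    using add[of x "- y"] neg[of y] assms(2) by (simp add: subspace_neg)
qed

lemma nbhd_zero_continuous:
  assumes "continuous_map X Y f" "f 0 = 0" "0 \<in> topspace X" "nbhd_zero Y N"
  shows "nbhd_zero X {x \<in> topspace X. f x \<in> N}"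
proof -
  obtain W where "openin Y W" "0 \<in> W" "W \<subseteq> N"
    using assms(4) by (auto simp: nbhd_zero_def)
  moreover from this have "openin X {x \<in> topspace X. f x \<in> W}"
    using assms(1) by (simp add: openin_continuous_map_preimage)
  ultimately show ?thesis
    using assms(2,3) unfolding nbhd_zero_def by (intro exI[of _ "{x \<in> topspace X. f x \<in> W}"]) auto
qed

lemma nbhd_zero_prod:
  assumes "nbhd_zero (prod_topology X Y) U"
  obtains V W where "openin X V" "0 \<in> V" "openin Y W" "0 \<in> W" "V \<times> W \<subseteq> U"
proof -
  obtain Q where "openin (prod_topology X Y) Q" "0 \<in> Q" "Q \<subseteq> U"
    using assms by (auto simp: nbhd_zero_def)
  then have "\<exists>V W. openin X V \<and> openin Y W \<and> 0 \<in> V \<and> 0 \<in> W \<and> V \<times> W \<subseteq> Q"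
    unfolding openin_prod_topology_alt zero_prod_def by blast
  with \<open>Q \<subseteq> U\<close> show thesis
    using that by (meson subset_trans)
qed

lemma nbhd_zero_prodI:
  assumes "nbhd_zero X V" "nbhd_zero Y W"
  shows "nbhd_zero (prod_topology X Y) (V \<times> W)"
  using assms unfolding nbhd_zero_def zero_prod_def
  by (metis SigmaI Sigma_mono openin_prod_Times_iff)

lemma continuous_map_tvs_add:
  assumes "tvs X" "continuous_map T X f" "continuous_map T X g"
  shows "continuous_map T X (\<lambda>t. f t + g t)"
proof -
  have "continuous_map T (prod_topology X X) (\<lambda>t. (f t, g t))"
    using assms(2,3) by (rule continuous_map_pairedI)
  then have "continuous_map T X ((\<lambda>(x, y). x + y) \<circ> (\<lambda>t. (f t, g t)))"
    using assms(1) unfolding tvs_def by (blast intro: continuous_map_compose)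
  then show ?thesis by (simp add: o_def)
qed

lemma continuous_map_tvs_scale:
  assumes "tvs X" "continuous_map T X f"
  shows "continuous_map T X (\<lambda>t. r *\<^sub>R f t)"
proof -
  have "continuous_map T (prod_topology euclideanreal X) (\<lambda>t. (r, f t))"
    using assms(2) by (intro continuous_map_pairedI) auto
  then have "continuous_map T X ((\<lambda>(r, x). r *\<^sub>R x) \<circ> (\<lambda>t. (r, f t)))"
    using assms(1) unfolding tvs_def by (blast intro: continuous_map_compose)
  then show ?thesis by (simp add: o_def)
qed

lemma continuous_map_tvs_neg:
  "tvs X \<Longrightarrow> continuous_map T X f \<Longrightarrow> continuous_map T X (\<lambda>t. - f t)"
  using continuous_map_tvs_scale[of X T f "- 1"] by simp

lemma continuous_map_translation:
  "tvs X \<Longrightarrow> x \<in> topspace X \<Longrightarrow> continuous_map X X (\<lambda>v. x + v)"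
  by (intro continuous_map_tvs_add) auto

text \<open>
  Translations are homeomorphisms, so the neighbourhoods of zero determine all open sets. Hence
  continuity and openness of linear maps can be tested at zero.
\<close>

lemma openin_iff_nbhd_zero:
  assumes "tvs X"
  shows "openin X U \<longleftrightarrow>
    U \<subseteq> topspace X \<and> (\<forall>x\<in>U. nbhd_zero X {v \<in> topspace X. x + v \<in> U})" (is "_ = ?R")
proof
  assume U: "openin X U"
  have "nbhd_zero X {v \<in> topspace X. x + v \<in> U}" if "x \<in> U" for x
  proof (rule nbhd_zero_open)
    have "x \<in> topspace X" using U that openin_subset by blast
    then show "openin X {v \<in> topspace X. x + v \<in> U}"
      using continuous_map_translation[OF assms] U by (intro openin_continuous_map_preimage)
    show "0 \<in> {v \<in> topspace X. x + v \<in> U}"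
      using that assms by (auto simp: tvs_def subspace_0)
  qed
  then show ?R using U openin_subset by blast
next
  assume R: ?R
  show "openin X U"
  proof (subst openin_subopen, intro ballI)
    fix x assume x: "x \<in> U"
    then obtain W where W: "openin X W" "0 \<in> W" "W \<subseteq> {v \<in> topspace X. x + v \<in> U}"
      using R by (auto simp: nbhd_zero_def)
    have xX: "x \<in> topspace X" using R x by blast
    then have "- x \<in> topspace X" using assms by (simp add: tvs_def subspace_neg)
    then have "openin X {w \<in> topspace X. - x + w \<in> W}"
      using continuous_map_translation[OF assms] W(1) by (intro openin_continuous_map_preimage)
    moreover have "{w \<in> topspace X. - x + w \<in> W} \<subseteq> U"
    proof
      fix w assume "w \<in> {w \<in> topspace X. - x + w \<in> W}"
      then have "x + (- x + w) \<in> U" using W(3) by blast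
      then show "w \<in> U" by simp
    qed
    ultimately show "\<exists>T. openin X T \<and> x \<in> T \<and> T \<subseteq> U"
      using xX W(2) by (intro exI[of _ "{w \<in> topspace X. - x + w \<in> W}"]) auto
  qed
qed

lemma continuous_map_at_zero:
  assumes X: "tvs X" and Y: "tvs Y" and lin: "linear_on (topspace X) f"
    and maps: "f ` topspace X \<subseteq> topspace Y"
    and zero: "\<And>N. nbhd_zero Y N \<Longrightarrow> nbhd_zero X {x \<in> topspace X. f x \<in> N}"
  shows "continuous_map X Y f"
  unfolding continuous_map_def
proof (intro conjI allI impI)
  show "f \<in> topspace X \<rightarrow> topspace Y" using maps by blast
  fix U assume U: "openin Y U"
  show "openin X {x \<in> topspace X. f x \<in> U}"
    unfolding openin_iff_nbhd_zero[OF X]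
  proof (intro conjI ballI)
    fix x assume x: "x \<in> {x \<in> topspace X. f x \<in> U}"
    then have "nbhd_zero Y {v \<in> topspace Y. f x + v \<in> U}"
      using U by (auto simp: openin_iff_nbhd_zero[OF Y])
    from zero[OF this]
    show "nbhd_zero X {v \<in> topspace X. x + v \<in> {x \<in> topspace X. f x \<in> U}}"
      by (rule nbhd_zero_mono)
        (use x linear_onD[OF lin tvs_subspace[OF X]] X in \<open>auto simp: tvs_def subspace_add\<close>)
  qed auto
qed

lemma open_map_at_zero:
  assumes X: "tvs X" and Y: "tvs Y" and lin: "linear_on (topspace X) f"
    and maps: "f ` topspace X \<subseteq> topspace Y"
    and zero: "\<And>U. nbhd_zero X U \<Longrightarrow> U \<subseteq> topspace X \<Longrightarrow> nbhd_zero Y (f ` U)"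
  shows "open_map X Y f"
  unfolding open_map_def
proof (intro allI impI)
  fix U assume U: "openin X U"
  then have UX: "U \<subseteq> topspace X" by (rule openin_subset)
  show "openin Y (f ` U)"
    unfolding openin_iff_nbhd_zero[OF Y]
  proof (intro conjI ballI)
    show "f ` U \<subseteq> topspace Y" using UX maps by blast
    fix w assume "w \<in> f ` U"
    then obtain x where x: "x \<in> U" "w = f x" by blast
    have "nbhd_zero X {v \<in> topspace X. x + v \<in> U}"
      using U x by (auto simp: openin_iff_nbhd_zero[OF X])
    then have "nbhd_zero Y (f ` {v \<in> topspace X. x + v \<in> U})"
      by (rule zero) auto
    then show "nbhd_zero Y {v \<in> topspace Y. w + v \<in> f ` U}"
    proof (rule nbhd_zero_mono)
      show "f ` {v \<in> topspace X. x + v \<in> U} \<subseteq> {v \<in> topspace Y. w + v \<in> f ` U}"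
        using x UX maps linear_onD(1)[OF lin tvs_subspace[OF X], symmetric]
        by (auto intro!: imageI)
    qed
  qed
qed

lemma open_map_nbhd_zero:
  assumes "open_map X Y f" "f 0 = 0" "nbhd_zero X U"
  shows "nbhd_zero Y (f ` U)"
  using assms unfolding nbhd_zero_def open_map_def by (metis image_eqI image_mono)

text \<open>
  Continuity of scalar multiplication at \<open>(0, 0)\<close> gives an open \<open>B\<close> around zero and an \<open>e > 0\<close>
  such that all \<open>r B\<close> with \<open>\<bar>r\<bar> < e\<close> lie in \<open>U\<close>. Their union over \<open>r \<noteq> 0\<close> is balanced, and it is
  open because multiplication by such an \<open>r\<close> is a homeomorphism.
\<close>

lemma balanced_nbhd_zero:
  assumes X: "tvs X" and U: "nbhd_zero X U"
  obtains V where "openin X V" "0 \<in> V" "balanced_set V" "V \<subseteq> U"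
proof -
  let ?s = "\<lambda>(r, x). r *\<^sub>R x"
  have sub: "subspace (topspace X)" using X by (rule tvs_subspace)
  obtain W where W: "openin X W" "0 \<in> W" "W \<subseteq> U"
    using U by (auto simp: nbhd_zero_def)
  have sc: "continuous_map (prod_topology euclideanreal X) X ?s" using X by (simp add: tvs_def)
  have "nbhd_zero (prod_topology euclideanreal X) {p \<in> topspace (prod_topology euclideanreal X). ?s p \<in> W}"
    by (rule nbhd_zero_continuous[OF sc])
      (use W sub in \<open>auto simp: zero_prod_def subspace_0 intro: nbhd_zero_open\<close>)
  then obtain A B where AB: "openin euclideanreal A" "0 \<in> A" "openin X B" "0 \<in> B"
     "A \<times> B \<subseteq> {p \<in> topspace (prod_topology euclideanreal X). ?s p \<in> W}"
    by (rule nbhd_zero_prod)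
  obtain e where e: "e > 0" "ball 0 e \<subseteq> A"
    using AB(1,2) by (auto simp: open_contains_ball)
  have BX: "B \<subseteq> topspace X" using AB(3) by (rule openin_subset)
  have op: "openin X ((\<lambda>x. r *\<^sub>R x) ` B)" if "r \<noteq> 0" for r
  proof -
    have "continuous_map X (prod_topology euclideanreal X) (\<lambda>v. (inverse r, v))"
      by (intro continuous_map_pairedI) auto
    then have "continuous_map X X (?s \<circ> (\<lambda>v. (inverse r, v)))"
      using sc by (blast intro: continuous_map_compose)
    then have "openin X {x \<in> topspace X. inverse r *\<^sub>R x \<in> B}"
      using openin_continuous_map_preimage[OF _ AB(3)] by (force simp: o_def)
    moreover have "{x \<in> topspace X. inverse r *\<^sub>R x \<in> B} = (\<lambda>x. r *\<^sub>R x) ` B"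
    proof (intro equalityI subsetI)
      fix x assume "x \<in> {x \<in> topspace X. inverse r *\<^sub>R x \<in> B}"
      then have "inverse r *\<^sub>R x \<in> B" "x = r *\<^sub>R inverse r *\<^sub>R x" using that by auto
      then show "x \<in> (\<lambda>x. r *\<^sub>R x) ` B" by blast
    qed (use that BX sub in \<open>auto simp: subspace_scale\<close>)
    ultimately show ?thesis by simp
  qed
  define V where "V = (\<Union>r\<in>{r. r \<noteq> 0 \<and> \<bar>r\<bar> < e}. (\<lambda>x. r *\<^sub>R x) ` B)"
  have V0: "0 \<in> V"
    unfolding V_def using AB(4) e(1) by (intro UN_I[of "e/2"]) (auto simp: image_iff)
  show thesis
  proof (rule that)
    show "openin X V" unfolding V_def using op by blast
    show "0 \<in> V" by (rule V0)
    show "V \<subseteq> U" using AB(5) e(2) W(3) by (force simp: V_def dist_norm)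
    show "balanced_set V"
      unfolding balanced_set_def
    proof (intro allI ballI impI)
      fix t :: real and v assume v: "v \<in> V" "\<bar>t\<bar> \<le> 1"
      then obtain r x where rx: "r \<noteq> 0" "\<bar>r\<bar> < e" "x \<in> B" "v = r *\<^sub>R x"
        by (auto simp: V_def)
      show "t *\<^sub>R v \<in> V"
      proof (cases "t = 0")
        case False
        moreover have "\<bar>t * r\<bar> \<le> \<bar>r\<bar>"
          using v(2) by (simp add: abs_mult mult_left_le_one_le)
        ultimately show ?thesis
          using rx unfolding V_def by (intro UN_I[of "t * r"]) auto
      qed (simp add: V0)
    qed
  qed
qed

lemma balanced_half_nbhd_zero:
  assumes X: "tvs X" and U: "nbhd_zero X U"
  obtains V where "openin X V" "0 \<in> V" "balanced_set V" "\<And>x y. x \<in> V \<Longrightarrow> y \<in> V \<Longrightarrow> x + y \<in> U"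
proof -
  let ?a = "\<lambda>(x, y). x + y"
  have "nbhd_zero (prod_topology X X) {p \<in> topspace (prod_topology X X). ?a p \<in> U}"
    by (rule nbhd_zero_continuous)
      (use X U in \<open>auto simp: tvs_def zero_prod_def subspace_0\<close>)
  then obtain A B where AB: "openin X A" "0 \<in> A" "openin X B" "0 \<in> B"
     "A \<times> B \<subseteq> {p \<in> topspace (prod_topology X X). ?a p \<in> U}"
    by (rule nbhd_zero_prod)
  have "nbhd_zero X (A \<inter> B)" using AB by (auto intro: nbhd_zero_open)
  then obtain V where V: "openin X V" "0 \<in> V" "balanced_set V" "V \<subseteq> A \<inter> B"
    using balanced_nbhd_zero[OF X] by blast
  have "x + y \<in> U" if "x \<in> V" "y \<in> V" for x y
  proof -
    have "(x, y) \<in> A \<times> B" using that V(4) by blast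
    then show ?thesis using AB(5) by auto
  qed
  with V show thesis using that by blast
qed

lemma balanced_neg: "balanced_set B \<Longrightarrow> x \<in> B \<Longrightarrow> - x \<in> B"
  unfolding balanced_set_def by (metis abs_minus abs_one order_refl scaleR_minus1_left)

lemma nbhd_zero_absorbing:
  assumes X: "tvs X" and U: "nbhd_zero X U" and x: "x \<in> topspace X"
  shows "\<exists>e>0. e *\<^sub>R x \<in> U"
proof -
  have "continuous_map euclideanreal (prod_topology euclideanreal X) (\<lambda>r. (r, x))"
    using x by (intro continuous_map_pairedI) auto
  then have "continuous_map euclideanreal X ((\<lambda>(r, x). r *\<^sub>R x) \<circ> (\<lambda>r. (r, x)))"
    using X unfolding tvs_def by (blast intro: continuous_map_compose)
  then have "nbhd_zero euclideanreal {r \<in> topspace euclideanreal. ((\<lambda>(r, x). r *\<^sub>R x) \<circ> (\<lambda>r. (r, x))) r \<in> U}"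
    by (rule nbhd_zero_continuous) (use U in auto)
  then obtain W where W: "open W" "0 \<in> W" "W \<subseteq> {r. r *\<^sub>R x \<in> U}"
    by (auto simp: nbhd_zero_def o_def)
  then obtain e where "e > 0" "ball 0 e \<subseteq> W" by (auto simp: open_contains_ball)
  then have "e / 2 > 0" "e / 2 \<in> W" by (auto simp: dist_norm)
  then show ?thesis using W(3) by blast
qed

lemma Hausdorff_nbhd_zero:
  assumes X: "tvs X" and x: "x \<in> topspace X" "x \<noteq> 0"
  obtains U where "nbhd_zero X U" "x \<notin> U"
proof -
  have "0 \<in> topspace X" using X by (simp add: tvs_def subspace_0)
  then obtain U V where "openin X U" "openin X V" "0 \<in> U" "x \<in> V" "disjnt U V"
    using X x unfolding tvs_def Hausdorff_space_def by metis
  then show thesis using that[of U] by (auto simp: disjnt_def intro: nbhd_zero_open)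
qed

lemma tvs_prod_topology:
  fixes X :: "'a::real_vector topology" and Y :: "'b::real_vector topology"
  assumes X: "tvs X" and Y: "tvs Y"
  shows "tvs (prod_topology X Y)"
  unfolding tvs_def
proof (intro conjI)
  let ?P = "prod_topology X Y"
  show "subspace (topspace ?P)" using X Y by (simp add: tvs_def subspace_Times)
  show "Hausdorff_space ?P" using X Y by (simp add: tvs_def Hausdorff_space_prod_topology)
  have f: "continuous_map (prod_topology ?P ?P) X (fst \<circ> fst)"
    "continuous_map (prod_topology ?P ?P) X (fst \<circ> snd)"
    "continuous_map (prod_topology ?P ?P) Y (snd \<circ> fst)"
    "continuous_map (prod_topology ?P ?P) Y (snd \<circ> snd)"
    by (blast intro: continuous_map_compose continuous_map_fst continuous_map_snd)+
  have "continuous_map (prod_topology ?P ?P) X ((\<lambda>(x, y). x + y) \<circ> (\<lambda>w. (fst (fst w), fst (snd w))))"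
    using X f unfolding tvs_def
    by (intro continuous_map_compose[of _ "prod_topology X X"] continuous_map_pairedI) (auto simp: o_def)
  moreover have "continuous_map (prod_topology ?P ?P) Y ((\<lambda>(x, y). x + y) \<circ> (\<lambda>w. (snd (fst w), snd (snd w))))"
    using Y f unfolding tvs_def
    by (intro continuous_map_compose[of _ "prod_topology Y Y"] continuous_map_pairedI) (auto simp: o_def)
  ultimately have "continuous_map (prod_topology ?P ?P) ?P
      (\<lambda>w. (fst (fst w) + fst (snd w), snd (fst w) + snd (snd w)))"
    by (intro continuous_map_pairedI) (auto simp: o_def)
  then show "continuous_map (prod_topology ?P ?P) ?P (\<lambda>(x, y). x + y)"
    by (rule continuous_map_eq) auto
  let ?Q = "prod_topology euclideanreal ?P"
  have g: "continuous_map ?Q euclideanreal fst" "continuous_map ?Q X (fst \<circ> snd)"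
    "continuous_map ?Q Y (snd \<circ> snd)"
    by (blast intro: continuous_map_compose continuous_map_fst continuous_map_snd)+
  have "continuous_map ?Q X ((\<lambda>(r, x). r *\<^sub>R x) \<circ> (\<lambda>w. (fst w, fst (snd w))))"
    using X g unfolding tvs_def
    by (intro continuous_map_compose[of _ "prod_topology euclideanreal X"] continuous_map_pairedI) (auto simp: o_def)
  moreover have "continuous_map ?Q Y ((\<lambda>(r, x). r *\<^sub>R x) \<circ> (\<lambda>w. (fst w, snd (snd w))))"
    using Y g unfolding tvs_def
    by (intro continuous_map_compose[of _ "prod_topology euclideanreal Y"] continuous_map_pairedI) (auto simp: o_def)
  ultimately have "continuous_map ?Q ?P (\<lambda>w. (fst w *\<^sub>R fst (snd w), fst w *\<^sub>R snd (snd w)))"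
    by (intro continuous_map_pairedI) (auto simp: o_def)
  then show "continuous_map ?Q ?P (\<lambda>(r, x). r *\<^sub>R x)"
    by (rule continuous_map_eq) auto
qed

lemma tvs_subtopology:
  assumes X: "tvs X" and S: "subspace (topspace X \<inter> S)"
  shows "tvs (subtopology X S)"
  unfolding tvs_def
proof (intro conjI)
  show "subspace (topspace (subtopology X S))" using S by simp
  show "Hausdorff_space (subtopology X S)" using X by (simp add: tvs_def Hausdorff_space_subtopology)
  have "continuous_map (subtopology (prod_topology X X) (S \<times> S)) X (\<lambda>(x, y). x + y)"
    using X by (auto simp: tvs_def intro: continuous_map_from_subtopology)
  then show "continuous_map (prod_topology (subtopology X S) (subtopology X S)) (subtopology X S) (\<lambda>(x, y). x + y)"
    using S subspace_add[OF S]
    by (auto simp: continuous_map_in_subtopology subtopology_Times)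
  have "continuous_map (subtopology (prod_topology euclideanreal X) (UNIV \<times> S)) X (\<lambda>(r, x). r *\<^sub>R x)"
    using X by (auto simp: tvs_def intro: continuous_map_from_subtopology)
  then show "continuous_map (prod_topology euclideanreal (subtopology X S)) (subtopology X S) (\<lambda>(r, x). r *\<^sub>R x)"
    using S subspace_scale[OF S]
    by (auto simp: continuous_map_in_subtopology subtopology_Times)
qed

text \<open>
  The classical axioms for a base at zero of a vector topology on \<open>S\<close>. For balanced sets, one
  positive multiple of each vector suffices to express that they absorb.
\<close>

definition zero_base :: "'a::real_vector set \<Rightarrow> 'a set set \<Rightarrow> bool" where
  "zero_base S \<B> \<longleftrightarrow> \<B> \<noteq> {} \<and>
     (\<forall>B\<in>\<B>. \<forall>C\<in>\<B>. \<exists>A\<in>\<B>. A \<subseteq> B \<inter> C) \<and>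
     (\<forall>B\<in>\<B>. 0 \<in> B \<and> B \<subseteq> S \<and> balanced_set B \<and> (\<forall>x\<in>S. \<exists>e>0. e *\<^sub>R x \<in> B) \<and>
        (\<exists>C\<in>\<B>. \<forall>x\<in>C. \<forall>y\<in>C. x + y \<in> B))"

text \<open>
  A set is open if it contains, around each of its points, a translate of a member of the base.
  The members need not be open themselves, but the points around which \<open>B\<close> contains a translate
  form an open subset of \<open>B\<close>; hence the members of \<open>\<B>\<close> are a base of neighbourhoods of zero.
\<close>

lemma zero_base_tvs:
  fixes S :: "'a::real_vector set"
  assumes S: "subspace S" and base: "zero_base S \<B>"
    and sep: "\<And>x. x \<in> S \<Longrightarrow> x \<noteq> 0 \<Longrightarrow> \<exists>B\<in>\<B>. x \<notin> B"
  obtains X where "tvs X" "topspace X = S" "\<And>U. nbhd_zero X U \<longleftrightarrow> (\<exists>B\<in>\<B>. B \<subseteq> U)"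
proof -
  have ne: "\<B> \<noteq> {}" and inter: "\<And>B C. B \<in> \<B> \<Longrightarrow> C \<in> \<B> \<Longrightarrow> \<exists>A\<in>\<B>. A \<subseteq> B \<inter> C"
    and B0: "\<And>B. B \<in> \<B> \<Longrightarrow> 0 \<in> B" and BS: "\<And>B. B \<in> \<B> \<Longrightarrow> B \<subseteq> S"
    and bal: "\<And>B. B \<in> \<B> \<Longrightarrow> balanced_set B"
    and absorb: "\<And>B x. B \<in> \<B> \<Longrightarrow> x \<in> S \<Longrightarrow> \<exists>e>0. e *\<^sub>R x \<in> B"
    and half: "\<And>B. B \<in> \<B> \<Longrightarrow> \<exists>C\<in>\<B>. \<forall>x\<in>C. \<forall>y\<in>C. x + y \<in> B"
    using base unfolding zero_base_def by blast+
  define opn where "opn = (\<lambda>U. U \<subseteq> S \<and> (\<forall>x\<in>U. \<exists>B\<in>\<B>. \<forall>b\<in>B. x + b \<in> U))"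
  have "istopology opn"
    unfolding istopology_def
  proof (intro conjI allI impI)
    fix U V assume UV: "opn U" "opn V"
    show "opn (U \<inter> V)"
      unfolding opn_def
    proof (intro conjI ballI)
      fix x assume x: "x \<in> U \<inter> V"
      then obtain B C where BC: "B \<in> \<B>" "\<forall>b\<in>B. x + b \<in> U" "C \<in> \<B>" "\<forall>b\<in>C. x + b \<in> V"
        using UV unfolding opn_def by blast
      then obtain A where "A \<in> \<B>" "A \<subseteq> B \<inter> C" using inter by blast
      then show "\<exists>B\<in>\<B>. \<forall>b\<in>B. x + b \<in> U \<inter> V" using BC by blast
    qed (use UV opn_def in blast)
  next
    fix \<K> assume "\<forall>K\<in>\<K>. opn K"
    then show "opn (\<Union>\<K>)" unfolding opn_def by (metis Sup_le_iff UnionE UnionI)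
  qed
  define X where "X = topology opn"
  have op: "openin X U \<longleftrightarrow> U \<subseteq> S \<and> (\<forall>x\<in>U. \<exists>B\<in>\<B>. \<forall>b\<in>B. x + b \<in> U)" for U
    unfolding X_def topology_inverse'[OF \<open>istopology opn\<close>] by (simp add: opn_def)
  have top: "topspace X = S"
  proof
    show "topspace X \<subseteq> S" using op openin_topspace by blast
    have "openin X S"
      unfolding op
    proof (intro conjI ballI)
      fix x assume "x \<in> S"
      moreover obtain B where "B \<in> \<B>" using ne by blast
      ultimately show "\<exists>B\<in>\<B>. \<forall>b\<in>B. x + b \<in> S"
        using BS S by (intro bexI[of _ B]) (auto intro!: subspace_add)
    qed auto
    then show "S \<subseteq> topspace X" by (rule openin_subset)
  qed
  have nb: "nbhd_zero X U \<longleftrightarrow> (\<exists>B\<in>\<B>. B \<subseteq> U)" for U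
  proof
    assume "nbhd_zero X U"
    then obtain W where W: "openin X W" "0 \<in> W" "W \<subseteq> U" by (auto simp: nbhd_zero_def)
    then obtain B where "B \<in> \<B>" "\<forall>b\<in>B. 0 + b \<in> W" unfolding op by blast
    then show "\<exists>B\<in>\<B>. B \<subseteq> U" using W(3) by (intro bexI[of _ B]) auto
  next
    assume "\<exists>B\<in>\<B>. B \<subseteq> U"
    then obtain B where B: "B \<in> \<B>" "B \<subseteq> U" by blast
    define W where "W = {x \<in> S. \<exists>C\<in>\<B>. \<forall>c\<in>C. x + c \<in> B}"
    have "openin X W"
      unfolding op
    proof (intro conjI ballI)
      show "W \<subseteq> S" by (auto simp: W_def)
      fix x assume "x \<in> W"
      then obtain C where C: "x \<in> S" "C \<in> \<B>" "\<forall>c\<in>C. x + c \<in> B" by (auto simp: W_def)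
      obtain D where D: "D \<in> \<B>" "\<forall>x\<in>D. \<forall>y\<in>D. x + y \<in> C" using half C(2) by blast
      have "x + d \<in> W" if "d \<in> D" for d
      proof -
        have "\<forall>c\<in>D. x + d + c \<in> B" using D C(3) that by (simp add: add.assoc)
        moreover have "x + d \<in> S" using C(1) that D(1) BS S by (auto intro: subspace_add)
        ultimately show ?thesis using D(1) by (auto simp: W_def)
      qed
      then show "\<exists>B\<in>\<B>. \<forall>b\<in>B. x + b \<in> W" using D(1) by blast
    qed
    moreover have "0 \<in> W" using B(1) S by (auto simp: W_def subspace_0)
    moreover have "W \<subseteq> U"
    proof
      fix x assume "x \<in> W"
      then obtain C where "C \<in> \<B>" "\<forall>c\<in>C. x + c \<in> B" by (auto simp: W_def)
      then have "x + 0 \<in> B" using B0 by blast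
      then show "x \<in> U" using B(2) by auto
    qed
    ultimately show "nbhd_zero X U" by (auto simp: nbhd_zero_def)
  qed
  have core: "\<exists>W. openin X W \<and> x \<in> W \<and> W \<subseteq> {w. w - x \<in> B}"
    if xS: "x \<in> S" and BB: "B \<in> \<B>" for x B
  proof -
    obtain V where V: "openin X V" "0 \<in> V" "V \<subseteq> B" using nb[of B] BB unfolding nbhd_zero_def by blast
    have "openin X ((+) x ` V)"
      unfolding op
    proof (intro conjI ballI)
      show "(+) x ` V \<subseteq> S" using V(3) BS[OF BB] xS S by (auto intro: subspace_add)
      fix u assume "u \<in> (+) x ` V"
      then obtain v where v: "u = x + v" "v \<in> V" by blast
      then obtain C where "C \<in> \<B>" "\<forall>c\<in>C. v + c \<in> V" using V(1) unfolding op by blast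
      then show "\<exists>B\<in>\<B>. \<forall>b\<in>B. u + b \<in> (+) x ` V" using v(1) by (auto simp: add.assoc)
    qed
    moreover have "x \<in> (+) x ` V" using V(2) by (metis add.right_neutral image_eqI)
    moreover have "(+) x ` V \<subseteq> {w. w - x \<in> B}" using V(3) by auto
    ultimately show ?thesis by blast
  qed
  have "Hausdorff_space X"
    unfolding Hausdorff_space_def top
  proof (intro allI impI, elim conjE)
    fix x y assume xy: "x \<in> S" "y \<in> S" "x \<noteq> y"
    then have "y - x \<in> S" "y - x \<noteq> 0" using S by (auto simp: subspace_diff)
    then obtain B where B: "B \<in> \<B>" "y - x \<notin> B" using sep by blast
    obtain C where C: "C \<in> \<B>" "\<forall>x\<in>C. \<forall>y\<in>C. x + y \<in> B" using half B(1) by blast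
    obtain V W where VW: "openin X V" "x \<in> V" "V \<subseteq> {w. w - x \<in> C}"
        "openin X W" "y \<in> W" "W \<subseteq> {w. w - y \<in> C}"
      using core[OF xy(1) C(1)] core[OF xy(2) C(1)] by blast
    have "False" if "w \<in> V" "w \<in> W" for w
    proof -
      have "w - x \<in> C" "- (w - y) \<in> C" using that VW balanced_neg[OF bal[OF C(1)]] by blast+
      then have "(w - x) + - (w - y) \<in> B" using C(2) by blast
      then show False using B(2) by simp
    qed
    then show "\<exists>U V. openin X U \<and> openin X V \<and> x \<in> U \<and> y \<in> V \<and> disjnt U V"
      using VW by (auto simp: disjnt_def)
  qed
  moreover have "continuous_map (prod_topology X X) X (\<lambda>(x, y). x + y)"
    unfolding continuous_map_def top topspace_prod_topology
  proof (intro conjI allI impI)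
    show "(\<lambda>(x, y). x + y) \<in> S \<times> S \<rightarrow> S" using S by (auto simp: subspace_add)
    fix U assume U: "openin X U"
    show "openin (prod_topology X X) {p \<in> S \<times> S. (case p of (x, y) \<Rightarrow> x + y) \<in> U}"
      unfolding openin_prod_topology_alt
    proof (intro allI impI)
      fix x y assume xy: "(x, y) \<in> {p \<in> S \<times> S. (case p of (x, y) \<Rightarrow> x + y) \<in> U}"
      then obtain B where B: "B \<in> \<B>" "\<forall>b\<in>B. x + y + b \<in> U" using U unfolding op by auto
      obtain C where C: "C \<in> \<B>" "\<forall>x\<in>C. \<forall>y\<in>C. x + y \<in> B" using half B(1) by blast
      obtain V W where VW: "openin X V" "x \<in> V" "V \<subseteq> {w. w - x \<in> C}"
        "openin X W" "y \<in> W" "W \<subseteq> {w. w - y \<in> C}"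
        using core[of x C] core[of y C] C(1) xy by blast
      have "v + w \<in> U" if "v \<in> V" "w \<in> W" for v w
      proof -
        have "(v - x) + (w - y) \<in> B" using that VW C(2) by blast
        then have "x + y + ((v - x) + (w - y)) \<in> U" using B(2) by blast
        then show ?thesis by (simp add: algebra_simps)
      qed
      moreover have "V \<subseteq> S" "W \<subseteq> S" using VW op by auto
      ultimately show "\<exists>V W. openin X V \<and> openin X W \<and> x \<in> V \<and> y \<in> W \<and>
          V \<times> W \<subseteq> {p \<in> S \<times> S. (case p of (x, y) \<Rightarrow> x + y) \<in> U}"
        using VW by (intro exI[of _ V] exI[of _ W]) auto
    qed
  qed
  moreover have "continuous_map (prod_topology euclideanreal X) X (\<lambda>(r, x). r *\<^sub>R x)"
    unfolding continuous_map_def top topspace_prod_topology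
  proof (intro conjI allI impI)
    show "(\<lambda>(r, x). r *\<^sub>R x) \<in> topspace euclideanreal \<times> S \<rightarrow> S" using S by (auto simp: subspace_scale)
    fix U assume U: "openin X U"
    show "openin (prod_topology euclideanreal X) {p \<in> topspace euclideanreal \<times> S. (case p of (r, x) \<Rightarrow> r *\<^sub>R x) \<in> U}"
      unfolding openin_prod_topology_alt
    proof (intro allI impI)
      fix r x assume rx: "(r, x) \<in> {p \<in> topspace euclideanreal \<times> S. (case p of (r, x) \<Rightarrow> r *\<^sub>R x) \<in> U}"
      then obtain B where B: "B \<in> \<B>" "\<forall>b\<in>B. r *\<^sub>R x + b \<in> U" using U unfolding op by auto
      obtain C where C: "C \<in> \<B>" "\<forall>x\<in>C. \<forall>y\<in>C. x + y \<in> B" using half B(1) by blast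
      obtain e where e: "e > 0" "e *\<^sub>R x \<in> C" using absorb[OF C(1)] rx by auto
      \<comment> \<open>Multiplication by a scalar of modulus at most \<open>2 ^ n\<close> is \<open>n\<close> doublings followed by a
        multiplication that balanced sets absorb.\<close>
      have doubling: "\<exists>A\<in>\<B>. \<forall>a\<in>A. (2 ^ n) *\<^sub>R a \<in> C" for n :: nat
      proof (induction n)
        case (Suc n)
        then obtain A where A: "A \<in> \<B>" "\<forall>a\<in>A. (2 ^ n) *\<^sub>R a \<in> C" by blast
        obtain A' where A': "A' \<in> \<B>" "\<forall>x\<in>A'. \<forall>y\<in>A'. x + y \<in> A" using half A(1) by blast
        have "(2 ^ Suc n) *\<^sub>R a = (2 ^ n) *\<^sub>R (a + a)" for a :: 'a
          by (simp add: scaleR_add_right flip: scaleR_add_left)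
        then show ?case using A A' by (intro bexI[of _ A']) auto
      qed (use C(1) in auto)
      obtain n :: nat where n: "\<bar>r\<bar> + e < 2 ^ n"
        using real_arch_pow[of 2 "\<bar>r\<bar> + e"] by auto
      obtain A where A: "A \<in> \<B>" "\<forall>a\<in>A. (2 ^ n) *\<^sub>R a \<in> C" using doubling by blast
      obtain W where W: "openin X W" "x \<in> W" "W \<subseteq> {w. w - x \<in> A}"
        using core[of x A] A(1) rx by blast
      have "s *\<^sub>R w \<in> U" if s: "s \<in> ball r e" and w: "w \<in> W" for s w
      proof -
        have "\<bar>s - r\<bar> \<le> e" using s by (auto simp: dist_real_def)
        then have "\<bar>(s - r) / e\<bar> \<le> 1" "\<bar>s / 2 ^ n\<bar> \<le> 1"
          using e(1) n by (auto simp: abs_divide divide_le_eq_1)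
        then have "((s - r) / e) *\<^sub>R (e *\<^sub>R x) \<in> C" "(s / 2 ^ n) *\<^sub>R ((2 ^ n) *\<^sub>R (w - x)) \<in> C"
          using e(2) A(2) W(3) w bal[OF C(1)] unfolding balanced_set_def by blast+
        then have "(s - r) *\<^sub>R x \<in> C" "s *\<^sub>R (w - x) \<in> C" using e(1) by auto
        then have "r *\<^sub>R x + ((s - r) *\<^sub>R x + s *\<^sub>R (w - x)) \<in> U" using C(2) B(2) by blast
        then show ?thesis by (simp add: algebra_simps)
      qed
      moreover have "W \<subseteq> S" using W op by auto
      ultimately show "\<exists>V W. openin euclideanreal V \<and> openin X W \<and> r \<in> V \<and> x \<in> W \<and>
          V \<times> W \<subseteq> {p \<in> topspace euclideanreal \<times> S. (case p of (r, x) \<Rightarrow> r *\<^sub>R x) \<in> U}"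
        using W e(1) by (intro exI[of _ "ball r e"] exI[of _ W]) auto
    qed
  qed
  ultimately have "tvs X" using S top by (simp add: tvs_def)
  then show thesis using that top nb by blast
qed

section \<open>Extensions\<close>

locale tvs_extension =
  fixes Z :: "'z::real_vector topology" and Y :: "'y::real_vector topology"
    and X :: "'x::real_vector topology" and i :: "'y \<Rightarrow> 'x" and p :: "'x \<Rightarrow> 'z"
  assumes ext: "extension Z Y (X, i, p)"
begin

lemma tvs: "tvs Y" "tvs X" "tvs Z"
  and i_cont: "continuous_map Y X i" and i_lin: "linear_on (topspace Y) i"
  and p_cont: "continuous_map X Z p" and p_lin: "linear_on (topspace X) p"
  and i_inj: "inj_on i (topspace Y)"
  and kernel: "i ` topspace Y = {x \<in> topspace X. p x = 0}"
  and p_onto: "p ` topspace X = topspace Z"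
  using ext by (auto simp: extension_def continuous_linear_def)

lemma sub: "subspace (topspace Y)" "subspace (topspace X)" "subspace (topspace Z)"
  using tvs by (auto simp: tvs_def)

lemma zero_in: "0 \<in> topspace Y" "0 \<in> topspace X" "0 \<in> topspace Z"
  using sub by (auto simp: subspace_0)

lemmas i_linear = linear_onD[OF i_lin sub(1)]
lemmas p_linear = linear_onD[OF p_lin sub(2)]

lemma i_in: "y \<in> topspace Y \<Longrightarrow> i y \<in> topspace X"
  and p_i: "y \<in> topspace Y \<Longrightarrow> p (i y) = 0"
  using kernel by blast+

lemma p_in: "x \<in> topspace X \<Longrightarrow> p x \<in> topspace Z"
  using p_onto by blast

lemma p_open: "open_map X Z p"
  using ext p_onto by (simp add: extension_def open_onto_image_def)

lemma i_open: "open_map Y (subtopology X (i ` topspace Y)) i"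
  using ext unfolding extension_def open_onto_image_def by blast

lemma i_eq_0: "y \<in> topspace Y \<Longrightarrow> i y = 0 \<longleftrightarrow> y = 0"
  using i_inj i_linear(3) zero_in(1) by (metis inj_onD)

lemma kernelE:
  assumes "x \<in> topspace X" "p x = 0"
  obtains y where "y \<in> topspace Y" "x = i y"
proof -
  have "x \<in> i ` topspace Y" using assms by (simp add: kernel)
  then show thesis using that by blast
qed

lemma liftE:
  assumes "z \<in> topspace Z"
  obtains x where "x \<in> topspace X" "p x = z"
proof -
  have "z \<in> p ` topspace X" using assms by (simp add: p_onto)
  then show thesis using that by blast
qed

text \<open>
  The form in which openness of \<open>i\<close> onto its image is used: the topology of \<open>Y\<close> is the one induced
  from \<open>X\<close>.
\<close>

lemma i_embedding:
  assumes "nbhd_zero Y N"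
  obtains W where "openin X W" "0 \<in> W" "\<And>y. y \<in> topspace Y \<Longrightarrow> i y \<in> W \<Longrightarrow> y \<in> N"
proof -
  obtain N' where N': "openin Y N'" "0 \<in> N'" "N' \<subseteq> N" using assms by (auto simp: nbhd_zero_def)
  then have "openin (subtopology X (i ` topspace Y)) (i ` N')"
    using i_open by (simp add: open_map_def)
  then obtain W where W: "openin X W" "i ` N' = W \<inter> i ` topspace Y"
    by (auto simp: openin_subtopology)
  have "i 0 \<in> i ` N'" using N'(2) by blast
  then have "0 \<in> W" using W(2) i_linear(3) by auto
  moreover have "y \<in> N" if "y \<in> topspace Y" "i y \<in> W" for y
  proof -
    have "i y \<in> i ` N'" using that W(2) by blast
    then have "y \<in> N'" using i_inj that(1) openin_subset[OF N'(1)] by (auto simp: inj_on_def)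
    then show ?thesis using N'(3) by blast
  qed
  ultimately show thesis using that W(1) by blast
qed

lemma p_nbhd_zero: "nbhd_zero X U \<Longrightarrow> nbhd_zero Z (p ` U)"
  using open_map_nbhd_zero p_open p_linear(3) by blast

text \<open>
  Every extension splits algebraically: subtract a linear section of \<open>p\<close>. The retraction is in general
  not continuous.
\<close>

lemma linear_retraction:
  obtains h where "linear_on (topspace X) h" "h ` topspace X \<subseteq> topspace Y"
    "\<And>y. y \<in> topspace Y \<Longrightarrow> h (i y) = y"
proof -
  obtain s where s: "linear s" "\<And>z. z \<in> topspace Z \<Longrightarrow> s z \<in> topspace X"
      "\<And>z. z \<in> topspace Z \<Longrightarrow> p (s z) = z"
    using linear_section_exists[OF sub(2,3) p_lin p_onto] by blast
  have "x - s (p x) \<in> i ` topspace Y" if "x \<in> topspace X" for x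
    using that s p_in[OF that] p_linear(5) sub(2) by (simp add: kernel subspace_diff)
  then have "\<exists>y. y \<in> topspace Y \<and> i y = x - s (p x)" if "x \<in> topspace X" for x
    using that by (metis imageE)
  then obtain h where h: "\<And>x. x \<in> topspace X \<Longrightarrow> h x \<in> topspace Y \<and> i (h x) = x - s (p x)"
    by metis
  have eq: "h x = y" if "x \<in> topspace X" "y \<in> topspace Y" "i y = x - s (p x)" for x y
    using that h[OF that(1)] i_inj by (metis inj_onD)
  show thesis
  proof (rule that)
    show "linear_on (topspace X) h"
      unfolding linear_on_def
    proof (intro conjI allI ballI)
      fix x y assume xy: "x \<in> topspace X" "y \<in> topspace X"
      show "h (x + y) = h x + h y"
        by (rule eq)
          (use xy h sub s(1) i_linear(1) p_linear(1) in \<open>auto simp: subspace_add linear_add\<close>)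
    next
      fix r x assume x: "x \<in> topspace X"
      show "h (r *\<^sub>R x) = r *\<^sub>R h x"
        by (rule eq)
          (use x h sub s(1) i_linear(2) p_linear(2) in
            \<open>auto simp: subspace_scale linear_scale scaleR_diff_right\<close>)
    qed
    show "h ` topspace X \<subseteq> topspace Y" using h by blast
    show "h (i y) = y" if "y \<in> topspace Y" for y
      using that by (intro eq) (auto simp: i_in p_i linear_0[OF s(1)])
  qed
qed

text \<open>
  The topological content of the five lemma. To reach a small \<open>x\<close> in \<open>X\<close>, first correct its image in
  \<open>Z\<close> by a small \<open>w\<close> in \<open>F\<close>, using that \<open>p \<circ> m\<close> is open. The difference \<open>x - m w\<close> is small and lies
  in the kernel of \<open>p\<close>, hence is \<open>i y\<close> with \<open>y\<close> small because \<open>i\<close> is an embedding, and it is reached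
  by the small vector \<open>k y\<close>.
\<close>

lemma open_map_onto_middle:
  fixes F :: "'f::real_vector topology"
  assumes F: "tvs F" and m: "continuous_linear F X m"
    and op: "open_map F Z (\<lambda>w. p (m w))" and onto: "(\<lambda>w. p (m w)) ` topspace F = topspace Z"
    and k: "continuous_map Y F k" "k 0 = 0" "\<And>y. y \<in> topspace Y \<Longrightarrow> m (k y) = i y"
  shows "open_map F X m" "m ` topspace F = topspace X"
proof -
  have mc: "continuous_map F X m" and ml: "linear_on (topspace F) m"
    using m by (auto simp: continuous_linear_def)
  note m_linear = linear_onD[OF ml tvs_subspace[OF F]]
  have m_in: "m w \<in> topspace X" if "w \<in> topspace F" for w
    using mc that by (auto simp: continuous_map_def)
  have k_in: "k y \<in> topspace F" if "y \<in> topspace Y" for y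
    using k(1) that by (auto simp: continuous_map_def)
  have sF: "subspace (topspace F)" using F by (rule tvs_subspace)
  show "open_map F X m"
  proof (rule open_map_at_zero[OF F tvs(2) ml])
    show "m ` topspace F \<subseteq> topspace X" using m_in by blast
    fix U assume U: "nbhd_zero F U" "U \<subseteq> topspace F"
    obtain V where V: "openin F V" "0 \<in> V" "balanced_set V" "\<And>x y. x \<in> V \<Longrightarrow> y \<in> V \<Longrightarrow> x + y \<in> U"
      using balanced_half_nbhd_zero[OF F U(1)] by blast
    have "nbhd_zero Y {y \<in> topspace Y. k y \<in> V}"
      using nbhd_zero_continuous[OF k(1,2) zero_in(1)] V by (auto intro: nbhd_zero_open)
    then obtain W where W: "openin X W" "0 \<in> W"
        "\<And>y. y \<in> topspace Y \<Longrightarrow> i y \<in> W \<Longrightarrow> y \<in> {y \<in> topspace Y. k y \<in> V}"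
      by (rule i_embedding) blast
    have "nbhd_zero X W" using W by (auto intro: nbhd_zero_open)
    then obtain W' where W': "openin X W'" "0 \<in> W'" "balanced_set W'"
        "\<And>x y. x \<in> W' \<Longrightarrow> y \<in> W' \<Longrightarrow> x + y \<in> W"
      using balanced_half_nbhd_zero[OF tvs(2)] by metis
    let ?G = "V \<inter> {w \<in> topspace F. m w \<in> W'}"
    have "nbhd_zero F ?G"
      using V(1,2) W'(1,2) m_linear(3) sF nbhd_zero_continuous[OF mc]
      by (intro nbhd_zero_Int) (auto intro: nbhd_zero_open simp: subspace_0)
    then have "nbhd_zero Z ((\<lambda>w. p (m w)) ` ?G)"
      using open_map_nbhd_zero[OF op] m_linear(3) p_linear(3) by simp
    then have "nbhd_zero X {x \<in> topspace X. p x \<in> (\<lambda>w. p (m w)) ` ?G}"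
      using nbhd_zero_continuous[OF p_cont p_linear(3) zero_in(2)] by blast
    then have "nbhd_zero X (W' \<inter> {x \<in> topspace X. p x \<in> (\<lambda>w. p (m w)) ` ?G})"
      using W' by (intro nbhd_zero_Int) (auto intro: nbhd_zero_open)
    moreover have "x \<in> m ` U"
      if "x \<in> W'" and x: "x \<in> topspace X" "p x \<in> (\<lambda>w. p (m w)) ` ?G" for x
    proof -
      obtain w where w: "w \<in> V" "w \<in> topspace F" "m w \<in> W'" "p x = p (m w)" using x by blast
      have "x - m w \<in> topspace X" "p (x - m w) = 0"
        using w x m_in sub(2) p_linear(5) by (auto simp: subspace_diff)
      then obtain y where y: "y \<in> topspace Y" "x - m w = i y" by (rule kernelE)
      have "x + - m w \<in> W" using W'(4) \<open>x \<in> W'\<close> balanced_neg[OF W'(3) w(3)] by blast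
      then have "k y \<in> V" using W(3) y by auto
      then have "w + k y \<in> U" using V(4) w(1) by blast
      moreover have "m (w + k y) = x"
        using m_linear(1)[OF w(2) k_in[OF y(1)]] k(3)[OF y(1)] by (simp flip: y(2))
      ultimately show ?thesis by blast
    qed
    ultimately show "nbhd_zero X (m ` U)" by (elim nbhd_zero_mono) blast
  qed
  show "m ` topspace F = topspace X"
  proof
    show "m ` topspace F \<subseteq> topspace X" using m_in by blast
    show "topspace X \<subseteq> m ` topspace F"
    proof
      fix x assume x: "x \<in> topspace X"
      then obtain w where w: "w \<in> topspace F" "p x = p (m w)" using onto p_in by blast
      have "x - m w \<in> topspace X" "p (x - m w) = 0"
        using w x m_in sub(2) p_linear(5) by (auto simp: subspace_diff)
      then obtain y where y: "y \<in> topspace Y" "x - m w = i y" by (rule kernelE)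
      have "m (w + k y) = x"
        using m_linear(1)[OF w(1) k_in[OF y(1)]] k(3)[OF y(1)] by (simp flip: y(2))
      moreover have "w + k y \<in> topspace F" using sF w k_in y by (auto simp: subspace_add)
      ultimately show "x \<in> m ` topspace F" by blast
    qed
  qed
qed

end

lemma extensionI:
  assumes tvs: "tvs Y" "tvs X" "tvs Z"
    and i: "linear_on (topspace Y) i" "inj_on i (topspace Y)"
    and p: "linear_on (topspace X) p" "p ` topspace X = topspace Z"
    and kernel: "i ` topspace Y = {x \<in> topspace X. p x = 0}"
    and i_cont: "\<And>N. nbhd_zero X N \<Longrightarrow> nbhd_zero Y {y \<in> topspace Y. i y \<in> N}"
    and i_open: "\<And>N. nbhd_zero Y N \<Longrightarrow> \<exists>W. nbhd_zero X W \<and> (\<forall>y\<in>topspace Y. i y \<in> W \<longrightarrow> y \<in> N)"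
    and p_cont: "\<And>N. nbhd_zero Z N \<Longrightarrow> nbhd_zero X {x \<in> topspace X. p x \<in> N}"
    and p_open: "\<And>N. nbhd_zero X N \<Longrightarrow> N \<subseteq> topspace X \<Longrightarrow> nbhd_zero Z (p ` N)"
  shows "extension Z Y (X, i, p)"
proof -
  have "continuous_map Y X i"
    using continuous_map_at_zero[OF tvs(1,2) i(1) _ i_cont] kernel by auto
  moreover have "continuous_map X Z p"
    using continuous_map_at_zero[OF tvs(2,3) p(1) _ p_cont] p(2) by auto
  moreover have "open_map X Z p"
    using open_map_at_zero[OF tvs(2,3) p(1) _ p_open] p(2) by auto
  moreover have "open_map Y (subtopology X (i ` topspace Y)) i"
  proof (rule open_map_at_zero[OF tvs(1) _ i(1)])
    have sub: "subspace (topspace Y)" using tvs(1) by (rule tvs_subspace)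
    have iX: "i ` topspace Y \<subseteq> topspace X" using kernel by blast
    have "subspace (i ` topspace Y)"
      unfolding subspace_def
    proof (intro conjI ballI allI)
      show "0 \<in> i ` topspace Y"
        using linear_onD(3)[OF i(1) sub] sub by (metis imageI subspace_0)
      fix x assume "x \<in> i ` topspace Y"
      then obtain a where a: "x = i a" "a \<in> topspace Y" by blast
      show "r *\<^sub>R x \<in> i ` topspace Y" for r
        using a linear_onD(2)[OF i(1) sub a(2), of r] sub by (metis imageI subspace_scale)
      fix y assume "y \<in> i ` topspace Y"
      then obtain b where b: "y = i b" "b \<in> topspace Y" by blast
      show "x + y \<in> i ` topspace Y"
        using a b linear_onD(1)[OF i(1) sub a(2) b(2)] sub by (metis imageI subspace_add)
    qed
    then show "tvs (subtopology X (i ` topspace Y))"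
      using iX by (intro tvs_subtopology[OF tvs(2)]) (simp add: inf.absorb2)
    show "i ` topspace Y \<subseteq> topspace (subtopology X (i ` topspace Y))" using iX by auto
    fix U assume U: "nbhd_zero Y U" "U \<subseteq> topspace Y"
    then obtain W where W: "nbhd_zero X W" "\<forall>y\<in>topspace Y. i y \<in> W \<longrightarrow> y \<in> U"
      using i_open by blast
    show "nbhd_zero (subtopology X (i ` topspace Y)) (i ` U)"
      by (rule nbhd_zero_subtopologyI[OF W(1)])
        (use W(2) \<open>subspace (i ` topspace Y)\<close> in \<open>auto simp: subspace_0\<close>)
  qed
  ultimately show ?thesis
    using tvs i p kernel by (simp add: extension_def continuous_linear_def open_onto_image_def)
qed

text \<open>
  Common construction for the two existence results below (sums, and extensions from a dense
  subspace). The topology is Hausdorff because a nonzero vector is separated from zero in \<open>Z\<close> or, if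
  it lies over zero, in \<open>Y\<close>.
\<close>

lemma extension_of_zero_base:
  fixes Z :: "'z::real_vector topology" and Y :: "'y::real_vector topology"
  assumes tvs: "tvs Z" "tvs Y" and base: "zero_base (topspace Y \<times> topspace Z) \<B>"
    and a: "\<And>B. B \<in> \<B> \<Longrightarrow> nbhd_zero Y {y \<in> topspace Y. (y, 0) \<in> B}"
    and b: "\<And>N. nbhd_zero Y N \<Longrightarrow> \<exists>B\<in>\<B>. \<forall>y. (y, 0) \<in> B \<longrightarrow> y \<in> N"
    and c: "\<And>B. B \<in> \<B> \<Longrightarrow> nbhd_zero Z (snd ` B)"
    and d: "\<And>N. nbhd_zero Z N \<Longrightarrow> \<exists>B\<in>\<B>. snd ` B \<subseteq> N"
  obtains P where "extension Z Y (P, \<lambda>y. (y, 0), snd)" "topspace P = topspace Y \<times> topspace Z"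
    "\<And>U. nbhd_zero P U \<longleftrightarrow> (\<exists>B\<in>\<B>. B \<subseteq> U)"
proof -
  let ?S = "topspace Y \<times> topspace Z"
  have sub: "subspace (topspace Y)" "subspace (topspace Z)" using tvs by (auto simp: tvs_def)
  have BS: "B \<subseteq> ?S" if "B \<in> \<B>" for B using base that by (auto simp: zero_base_def)
  have sep: "\<exists>B\<in>\<B>. x \<notin> B" if x: "x \<in> ?S" "x \<noteq> 0" for x
  proof (cases "snd x = 0")
    case True
    then have "fst x \<in> topspace Y" "fst x \<noteq> 0" using x by (auto simp: prod_eq_iff)
    then obtain N where "nbhd_zero Y N" "fst x \<notin> N" using Hausdorff_nbhd_zero[OF tvs(2)] by blast
    then show ?thesis using b True by (metis prod.collapse)
  next
    case False
    then have "snd x \<in> topspace Z" "snd x \<noteq> 0" using x by (auto simp: prod_eq_iff)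
    then obtain N where "nbhd_zero Z N" "snd x \<notin> N" using Hausdorff_nbhd_zero[OF tvs(1)] by blast
    then show ?thesis using d by blast
  qed
  have "subspace ?S" using sub by (rule subspace_Times)
  then obtain P where P: "tvs P" "topspace P = ?S" "\<And>U. nbhd_zero P U \<longleftrightarrow> (\<exists>B\<in>\<B>. B \<subseteq> U)"
    using zero_base_tvs[OF _ base sep] by metis
  have "extension Z Y (P, \<lambda>y. (y, 0), snd)"
  proof (rule extensionI[OF tvs(2) P(1) tvs(1)])
    show "linear_on (topspace Y) (\<lambda>y. (y, 0::'z))" "linear_on (topspace P) snd"
      by (auto simp: linear_on_def)
    show "inj_on (\<lambda>y. (y, 0::'z)) (topspace Y)" by (auto simp: inj_on_def)
    show "snd ` topspace P = topspace Z" using subspace_0[OF sub(1)] by (force simp: P(2))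
    show "(\<lambda>y. (y, 0)) ` topspace Y = {x \<in> topspace P. snd x = 0}"
      using subspace_0[OF sub(2)] by (auto simp: P(2))
    show "nbhd_zero Y {y \<in> topspace Y. (y, 0) \<in> N}" if "nbhd_zero P N" for N
    proof -
      obtain B where B: "B \<in> \<B>" "B \<subseteq> N" using \<open>nbhd_zero P N\<close> unfolding P(3) by blast
      show ?thesis by (rule nbhd_zero_mono[OF a[OF B(1)]]) (use B(2) in auto)
    qed
    show "\<exists>W. nbhd_zero P W \<and> (\<forall>y\<in>topspace Y. (y, 0) \<in> W \<longrightarrow> y \<in> N)" if "nbhd_zero Y N" for N
    proof -
      obtain B where B: "B \<in> \<B>" "\<forall>y. (y, 0) \<in> B \<longrightarrow> y \<in> N" using b[OF \<open>nbhd_zero Y N\<close>] by blast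
      then show ?thesis by (intro exI[of _ B]) (auto simp: P(3))
    qed
    show "nbhd_zero P {x \<in> topspace P. snd x \<in> N}" if "nbhd_zero Z N" for N
    proof -
      obtain B where B: "B \<in> \<B>" "snd ` B \<subseteq> N" using d[OF \<open>nbhd_zero Z N\<close>] by blast
      then have "B \<subseteq> {x \<in> topspace P. snd x \<in> N}" using BS P(2) by blast
      then show ?thesis using B(1) by (auto simp: P(3))
    qed
    show "nbhd_zero Z (snd ` N)" if "nbhd_zero P N" for N
    proof -
      obtain B where B: "B \<in> \<B>" "B \<subseteq> N" using \<open>nbhd_zero P N\<close> unfolding P(3) by blast
      show ?thesis by (rule nbhd_zero_mono[OF c[OF B(1)]]) (use B(2) in auto)
    qed
  qed
  then show thesis using that P by blast
qed

lemma trivial_extension: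
  fixes Z :: "'z::real_vector topology" and Y :: "'y::real_vector topology"
  assumes "tvs Z" "tvs Y"
  shows "extension Z Y (trivial_ext Z Y)"
  unfolding trivial_ext_def
proof (rule extensionI)
  show "tvs Y" "tvs Z" "tvs (prod_topology Y Z)" using assms by (auto intro: tvs_prod_topology)
  have sub: "subspace (topspace Y)" "subspace (topspace Z)" using assms by (auto simp: tvs_def)
  have z: "0 \<in> topspace Y" "0 \<in> topspace Z" using sub by (auto simp: subspace_0)
  have nb: "nbhd_zero Y (topspace Y)" "nbhd_zero Z (topspace Z)"
    using z by (auto intro: nbhd_zero_open)
  show "linear_on (topspace Y) (\<lambda>y. (y, 0::'z))" "linear_on (topspace (prod_topology Y Z)) snd"
    by (auto simp: linear_on_def)
  show "inj_on (\<lambda>y. (y, 0::'z)) (topspace Y)" by (auto simp: inj_on_def)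
  show "snd ` topspace (prod_topology Y Z) = topspace Z" using z by force
  show "(\<lambda>y. (y, 0)) ` topspace Y = {x \<in> topspace (prod_topology Y Z). snd x = 0}"
    using z by auto
  show "nbhd_zero Y {y \<in> topspace Y. (y, 0) \<in> N}" if "nbhd_zero (prod_topology Y Z) N" for N
    using that
    by (intro nbhd_zero_continuous[of Y "prod_topology Y Z"] continuous_map_pairedI)
      (auto simp: z zero_prod_def)
  show "\<exists>W. nbhd_zero (prod_topology Y Z) W \<and> (\<forall>y\<in>topspace Y. (y, 0) \<in> W \<longrightarrow> y \<in> N)"
    if "nbhd_zero Y N" for N
    using nbhd_zero_prodI[OF that nb(2)] by blast
  show "nbhd_zero (prod_topology Y Z) {x \<in> topspace (prod_topology Y Z). snd x \<in> N}"
    if "nbhd_zero Z N" for N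
    using that by (intro nbhd_zero_continuous) (auto simp: continuous_map_snd z zero_prod_def)
  show "nbhd_zero Z (snd ` N)" if "nbhd_zero (prod_topology Y Z) N" for N
    using that by (intro open_map_nbhd_zero[OF open_map_snd]) auto
qed

section \<open>Equivalence of extensions\<close>

lemma continuous_linear_compose:
  assumes "continuous_linear X Y f" "continuous_linear Y W g"
  shows "continuous_linear X W (\<lambda>x. g (f x))"
proof -
  have "continuous_map X W (g \<circ> f)"
    using assms by (auto simp: continuous_linear_def intro: continuous_map_compose)
  moreover have "f x \<in> topspace Y" if "x \<in> topspace X" for x
    using assms(1) that by (auto simp: continuous_linear_def continuous_map_def)
  ultimately show ?thesis
    using assms by (auto simp: continuous_linear_def linear_on_def o_def)
qed

lemma continuous_linear_in:
  "continuous_linear X Y f \<Longrightarrow> x \<in> topspace X \<Longrightarrow> f x \<in> topspace Y"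
  by (auto simp: continuous_linear_def continuous_map_def)

text \<open>
  An open continuous surjection is a quotient map, so a continuous linear map that vanishes on its
  kernel factors through it. This yields every map between middle spaces constructed below.
\<close>

lemma continuous_linear_factor:
  fixes F :: "'f::real_vector topology"
  assumes F: "tvs F" and m: "continuous_linear F P m" "open_map F P m" "m ` topspace F = topspace P"
    and m': "continuous_linear F P' m'"
    and ker: "\<And>w. w \<in> topspace F \<Longrightarrow> m w = 0 \<Longrightarrow> m' w = 0"
  obtains T where "continuous_linear P P' T" "\<And>w. w \<in> topspace F \<Longrightarrow> T (m w) = m' w"
proof -
  have sF: "subspace (topspace F)" using F by (rule tvs_subspace)
  have ml: "linear_on (topspace F) m" "linear_on (topspace F) m'"
    using m(1) m' by (auto simp: continuous_linear_def)
  note m_linear = linear_onD[OF ml(1) sF] and m'_linear = linear_onD[OF ml(2) sF]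
  have eq: "m' v = m' w" if vw: "v \<in> topspace F" "w \<in> topspace F" "m v = m w" for v w
    using ker[of "v - w"] m_linear(5)[OF vw(1,2)] m'_linear(5)[OF vw(1,2)] vw sF
    by (simp add: subspace_diff)
  define T where "T = (\<lambda>x. m' (inv_into (topspace F) m x))"
  have T: "T (m w) = m' w" if "w \<in> topspace F" for w
    unfolding T_def using that by (intro eq) (auto simp: inv_into_into f_inv_into_f)
  have "quotient_map F P m"
    using m by (intro continuous_open_imp_quotient_map) (auto simp: continuous_linear_def)
  moreover have "continuous_map F P' (T \<circ> m)"
    by (rule continuous_map_eq[of _ _ m']) (use m' T in \<open>auto simp: continuous_linear_def\<close>)
  ultimately have "continuous_map P P' T" by (rule continuous_compose_quotient_map)
  moreover have "linear_on (topspace P) T"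
    unfolding linear_on_def m(3)[symmetric]
  proof (intro conjI ballI allI)
    fix x y assume "x \<in> m ` topspace F" "y \<in> m ` topspace F"
    then obtain v w where vw: "x = m v" "y = m w" "v \<in> topspace F" "w \<in> topspace F" by blast
    show "T (x + y) = T x + T y"
      using T[of "v + w"] vw m_linear(1) m'_linear(1) T sF by (simp add: subspace_add)
  next
    fix r x assume "x \<in> m ` topspace F"
    then obtain v where v: "x = m v" "v \<in> topspace F" by blast
    show "T (r *\<^sub>R x) = r *\<^sub>R T x"
      using T[of "r *\<^sub>R v"] v m_linear(2) m'_linear(2) T sF by (simp add: subspace_scale)
  qed
  ultimately show thesis using that T by (simp add: continuous_linear_def)
qed

lemma ext_equiv_refl: "ext_equiv Z Y E E"
  unfolding ext_equiv_def continuous_linear_def linear_on_def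
  by (cases E) (auto intro!: exI[of _ "\<lambda>x. x"])

lemma ext_equiv_trans:
  assumes "extension Z Y E" "ext_equiv Z Y E E'" "ext_equiv Z Y E' E''"
  shows "ext_equiv Z Y E E''"
proof -
  obtain X i p X' i' p' X'' i'' p'' where
    E: "E = (X, i, p)" "E' = (X', i', p')" "E'' = (X'', i'', p'')"
    by (cases E, cases E', cases E'')
  obtain T T' where T: "continuous_linear X X' T" "\<forall>y\<in>topspace Y. T (i y) = i' y"
      "\<forall>x\<in>topspace X. p' (T x) = p x"
      "continuous_linear X' X'' T'" "\<forall>y\<in>topspace Y. T' (i' y) = i'' y"
      "\<forall>x\<in>topspace X'. p'' (T' x) = p' x"
    using assms(2,3) by (auto simp: E ext_equiv_def)
  then show ?thesis
    unfolding E ext_equiv_def prod.case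
    by (intro exI[of _ "\<lambda>x. T' (T x)"])
      (auto intro: continuous_linear_compose dest: continuous_linear_in)
qed

text \<open>
  An equivalence \<open>T\<close> is injective by diagram chase, and open and onto by \<open>open_map_onto_middle\<close>;
  factoring the identity through \<open>T\<close> gives its inverse.
\<close>

lemma ext_equiv_sym:
  assumes "extension Z Y E" "extension Z Y E'" "ext_equiv Z Y E E'"
  shows "ext_equiv Z Y E' E"
proof -
  obtain X i p X' i' p' where E: "E = (X, i, p)" "E' = (X', i', p')"
    by (cases E, cases E')
  interpret A: tvs_extension Z Y X i p using assms(1) E by unfold_locales simp
  interpret B: tvs_extension Z Y X' i' p' using assms(2) E by unfold_locales simp
  obtain T where T: "continuous_linear X X' T" "\<And>y. y \<in> topspace Y \<Longrightarrow> T (i y) = i' y"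
      "\<And>x. x \<in> topspace X \<Longrightarrow> p' (T x) = p x"
    using assms(3) by (auto simp: E ext_equiv_def)
  have op: "open_map X Z (\<lambda>x. p' (T x))"
    using A.p_open T(3) openin_subset unfolding open_map_def by (metis (no_types, lifting) image_cong subsetD)
  have onto: "(\<lambda>x. p' (T x)) ` topspace X = topspace Z"
    using A.p_onto T(3) by (metis (no_types, lifting) image_cong)
  note O = B.open_map_onto_middle[OF A.tvs(2) T(1) op onto A.i_cont A.i_linear(3) T(2)]
  have ker: "x = 0" if x: "x \<in> topspace X" "T x = 0" for x
  proof -
    have "p x = 0" using x T(3) B.p_linear(3) by force
    then obtain y where y: "y \<in> topspace Y" "x = i y" using x A.kernelE by blast
    then show ?thesis using x T(2) B.i_eq_0 A.i_linear(3) by metis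
  qed
  have "continuous_linear X X (\<lambda>x. x)" by (auto simp: continuous_linear_def linear_on_def)
  then obtain S where S: "continuous_linear X' X S" "\<And>x. x \<in> topspace X \<Longrightarrow> S (T x) = x"
    using continuous_linear_factor[OF A.tvs(2) T(1) O _ ker, of X] by blast
  have "S (i' y) = i y" if "y \<in> topspace Y" for y
    using that S(2) T(2) A.i_in by metis
  moreover have "p (S x) = p' x" if "x \<in> topspace X'" for x
    using that S(2) T(3) O(2) by (metis imageE)
  ultimately show ?thesis
    using S(1) by (auto simp: E ext_equiv_def)
qed

lemma equiv_ext_rel: "equiv {E. extension Z Y E} (ext_rel Z Y)"
proof (rule equivI)
  show "ext_rel Z Y \<subseteq> {E. extension Z Y E} \<times> {E. extension Z Y E}"
    by (auto simp: ext_rel_def)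
  show "refl_on {E. extension Z Y E} (ext_rel Z Y)"
    by (auto simp: refl_on_def ext_rel_def ext_equiv_refl)
  show "sym (ext_rel Z Y)"
    using ext_equiv_sym by (auto simp: sym_def ext_rel_def)
  show "trans (ext_rel Z Y)"
    using ext_equiv_trans by (auto simp: trans_def ext_rel_def) blast
qed

section \<open>Fibre products\<close>

definition fibre_product ::
  "'x topology \<Rightarrow> ('x \<Rightarrow> 'z) \<Rightarrow> 'w topology \<Rightarrow> ('w \<Rightarrow> 'z) \<Rightarrow> ('x \<times> 'w) topology" where
  "fibre_product X p W q = subtopology (prod_topology X W) {(x, w). p x = q w}"

lemma topspace_fibre_product:
  "topspace (fibre_product X p W q) = {(x, w). x \<in> topspace X \<and> w \<in> topspace W \<and> p x = q w}"
  by (auto simp: fibre_product_def)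

lemma tvs_fibre_product:
  fixes X :: "'x::real_vector topology" and W :: "'w::real_vector topology"
  assumes X: "tvs X" and W: "tvs W" and p: "linear_on (topspace X) p" and q: "linear_on (topspace W) q"
  shows "tvs (fibre_product X p W q)"
  unfolding fibre_product_def
proof (rule tvs_subtopology[OF tvs_prod_topology[OF X W]])
  have sub: "subspace (topspace X)" "subspace (topspace W)" using X W by (auto simp: tvs_def)
  show "subspace (topspace (prod_topology X W) \<inter> {(x, w). p x = q w})"
    using subspace_Times[OF sub] linear_onD[OF p sub(1)] linear_onD[OF q sub(2)]
    by (auto simp: subspace_def zero_prod_def)
qed

lemma continuous_map_into_fibre_product:
  assumes "continuous_map T X f" "continuous_map T W g" "\<And>t. t \<in> topspace T \<Longrightarrow> p (f t) = q (g t)"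
  shows "continuous_map T (fibre_product X p W q) (\<lambda>t. (f t, g t))"
  using assms unfolding fibre_product_def
  by (auto simp: continuous_map_in_subtopology intro: continuous_map_pairedI)

lemma continuous_map_fibre_product:
  "continuous_map (fibre_product X p W q) X fst" "continuous_map (fibre_product X p W q) W snd"
  by (auto simp: fibre_product_def intro: continuous_map_from_subtopology continuous_map_fst continuous_map_snd)

lemma nbhd_zero_fibre_product:
  assumes "nbhd_zero (fibre_product X p W q) U"
  obtains A B where "openin X A" "0 \<in> A" "openin W B" "0 \<in> B"
    "\<And>x w. x \<in> A \<Longrightarrow> w \<in> B \<Longrightarrow> p x = q w \<Longrightarrow> (x, w) \<in> U"
proof -
  obtain V where V: "nbhd_zero (prod_topology X W) V" "V \<inter> {(x, w). p x = q w} \<subseteq> U"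
    using assms unfolding fibre_product_def by (rule nbhd_zero_subtopology)
  obtain A B where "openin X A" "0 \<in> A" "openin W B" "0 \<in> B" "A \<times> B \<subseteq> V"
    using V(1) by (rule nbhd_zero_prod)
  with V(2) show thesis by (intro that[of A B]) auto
qed

lemma nbhd_zero_fibre_productI:
  assumes "nbhd_zero X A" "nbhd_zero W B" "p 0 = q 0"
  shows "nbhd_zero (fibre_product X p W q) {(x, w). x \<in> A \<and> w \<in> B \<and> p x = q w}"
  unfolding fibre_product_def
  by (rule nbhd_zero_subtopologyI[OF nbhd_zero_prodI[OF assms(1,2)]])
    (use assms(3) in \<open>auto simp: zero_prod_def\<close>)

section \<open>Sums of extensions\<close>

text \<open>
  A map that exhibits the third extension as the Baer sum of the first two. On the fibre product of
  the middle spaces it adds the two copies of \<open>Y\<close> and covers the identity of \<open>Z\<close>. Unlike the push-out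
  it refers to no quotient, so it can be composed and restricted.
\<close>

definition sum_map ::
  "'y::real_vector topology \<Rightarrow> ('y, 'x::real_vector, 'z::real_vector) ext \<Rightarrow>
   ('y, 'w::real_vector, 'z) ext \<Rightarrow> ('y, 'v::real_vector, 'z) ext \<Rightarrow> ('x \<times> 'w \<Rightarrow> 'v) \<Rightarrow> bool" where
  "sum_map Y = (\<lambda>(X1, i1, p1) (X2, i2, p2) (X, i, p) m.
     continuous_linear (fibre_product X1 p1 X2 p2) X m \<and>
     (\<forall>y\<in>topspace Y. \<forall>y'\<in>topspace Y. m (i1 y, i2 y') = i (y + y')) \<and>
     (\<forall>w\<in>topspace (fibre_product X1 p1 X2 p2). p (m w) = p1 (fst w)))"

definition ext_sum ::
  "'z::real_vector topology \<Rightarrow> 'y::real_vector topology \<Rightarrow> ('y, 'x::real_vector, 'z) ext \<Rightarrow>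
   ('y, 'w::real_vector, 'z) ext \<Rightarrow> ('y, 'v::real_vector, 'z) ext \<Rightarrow> bool" where
  "ext_sum Z Y E1 E2 E \<longleftrightarrow>
     extension Z Y E1 \<and> extension Z Y E2 \<and> extension Z Y E \<and> (\<exists>m. sum_map Y E1 E2 E m)"

locale extension_pair =
  A: tvs_extension Z Y X1 i1 p1 + B: tvs_extension Z Y X2 i2 p2
  for Z :: "'z::real_vector topology" and Y :: "'y::real_vector topology"
    and X1 :: "'x::real_vector topology" and i1 p1
    and X2 :: "'w::real_vector topology" and i2 p2
begin

abbreviation "F \<equiv> fibre_product X1 p1 X2 p2"

lemma F_tvs: "tvs F"
  by (rule tvs_fibre_product[OF A.tvs(2) B.tvs(2) A.p_lin B.p_lin])

lemma F_sub: "subspace (topspace F)"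
  using F_tvs by (rule tvs_subspace)

lemma F_iff: "(x, w) \<in> topspace F \<longleftrightarrow> x \<in> topspace X1 \<and> w \<in> topspace X2 \<and> p1 x = p2 w"
  by (simp add: topspace_fibre_product)

text \<open>
  The image of a basic neighbourhood \<open>V \<times> W\<close> of zero is \<open>p1 V \<inter> p2 W\<close>, a neighbourhood of zero because
  both projections are open.
\<close>

lemma F_projection: "open_map F Z (\<lambda>w. p1 (fst w))" "(\<lambda>w. p1 (fst w)) ` topspace F = topspace Z"
proof -
  show "(\<lambda>w. p1 (fst w)) ` topspace F = topspace Z"
  proof
    show "(\<lambda>w. p1 (fst w)) ` topspace F \<subseteq> topspace Z" by (auto simp: F_iff B.p_in)
    show "topspace Z \<subseteq> (\<lambda>w. p1 (fst w)) ` topspace F"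
    proof
      fix z assume "z \<in> topspace Z"
      then obtain x w where "x \<in> topspace X1" "p1 x = z" "w \<in> topspace X2" "p2 w = z"
        by (metis A.liftE B.liftE)
      then show "z \<in> (\<lambda>w. p1 (fst w)) ` topspace F"
        by (intro image_eqI[of _ _ "(x, w)"]) (auto simp: F_iff)
    qed
  qed
  show "open_map F Z (\<lambda>w. p1 (fst w))"
  proof (rule open_map_at_zero[OF F_tvs A.tvs(3)])
    show "linear_on (topspace F) (\<lambda>w. p1 (fst w))"
      by (auto simp: linear_on_def F_iff A.p_linear)
    show "(\<lambda>w. p1 (fst w)) ` topspace F \<subseteq> topspace Z" by (auto simp: F_iff B.p_in)
    fix U assume "nbhd_zero F U"
    then obtain V W where VW: "openin X1 V" "0 \<in> V" "openin X2 W" "0 \<in> W"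
      "\<And>x w. x \<in> V \<Longrightarrow> w \<in> W \<Longrightarrow> p1 x = p2 w \<Longrightarrow> (x, w) \<in> U"
      by (rule nbhd_zero_fibre_product) blast
    have "nbhd_zero Z (p1 ` V \<inter> p2 ` W)"
      using VW by (intro nbhd_zero_Int A.p_nbhd_zero B.p_nbhd_zero) (auto intro: nbhd_zero_open)
    then show "nbhd_zero Z ((\<lambda>w. p1 (fst w)) ` U)"
    proof (rule nbhd_zero_mono, intro subsetI)
      fix z assume "z \<in> p1 ` V \<inter> p2 ` W"
      then obtain x w where xw: "x \<in> V" "w \<in> W" "z = p1 x" "z = p2 w" by blast
      then have "(x, w) \<in> U" using VW(5) by simp
      then show "z \<in> (\<lambda>w. p1 (fst w)) ` U" using xw(3) by force
    qed
  qed
qed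

lemma F_kernelE:
  assumes "(x, w) \<in> topspace F" "p1 x = 0"
  obtains y y' where "y \<in> topspace Y" "y' \<in> topspace Y" "x = i1 y" "w = i2 y'"
  using assms A.kernelE[of x] B.kernelE[of w] by (metis F_iff)

lemma F_axis: "continuous_map Y F (\<lambda>y. (i1 y, 0))"
proof (rule continuous_map_into_fibre_product)
  show "continuous_map Y X2 (\<lambda>y. 0)" using B.zero_in by simp
qed (auto simp: A.i_cont A.p_i B.p_linear)

text \<open>
  With algebraic retractions \<open>h1\<close> and \<open>h2\<close>, the linear map \<open>(x, w) \<mapsto> (h1 x + h2 w, p1 x)\<close> is onto
  \<open>Y \<times> Z\<close> and has the kernel required of a sum map. The quotient topology that it induces, whose
  neighbourhoods of zero are the images of those of the fibre product, makes \<open>Y \<times> Z\<close> the sum.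
\<close>

lemma ext_sum_exists:
  obtains E :: "('y, 'y \<times> 'z, 'z) ext" where "ext_sum Z Y (X1, i1, p1) (X2, i2, p2) E"
proof -
  obtain h1 where h1: "linear_on (topspace X1) h1" "h1 ` topspace X1 \<subseteq> topspace Y"
    "\<And>y. y \<in> topspace Y \<Longrightarrow> h1 (i1 y) = y" using A.linear_retraction by blast
  obtain h2 where h2: "linear_on (topspace X2) h2" "h2 ` topspace X2 \<subseteq> topspace Y"
    "\<And>y. y \<in> topspace Y \<Longrightarrow> h2 (i2 y) = y" using B.linear_retraction by blast
  note h1_linear = linear_onD[OF h1(1) A.sub(2)] and h2_linear = linear_onD[OF h2(1) B.sub(2)]
  define m where "m = (\<lambda>(x, w). (h1 x + h2 w, p1 x))"
  have mi: "m (i1 y, i2 y') = (y + y', 0)" if "y \<in> topspace Y" "y' \<in> topspace Y" for y y'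
    using that by (simp add: m_def h1(3) h2(3) A.p_i)
  have m_lin: "linear_on (topspace F) m"
    unfolding linear_on_def m_def
    by (auto simp: F_iff h1_linear h2_linear A.p_linear scaleR_add_right)
  note m_linear = linear_onD[OF m_lin F_sub]
  have m_in: "m w \<in> topspace Y \<times> topspace Z" if "w \<in> topspace F" for w
    using that h1(2) h2(2) A.sub(1) B.p_in by (cases w) (auto simp: F_iff m_def intro!: subspace_add)
  have snd_m: "snd (m w) = p1 (fst w)" for w by (simp add: m_def case_prod_beta)
  have m_onto: "\<exists>w\<in>topspace F. v = m w" if "v \<in> topspace Y \<times> topspace Z" for v
  proof -
    obtain y z where v: "v = (y, z)" "y \<in> topspace Y" "z \<in> topspace Z" using \<open>v \<in> _\<close> by (cases v) auto
    have "z \<in> (\<lambda>w. p1 (fst w)) ` topspace F" using v(3) by (simp add: F_projection(2))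
    then obtain w where w: "w \<in> topspace F" "p1 (fst w) = z" by blast
    define d where "d = y - fst (m w)"
    have d: "d \<in> topspace Y" using m_in[OF w(1)] v(2) A.sub(1) by (auto simp: d_def intro: subspace_diff)
    have di: "(i1 d, i2 0) \<in> topspace F" using d B.i_in A.zero_in by (simp add: F_iff A.i_in A.p_i B.p_i)
    have "m (w + (i1 d, i2 0)) = (fst (m w), snd (m w)) + (d, 0)"
      using m_linear(1)[OF w(1) di] mi[OF d A.zero_in(1)] by simp
    also have "\<dots> = v" using snd_m w(2) by (simp add: d_def v(1))
    finally show ?thesis using w(1) di F_sub by (metis subspace_add)
  qed
  define \<B> where "\<B> = {m ` B | B. openin F B \<and> 0 \<in> B \<and> balanced_set B}"
  have \<B>E: "\<exists>B. V = m ` B \<and> openin F B \<and> 0 \<in> B \<and> balanced_set B" if "V \<in> \<B>" for V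
    using that by (auto simp: \<B>_def)
  have F_open: "B \<subseteq> topspace F" if "openin F B" for B using that by (rule openin_subset)
  have basis: "\<exists>B. openin F B \<and> 0 \<in> B \<and> balanced_set B \<and> B \<subseteq> U" if "nbhd_zero F U" for U
    using balanced_nbhd_zero[OF F_tvs that] by metis
  have "zero_base (topspace Y \<times> topspace Z) \<B>"
    unfolding zero_base_def
  proof (intro conjI ballI)
    have "nbhd_zero F (topspace F)" using F_sub by (auto intro: nbhd_zero_open simp: subspace_0)
    from basis[OF this] show "\<B> \<noteq> {}" by (auto simp: \<B>_def)
  next
    fix V V' assume VV': "V \<in> \<B>" "V' \<in> \<B>"
    obtain B B' where B: "V = m ` B" "openin F B" "0 \<in> B" "balanced_set B"
      "V' = m ` B'" "openin F B'" "0 \<in> B'" "balanced_set B'"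
      using \<B>E[OF VV'(1)] \<B>E[OF VV'(2)] by metis
    have "openin F (B \<inter> B')" "0 \<in> B \<inter> B'" "balanced_set (B \<inter> B')"
      using B by (auto simp: balanced_set_def)
    then have "m ` (B \<inter> B') \<in> \<B>" by (auto simp: \<B>_def)
    then show "\<exists>A\<in>\<B>. A \<subseteq> V \<inter> V'" using B(1,5) by (intro bexI[of _ "m ` (B \<inter> B')"]) auto
  next
    fix V assume "V \<in> \<B>"
    then obtain B where B: "V = m ` B" "openin F B" "0 \<in> B" "balanced_set B"
      using \<B>E by metis
    have BF: "B \<subseteq> topspace F" using B(2) by (rule F_open)
    show "0 \<in> V" using B m_linear(3) by (metis imageI)
    show "V \<subseteq> topspace Y \<times> topspace Z" using B BF m_in by blast
    show "balanced_set V"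
      unfolding balanced_set_def
    proof (intro allI ballI impI)
      fix r :: real and v assume "v \<in> V" "\<bar>r\<bar> \<le> 1"
      then obtain w where "v = m w" "w \<in> B" "r *\<^sub>R w \<in> B"
        using B by (auto simp: balanced_set_def)
      then show "r *\<^sub>R v \<in> V" using B(1) m_linear(2) BF by (metis image_eqI subsetD)
    qed
    show "\<exists>e>0. e *\<^sub>R v \<in> V" if "v \<in> topspace Y \<times> topspace Z" for v
    proof -
      obtain w where w: "w \<in> topspace F" "v = m w" using m_onto[OF \<open>v \<in> _\<close>] by blast
      then obtain e where "e > 0" "e *\<^sub>R w \<in> B"
        using nbhd_zero_absorbing[OF F_tvs] B by (metis nbhd_zero_open)
      then show ?thesis using w m_linear(2) B(1) by (metis imageI)
    qed
    obtain C where C: "openin F C" "0 \<in> C" "balanced_set C" "\<And>x y. x \<in> C \<Longrightarrow> y \<in> C \<Longrightarrow> x + y \<in> B"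
      using balanced_half_nbhd_zero[OF F_tvs nbhd_zero_open[OF B(2,3)]] by metis
    have "m x + m y \<in> V" if "x \<in> C" "y \<in> C" for x y
      using that C(4) B(1) m_linear(1) F_open[OF C(1)] by (metis imageI subsetD)
    then show "\<exists>C\<in>\<B>. \<forall>x\<in>C. \<forall>y\<in>C. x + y \<in> V"
      using C by (intro bexI[of _ "m ` C"]) (auto simp: \<B>_def)
  qed
  then obtain P where P: "extension Z Y (P, \<lambda>y. (y, 0), snd)"
    "topspace P = topspace Y \<times> topspace Z" "\<And>U. nbhd_zero P U \<longleftrightarrow> (\<exists>B\<in>\<B>. B \<subseteq> U)"
  proof (rule extension_of_zero_base[OF A.tvs(3,1)])
    fix V assume "V \<in> \<B>"
    then obtain B where B: "V = m ` B" "openin F B" "0 \<in> B" using \<B>E by metis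
    have nB: "nbhd_zero F B" using B(2,3) by (rule nbhd_zero_open)
    have "nbhd_zero Y {y \<in> topspace Y. (i1 y, 0) \<in> B}"
      by (rule nbhd_zero_continuous[OF F_axis])
        (use nB A.zero_in in \<open>auto simp: A.i_linear(3) zero_prod_def\<close>)
    then show "nbhd_zero Y {y \<in> topspace Y. (y, 0) \<in> V}"
    proof (rule nbhd_zero_mono, clarify)
      fix y assume y: "y \<in> topspace Y" "(i1 y, 0) \<in> B"
      have "m (i1 y, 0) = (y, 0)" using mi[OF y(1) A.zero_in(1)] by (simp add: B.i_linear(3))
      then show "(y, 0) \<in> V" using y(2) B(1) by (metis imageI)
    qed
    show "nbhd_zero Z (snd ` V)"
      using open_map_nbhd_zero[OF F_projection(1) _ nB] A.p_linear(3)
      by (simp add: B(1) image_image snd_m)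
  next
    fix N assume "nbhd_zero Y N"
    then obtain N' where N': "openin Y N'" "0 \<in> N'" "balanced_set N'"
        "\<And>x y. x \<in> N' \<Longrightarrow> y \<in> N' \<Longrightarrow> x + y \<in> N"
      using balanced_half_nbhd_zero[OF A.tvs(1)] by metis
    have nN': "nbhd_zero Y N'" using N'(1,2) by (rule nbhd_zero_open)
    obtain W1 where W1: "openin X1 W1" "0 \<in> W1" "\<And>y. y \<in> topspace Y \<Longrightarrow> i1 y \<in> W1 \<Longrightarrow> y \<in> N'"
      using A.i_embedding[OF nN'] by blast
    obtain W2 where W2: "openin X2 W2" "0 \<in> W2" "\<And>y. y \<in> topspace Y \<Longrightarrow> i2 y \<in> W2 \<Longrightarrow> y \<in> N'"
      using B.i_embedding[OF nN'] by blast
    have "nbhd_zero F {(x, w). x \<in> W1 \<and> w \<in> W2 \<and> p1 x = p2 w}"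
      using W1 W2
      by (intro nbhd_zero_fibre_productI) (auto intro: nbhd_zero_open simp: A.p_linear B.p_linear)
    from basis[OF this] obtain B where B: "openin F B" "0 \<in> B" "balanced_set B"
        "B \<subseteq> {(x, w). x \<in> W1 \<and> w \<in> W2 \<and> p1 x = p2 w}" by blast
    have "y \<in> N" if "(y, 0) \<in> m ` B" for y
    proof -
      obtain x w where xw: "(x, w) \<in> B" "(y, 0) = m (x, w)" using \<open>(y, 0) \<in> m ` B\<close> by auto
      then have "(x, w) \<in> topspace F" "p1 x = 0" using F_open[OF B(1)] by (auto simp: m_def)
      then obtain a b where ab: "a \<in> topspace Y" "b \<in> topspace Y" "x = i1 a" "w = i2 b"
        by (rule F_kernelE)
      have "i1 a \<in> W1" "i2 b \<in> W2" using xw(1) B(4) ab by auto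
      then have "a \<in> N'" "b \<in> N'" using ab W1(3) W2(3) by blast+
      moreover have "y = a + b" using xw(2) mi ab by simp
      ultimately show ?thesis using N'(4) by blast
    qed
    then show "\<exists>B\<in>\<B>. \<forall>y. (y, 0) \<in> B \<longrightarrow> y \<in> N"
      using B by (intro bexI[of _ "m ` B"]) (auto simp: \<B>_def)
  next
    fix N assume N: "nbhd_zero Z N"
    have "continuous_map F Z (p1 \<circ> fst)"
      using continuous_map_fibre_product(1) A.p_cont by (rule continuous_map_compose)
    then have "nbhd_zero F {w \<in> topspace F. (p1 \<circ> fst) w \<in> N}"
      by (rule nbhd_zero_continuous) (use N F_sub in \<open>auto simp: A.p_linear subspace_0\<close>)
    from basis[OF this] obtain B where B: "openin F B" "0 \<in> B" "balanced_set B"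
      "B \<subseteq> {w \<in> topspace F. (p1 \<circ> fst) w \<in> N}" by blast
    have "snd ` m ` B \<subseteq> N" using B(4) by (auto simp: image_image snd_m)
    then show "\<exists>B\<in>\<B>. snd ` B \<subseteq> N"
      using B by (intro bexI[of _ "m ` B"]) (auto simp: \<B>_def)
  qed blast
  interpret C: tvs_extension Z Y P "\<lambda>y. (y, 0)" snd using P(1) by unfold_locales
  have "continuous_map F P m"
  proof (rule continuous_map_at_zero[OF F_tvs C.tvs(2) m_lin])
    show "m ` topspace F \<subseteq> topspace P" using m_in P(2) by blast
    fix N assume "nbhd_zero P N"
    then obtain B where B: "openin F B" "0 \<in> B" "m ` B \<subseteq> N" unfolding P(3) using \<B>E by metis
    then show "nbhd_zero F {w \<in> topspace F. m w \<in> N}"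
      using F_open[OF B(1)] by (intro nbhd_zero_mono[OF nbhd_zero_open[OF B(1,2)]]) auto
  qed
  then have "sum_map Y (X1, i1, p1) (X2, i2, p2) (P, \<lambda>y. (y, 0), snd) m"
    using m_lin mi snd_m by (simp add: sum_map_def continuous_linear_def)
  then show thesis
    using that[of "(P, \<lambda>y. (y, 0), snd)"] P(1) A.ext B.ext by (auto simp: ext_sum_def)
qed

end

locale sum_of_extensions = extension_pair Z Y X1 i1 p1 X2 i2 p2 + C: tvs_extension Z Y X i p
  for Z :: "'z::real_vector topology" and Y :: "'y::real_vector topology"
    and X1 :: "'x::real_vector topology" and i1 p1
    and X2 :: "'w::real_vector topology" and i2 p2
    and X :: "'v::real_vector topology" and i p +
  fixes m :: "'x \<times> 'w \<Rightarrow> 'v"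
  assumes m: "sum_map Y (X1, i1, p1) (X2, i2, p2) (X, i, p) m"
begin

lemma m_cl: "continuous_linear F X m"
  and m_i: "y \<in> topspace Y \<Longrightarrow> y' \<in> topspace Y \<Longrightarrow> m (i1 y, i2 y') = i (y + y')"
  and p_m: "w \<in> topspace F \<Longrightarrow> p (m w) = p1 (fst w)"
  using m by (auto simp: sum_map_def)

lemma m_lin: "linear_on (topspace F) m" and m_cont: "continuous_map F X m"
  using m_cl by (auto simp: continuous_linear_def)

lemmas m_linear = linear_onD[OF m_lin F_sub]

lemma m_axis: "y \<in> topspace Y \<Longrightarrow> m (i1 y, 0) = i y"
  using m_i[of y 0] B.i_linear(3) A.zero_in by simp

text \<open>
  The five lemma applies because \<open>p \<circ> m\<close> is the projection of the fibre product to \<open>Z\<close> and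
  \<open>y \<mapsto> (i1 y, 0)\<close> lifts \<open>i\<close>.
\<close>

lemma m_open: "open_map F X m" "m ` topspace F = topspace X"
proof -
  have op: "open_map F Z (\<lambda>w. p (m w))"
    unfolding open_map_def
  proof (intro allI impI)
    fix U assume U: "openin F U"
    then have "(\<lambda>w. p (m w)) ` U = (\<lambda>w. p1 (fst w)) ` U"
      using p_m openin_subset[OF U] by (intro image_cong) auto
    then show "openin Z ((\<lambda>w. p (m w)) ` U)"
      using F_projection(1) U by (simp add: open_map_def)
  qed
  have onto: "(\<lambda>w. p (m w)) ` topspace F = topspace Z"
    unfolding F_projection(2)[symmetric] using p_m by (intro image_cong) auto
  show "open_map F X m" "m ` topspace F = topspace X"
    using C.open_map_onto_middle[OF F_tvs m_cl op onto F_axis _ m_axis]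
    by (auto simp: A.i_linear(3) zero_prod_def)
qed

text \<open>
  The kernel of a sum map is the antidiagonal copy of \<open>Y\<close>; in particular it depends only on the two
  summands, which is why sums are unique up to equivalence.
\<close>

lemma m_kernelE:
  assumes "w \<in> topspace F" "m w = 0"
  obtains y where "y \<in> topspace Y" "w = (i1 y, i2 (- y))"
proof -
  have "p1 (fst w) = 0" using assms p_m C.p_linear(3) by metis
  then obtain y y' where y: "y \<in> topspace Y" "y' \<in> topspace Y" "w = (i1 y, i2 y')"
    using assms(1) F_kernelE by (metis prod.collapse)
  then have "i (y + y') = 0" using assms(2) m_i by simp
  then have "y + y' = 0" using y A.sub(1) C.i_eq_0 by (simp add: subspace_add)
  then have "y' = - y" by (simp add: eq_neg_iff_add_eq_0 add.commute)
  then show thesis using that y by blast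
qed

end

lemma ext_sum_unique:
  assumes "ext_sum Z Y E1 E2 E" "ext_sum Z Y E1 E2 E'"
  shows "ext_equiv Z Y E E'"
proof -
  obtain X1 i1 p1 X2 i2 p2 X i p X' i' p' where
    E: "E1 = (X1, i1, p1)" "E2 = (X2, i2, p2)" "E = (X, i, p)" "E' = (X', i', p')"
    by (cases E1, cases E2, cases E, cases E')
  obtain m m' where m: "sum_map Y E1 E2 E m" "sum_map Y E1 E2 E' m'"
    using assms by (auto simp: ext_sum_def)
  interpret S: sum_of_extensions Z Y X1 i1 p1 X2 i2 p2 X i p m
    using assms m unfolding ext_sum_def E by unfold_locales auto
  interpret S': sum_of_extensions Z Y X1 i1 p1 X2 i2 p2 X' i' p' m'
    using assms m unfolding ext_sum_def E by unfold_locales auto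
  have "m' w = 0" if w: "w \<in> topspace S.F" "m w = 0" for w
  proof -
    obtain y where "y \<in> topspace Y" "w = (i1 y, i2 (- y))" using S.m_kernelE w by blast
    then show ?thesis using S'.m_i[of y "- y"] S.A.sub(1) S'.C.i_linear(3) by (simp add: subspace_neg)
  qed
  then obtain T where T: "continuous_linear X X' T" "\<And>w. w \<in> topspace S.F \<Longrightarrow> T (m w) = m' w"
    using continuous_linear_factor[OF S.F_tvs S.m_cl S.m_open S'.m_cl] by blast
  have "T (i y) = i' y" if "y \<in> topspace Y" for y
  proof -
    have "(i1 y, 0) \<in> topspace S.F" using that S.F_axis by (auto simp: continuous_map_def)
    then show ?thesis using T(2) S.m_axis[OF that] S'.m_axis[OF that] by metis
  qed
  moreover have "p' (T x) = p x" if "x \<in> topspace X" for x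
  proof -
    have "x \<in> m ` topspace S.F" using that by (simp add: S.m_open(2))
    then obtain w where "w \<in> topspace S.F" "x = m w" by blast
    then show ?thesis using T(2) S.p_m S'.p_m by simp
  qed
  ultimately show ?thesis using T(1) by (auto simp: E ext_equiv_def)
qed

lemma ext_sum_cong:
  assumes sum: "ext_sum Z Y E1 E2 E"
    and ext: "extension Z Y E1'" "extension Z Y E2'" "extension Z Y E'"
    and equiv: "ext_equiv Z Y E1' E1" "ext_equiv Z Y E2' E2" "ext_equiv Z Y E E'"
  shows "ext_sum Z Y E1' E2' E'"
proof -
  obtain X1 i1 p1 X2 i2 p2 X i p where
    E: "E1 = (X1, i1, p1)" "E2 = (X2, i2, p2)" "E = (X, i, p)"
    by (cases E1, cases E2, cases E)
  obtain Y1 j1 r1 Y2 j2 r2 X' i' p' where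
    E': "E1' = (Y1, j1, r1)" "E2' = (Y2, j2, r2)" "E' = (X', i', p')"
    by (cases E1', cases E2', cases E')
  obtain m where m: "sum_map Y E1 E2 E m" using sum by (auto simp: ext_sum_def)
  interpret S: sum_of_extensions Z Y X1 i1 p1 X2 i2 p2 X i p m
    using sum m unfolding ext_sum_def E by unfold_locales auto
  interpret P: extension_pair Z Y Y1 j1 r1 Y2 j2 r2
    using ext unfolding E' by unfold_locales auto
  obtain T1 T2 T where T1: "continuous_linear Y1 X1 T1" "\<And>y. y \<in> topspace Y \<Longrightarrow> T1 (j1 y) = i1 y"
      "\<And>x. x \<in> topspace Y1 \<Longrightarrow> p1 (T1 x) = r1 x"
    and T2: "continuous_linear Y2 X2 T2" "\<And>y. y \<in> topspace Y \<Longrightarrow> T2 (j2 y) = i2 y"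
      "\<And>x. x \<in> topspace Y2 \<Longrightarrow> p2 (T2 x) = r2 x"
    and T: "continuous_linear X X' T" "\<And>y. y \<in> topspace Y \<Longrightarrow> T (i y) = i' y"
      "\<And>x. x \<in> topspace X \<Longrightarrow> p' (T x) = p x"
    using equiv unfolding E E' ext_equiv_def prod.case by blast
  define t where "t = (\<lambda>w. (T1 (fst w), T2 (snd w)))"
  have "continuous_map P.F S.F t"
    unfolding t_def
  proof (rule continuous_map_into_fibre_product)
    show "continuous_map P.F X1 (\<lambda>w. T1 (fst w))"
      using continuous_map_compose[OF continuous_map_fibre_product(1)] T1(1)
      by (fastforce simp: continuous_linear_def o_def)
    show "continuous_map P.F X2 (\<lambda>w. T2 (snd w))"
      using continuous_map_compose[OF continuous_map_fibre_product(2)] T2(1)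
      by (fastforce simp: continuous_linear_def o_def)
  qed (auto simp: P.F_iff T1 T2)
  moreover have "linear_on (topspace P.F) t"
    using T1(1) T2(1) by (auto simp: continuous_linear_def linear_on_def P.F_iff t_def)
  ultimately have t: "continuous_linear P.F S.F t" by (simp add: continuous_linear_def)
  have "sum_map Y E1' E2' E' (\<lambda>w. T (m (t w)))"
    unfolding sum_map_def E' prod.case
  proof (intro conjI ballI)
    show "continuous_linear P.F X' (\<lambda>w. T (m (t w)))"
      using continuous_linear_compose[OF continuous_linear_compose[OF t S.m_cl] T(1)] .
    show "T (m (t (j1 y, j2 y'))) = i' (y + y')" if "y \<in> topspace Y" "y' \<in> topspace Y" for y y'
      using that T1(2) T2(2) T(2) S.m_i S.A.sub(1) by (simp add: t_def subspace_add)
    show "p' (T (m (t w))) = r1 (fst w)" if w: "w \<in> topspace P.F" for w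
    proof -
      have "t w \<in> topspace S.F" using t w by (rule continuous_linear_in)
      moreover from this have "m (t w) \<in> topspace X" by (rule continuous_linear_in[OF S.m_cl])
      moreover have "fst w \<in> topspace Y1" using w P.F_iff by (metis prod.collapse)
      ultimately show ?thesis using T(3) S.p_m T1(3) by (simp add: t_def)
    qed
  qed
  then show ?thesis using ext by (auto simp: ext_sum_def)
qed

section \<open>Sums of extensions are the Baer sums\<close>

context extension_pair
begin

text \<open>
  The pull-back of the product extension along the diagonal of \<open>Z\<close> carries a third coordinate that
  the other two determine; dropping it identifies this space with the fibre product \<open>F\<close>.
\<close>

abbreviation "G \<equiv> fibre_product (prod_topology X1 X2) (map_prod p1 p2) Z (\<lambda>z. (z, z))"

lemma G_iff: "((x, w), z) \<in> topspace G \<longleftrightarrow> (x, w) \<in> topspace F \<and> z = p1 x"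
  by (auto simp: topspace_fibre_product B.p_in)

lemma G_tvs: "tvs G"
proof (rule tvs_fibre_product)
  show "tvs (prod_topology X1 X2)" using A.tvs(2) B.tvs(2) by (rule tvs_prod_topology)
  show "linear_on (topspace (prod_topology X1 X2)) (map_prod p1 p2)"
    by (auto simp: linear_on_def A.p_linear B.p_linear)
qed (auto simp: A.tvs linear_on_def)

lemma G_section: "continuous_map F G (\<lambda>w. (w, p1 (fst w)))"
proof (rule continuous_map_into_fibre_product)
  show "continuous_map F (prod_topology X1 X2) (\<lambda>w. w)"
    unfolding fibre_product_def by (rule continuous_map_from_subtopology) simp
  show "continuous_map F Z (\<lambda>w. p1 (fst w))"
    using continuous_map_compose[OF continuous_map_fibre_product(1) A.p_cont] by (simp add: o_def)
qed (auto simp: F_iff)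

lemma G_fst: "continuous_map G F fst"
  unfolding fibre_product_def[of X1]
  by (rule continuous_map_into_subtopology[OF continuous_map_fibre_product(1)])
    (auto simp: topspace_fibre_product)

lemma baer_middle:
  "pullback_ext Z (\<lambda>z. (z, z)) (product_ext (X1, i1, p1) (X2, i2, p2)) =
    (G, \<lambda>y. (map_prod i1 i2 y, 0), snd)"
  by (simp add: product_ext_def pullback_ext_def fibre_product_def)

end

context sum_of_extensions
begin

text \<open>
  The quotient map of the push-out is \<open>q (v, g) = i v + m (fst g)\<close>. It is open and onto by the five
  lemma, and its kernel is computed from that of \<open>m\<close>.
\<close>

lemma baer_quotient: "is_baer_sum Z Y (X1, i1, p1) (X2, i2, p2) (X, i, p)"
proof -
  let ?P = "prod_topology Y G"
  define q where "q = (\<lambda>(v, g :: ('x \<times> 'w) \<times> 'z). i v + m (fst g))"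
  have in_F: "fst g \<in> topspace F" if "g \<in> topspace G" for g
    using that by (auto simp: topspace_fibre_product)
  have P_tvs: "tvs ?P" using A.tvs(1) G_tvs by (rule tvs_prod_topology)
  have P_iff: "(v, g) \<in> topspace ?P \<longleftrightarrow> v \<in> topspace Y \<and> g \<in> topspace G" for v g by simp
  have q_lin: "linear_on (topspace ?P) q"
    using in_F unfolding linear_on_def q_def
    by (auto simp: C.i_linear m_linear scaleR_add_right)
  have "continuous_map ?P X (i \<circ> fst)"
    using continuous_map_fst C.i_cont by (rule continuous_map_compose)
  moreover have "continuous_map ?P X (m \<circ> (fst \<circ> snd))"
    using continuous_map_snd G_fst m_cont by (intro continuous_map_compose)
  ultimately have "continuous_map ?P X (\<lambda>v. (i \<circ> fst) v + (m \<circ> (fst \<circ> snd)) v)"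
    using C.tvs(2) by (intro continuous_map_tvs_add)
  then have q_cont: "continuous_map ?P X q"
    by (rule continuous_map_eq) (auto simp: q_def)
  then have q_cl: "continuous_linear ?P X q" using q_lin by (simp add: continuous_linear_def)
  have pq: "p (q (v, g)) = snd g" if "v \<in> topspace Y" "g \<in> topspace G" for v g
  proof -
    have "m (fst g) \<in> topspace X" using continuous_linear_in[OF m_cl] in_F that by blast
    moreover have "snd g = p1 (fst (fst g))" using that(2) by (auto simp: topspace_fibre_product)
    ultimately show ?thesis
      using that in_F[OF that(2)] p_m C.i_in C.p_i by (simp add: q_def C.p_linear)
  qed
  \<comment> \<open>The map \<open>p \<circ> q\<close> is open because its composition with the continuous map \<open>u\<close> is the projection
    of \<open>F\<close> to \<open>Z\<close>.\<close>
  define u where "u = (\<lambda>w::'x \<times> 'w. (0::'y, (w, p1 (fst w))))"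
  have u_cont: "continuous_map F ?P u"
    unfolding u_def using A.zero_in G_section by (intro continuous_map_pairedI) auto
  have u_in: "u w \<in> topspace ?P" if "w \<in> topspace F" for w
    using u_cont that by (auto simp: continuous_map_def)
  have op: "open_map ?P Z (\<lambda>v. p (q v))"
  proof (rule open_map_at_zero[OF P_tvs A.tvs(3)])
    show "linear_on (topspace ?P) (\<lambda>v. p (q v))" "(\<lambda>v. p (q v)) ` topspace ?P \<subseteq> topspace Z"
      using continuous_linear_compose[OF q_cl, of Z p] C.p_cont C.p_lin
      by (auto simp: continuous_linear_def continuous_map_def)
    fix U assume U: "nbhd_zero ?P U" "U \<subseteq> topspace ?P"
    have "nbhd_zero F {w \<in> topspace F. u w \<in> U}"
      using u_cont _ _ U(1)
      by (rule nbhd_zero_continuous) (use subspace_0[OF F_sub] in \<open>auto simp: u_def zero_prod_def A.p_linear\<close>)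
    then have "nbhd_zero Z ((\<lambda>w. p1 (fst w)) ` {w \<in> topspace F. u w \<in> U})"
      by (rule open_map_nbhd_zero[OF F_projection(1), rotated]) (simp add: A.p_linear)
    then show "nbhd_zero Z ((\<lambda>v. p (q v)) ` U)"
    proof (rule nbhd_zero_mono, intro subsetI)
      fix z assume "z \<in> (\<lambda>w. p1 (fst w)) ` {w \<in> topspace F. u w \<in> U}"
      then obtain w where w: "w \<in> topspace F" "u w \<in> U" "z = p1 (fst w)" by blast
      have "p (q (u w)) = z" using pq u_in[OF w(1)] w(3) by (simp add: u_def)
      then show "z \<in> (\<lambda>v. p (q v)) ` U" using w(2) by blast
    qed
  qed
  have onto: "(\<lambda>v. p (q v)) ` topspace ?P = topspace Z"
  proof
    show "(\<lambda>v. p (q v)) ` topspace ?P \<subseteq> topspace Z"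
      using continuous_linear_in[OF q_cl] C.p_in by blast
    show "topspace Z \<subseteq> (\<lambda>v. p (q v)) ` topspace ?P"
    proof
      fix z assume "z \<in> topspace Z"
      then have "z \<in> (\<lambda>w. p1 (fst w)) ` topspace F" by (simp add: F_projection(2))
      then obtain w where w: "w \<in> topspace F" "z = p1 (fst w)" by blast
      then have "p (q (u w)) = z" using pq u_in[OF w(1)] by (simp add: u_def)
      then show "z \<in> (\<lambda>v. p (q v)) ` topspace ?P" using u_in[OF w(1)] by blast
    qed
  qed
  have axis: "continuous_map Y ?P (\<lambda>y. (y, 0))"
    using G_tvs by (intro continuous_map_pairedI) (auto simp: tvs_def subspace_0)
  have "quotient_map ?P X q"
    using C.open_map_onto_middle[OF P_tvs q_cl op onto axis]
    by (intro continuous_open_imp_quotient_map[OF q_cont])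
      (auto simp: q_def zero_prod_def m_linear(3)[unfolded zero_prod_def])
  moreover have "{w \<in> topspace Y \<times> topspace G. q w = 0} =
      (\<lambda>y. (case y of (y, y') \<Rightarrow> y + y', - (map_prod i1 i2 y, 0))) ` topspace (prod_topology Y Y)"
    (is "?K = ?R")
  proof (intro equalityI subsetI)
    fix v assume v: "v \<in> ?K"
    obtain y x w z where v_eq: "v = (y, ((x, w), z))" by (metis surj_pair)
    have y: "y \<in> topspace Y" and g: "((x, w), z) \<in> topspace G" and q0: "i y + m (x, w) = 0"
      using v by (auto simp: v_eq q_def)
    have xw: "(x, w) \<in> topspace F" "z = p1 x" using g unfolding G_iff by auto
    have "z = 0" using pq[OF y g] q0 C.p_linear(3) by (simp add: q_def)
    then obtain a b where ab: "a \<in> topspace Y" "b \<in> topspace Y" "x = i1 a" "w = i2 b"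
      using F_kernelE xw by metis
    have "i (y + (a + b)) = 0" using q0 y ab m_i A.sub(1) by (simp add: C.i_linear subspace_add)
    then have "y + (a + b) = 0" using y ab A.sub(1) C.i_eq_0 by (simp add: subspace_add)
    then have "y = - a + - b" by (simp add: eq_neg_iff_add_eq_0 algebra_simps)
    then have "v = (- a + - b, - (map_prod i1 i2 (- a, - b), 0))"
      using \<open>z = 0\<close> ab by (simp add: v_eq A.i_linear B.i_linear)
    then show "v \<in> ?R" using ab A.sub(1)
      by (intro image_eqI[of _ _ "(- a, - b)"]) (auto simp: subspace_neg)
  next
    fix v assume "v \<in> ?R"
    then obtain a b where ab: "a \<in> topspace Y" "b \<in> topspace Y" "v = (a + b, ((- i1 a, - i2 b), 0))"
      by auto
    have F: "(i1 a, i2 b) \<in> topspace F" using ab by (simp add: F_iff A.i_in B.i_in A.p_i B.p_i)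
    then have F': "(- i1 a, - i2 b) \<in> topspace F" using F_sub subspace_neg by fastforce
    have "m (- i1 a, - i2 b) = - i (a + b)" using m_linear(4)[OF F] m_i ab by simp
    moreover have "((- i1 a, - i2 b), 0) \<in> topspace G"
      using F' ab A.i_in A.p_i by (auto simp: G_iff A.p_linear)
    ultimately show "v \<in> ?K"
      using ab A.sub(1) by (auto simp: q_def subspace_add)
  qed
  ultimately show ?thesis
    unfolding is_baer_sum_def baer_middle is_pushout_ext_def prod.case
    using q_lin pq by (intro exI[of _ q]) (auto simp: q_def zero_prod_def m_linear(3)[unfolded zero_prod_def])
qed

end

text \<open>
  Conversely, a push-out quotient map \<open>q\<close> gives the sum map \<open>w \<mapsto> q (0, w)\<close>. Elements
  \<open>(y + y', 0)\<close> and \<open>(0, (i1 y, i2 y'))\<close> differ by one of the kernel, so it adds the two copies of \<open>Y\<close>.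
\<close>

lemma is_baer_sum_iff_ext_sum:
  fixes Z :: "'z::real_vector topology" and Y :: "'y::real_vector topology"
    and E1 :: "('y, 'x::real_vector, 'z) ext" and E2 :: "('y, 'w::real_vector, 'z) ext"
    and E :: "('y, 'v::real_vector, 'z) ext"
  assumes "extension Z Y E1" "extension Z Y E2" "extension Z Y E"
  shows "is_baer_sum Z Y E1 E2 E \<longleftrightarrow> ext_sum Z Y E1 E2 E"
proof -
  obtain X1 i1 p1 X2 i2 p2 X i p where
    E: "E1 = (X1, i1, p1)" "E2 = (X2, i2, p2)" "E = (X, i, p)"
    by (cases E1, cases E2, cases E)
  interpret extension_pair Z Y X1 i1 p1 X2 i2 p2
    using assms unfolding E by unfold_locales auto
  interpret C: tvs_extension Z Y X i p using assms unfolding E by unfold_locales auto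
  show ?thesis
  proof
    assume "ext_sum Z Y E1 E2 E"
    then obtain m where m: "sum_map Y E1 E2 E m" by (auto simp: ext_sum_def)
    interpret sum_of_extensions Z Y X1 i1 p1 X2 i2 p2 X i p m
      using m unfolding E by unfold_locales auto
    show "is_baer_sum Z Y E1 E2 E" unfolding E by (rule baer_quotient)
  next
    assume "is_baer_sum Z Y E1 E2 E"
    then obtain q where q_lin: "linear_on (topspace Y \<times> topspace G) q"
      and q_quot: "quotient_map (prod_topology Y G) X q"
      and q_ker: "{w \<in> topspace Y \<times> topspace G. q w = 0} =
        (\<lambda>y. (case y of (y, y') \<Rightarrow> y + y', - (map_prod i1 i2 y, 0))) ` topspace (prod_topology Y Y)"
      and q_i: "\<forall>v\<in>topspace Y. i v = q (v, 0)"
      and q_p: "\<forall>v\<in>topspace Y. \<forall>x\<in>topspace G. p (q (v, x)) = snd x"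
      unfolding E is_baer_sum_def baer_middle is_pushout_ext_def prod.case by blast
    have sub: "subspace (topspace Y \<times> topspace G)"
      using A.sub(1) G_tvs by (auto simp: tvs_def subspace_Times)
    note q_linear = linear_onD[OF q_lin sub]
    define u where "u = (\<lambda>w::'x \<times> 'w. (0::'y, (w, p1 (fst w))))"
    have u_cont: "continuous_map F (prod_topology Y G) u"
      unfolding u_def using A.zero_in G_section by (intro continuous_map_pairedI) auto
    have u_lin: "linear_on (topspace F) u"
      by (auto simp: linear_on_def u_def F_iff A.p_linear)
    have q_cl: "continuous_linear (prod_topology Y G) X q"
      using q_quot q_lin by (simp add: continuous_linear_def quotient_imp_continuous_map)
    have u_cl: "continuous_linear F (prod_topology Y G) u"
      using u_cont u_lin by (simp add: continuous_linear_def)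
    have "q (u (i1 y, i2 y')) = i (y + y')" if y: "y \<in> topspace Y" "y' \<in> topspace Y" for y y'
    proof -
      let ?k = "(y + y', - ((i1 y, i2 y'), 0::'z))"
      have "?k \<in> {w \<in> topspace Y \<times> topspace G. q w = 0}"
        unfolding q_ker using y by (intro image_eqI[of _ _ "(y, y')"]) auto
      then have k: "?k \<in> topspace Y \<times> topspace G" "q ?k = 0" by auto
      have u: "u (i1 y, i2 y') \<in> topspace Y \<times> topspace G"
        using continuous_linear_in[OF u_cl, of "(i1 y, i2 y')"] y
        by (simp add: F_iff A.i_in B.i_in A.p_i B.p_i)
      have "i (y + y') = q (y + y', 0)" using q_i y A.sub(1) by (simp add: subspace_add)
      also have "(y + y', 0) = u (i1 y, i2 y') + ?k" using y by (simp add: u_def A.p_i zero_prod_def)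
      also have "q \<dots> = q (u (i1 y, i2 y'))" using q_linear(1)[OF u k(1)] k(2) by simp
      finally show ?thesis by simp
    qed
    moreover have "p (q (u w)) = p1 (fst w)" if "w \<in> topspace F" for w
      using continuous_linear_in[OF u_cl that] q_p by (auto simp: u_def)
    ultimately have "sum_map Y E1 E2 E (\<lambda>w. q (u w))"
      using continuous_linear_compose[OF u_cl q_cl] by (simp add: sum_map_def E)
    then show "ext_sum Z Y E1 E2 E" using assms by (auto simp: ext_sum_def)
  qed
qed

section \<open>Laws of the sum\<close>

lemma ext_sum_commute:
  fixes Z :: "'z::real_vector topology" and Y :: "'y::real_vector topology"
    and E1 :: "('y, 'x::real_vector, 'z) ext" and E2 :: "('y, 'w::real_vector, 'z) ext"
    and E :: "('y, 'v::real_vector, 'z) ext"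
  assumes "ext_sum Z Y E1 E2 E"
  shows "ext_sum Z Y E2 E1 E"
proof -
  obtain X1 i1 p1 X2 i2 p2 X i p where
    E: "E1 = (X1, i1, p1)" "E2 = (X2, i2, p2)" "E = (X, i, p)"
    by (cases E1, cases E2, cases E)
  obtain m where m: "sum_map Y E1 E2 E m" using assms by (auto simp: ext_sum_def)
  interpret sum_of_extensions Z Y X1 i1 p1 X2 i2 p2 X i p m
    using assms m unfolding ext_sum_def E by unfold_locales auto
  interpret S: extension_pair Z Y X2 i2 p2 X1 i1 p1 ..
  define s where "s = (\<lambda>w::'w \<times> 'x. (snd w, fst w))"
  have "continuous_map S.F F s"
    unfolding s_def using continuous_map_fibre_product[of X2 p2 X1 p1]
    by (intro continuous_map_into_fibre_product) (auto simp: S.F_iff)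
  then have s: "continuous_linear S.F F s"
    by (auto simp: continuous_linear_def linear_on_def s_def)
  have "sum_map Y E2 E1 E (\<lambda>w. m (s w))"
    unfolding sum_map_def E prod.case
    using continuous_linear_compose[OF s m_cl] m_i p_m continuous_linear_in[OF s]
    by (auto simp: s_def add.commute S.F_iff)
  then show ?thesis using assms by (auto simp: ext_sum_def)
qed

text \<open>
  The sum map is \<open>((y, z), x) \<mapsto> i y + x\<close>.
\<close>

lemma ext_sum_trivial:
  fixes Z :: "'z::real_vector topology" and Y :: "'y::real_vector topology"
    and E :: "('y, 'x::real_vector, 'z) ext"
  assumes "extension Z Y E"
  shows "ext_sum Z Y (trivial_ext Z Y) E E"
proof -
  obtain X i p where E: "E = (X, i, p)" by (cases E)
  interpret X: tvs_extension Z Y X i p using assms unfolding E by unfold_locales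
  let ?T = "prod_topology Y Z"
  have triv: "extension Z Y (?T, \<lambda>y. (y, 0), snd)"
    using trivial_extension[OF X.tvs(3,1)] by (simp add: trivial_ext_def)
  interpret extension_pair Z Y ?T "\<lambda>y. (y, 0)" snd X i p
    using triv by unfold_locales
  define m where "m = (\<lambda>w::('y \<times> 'z) \<times> 'x. i (fst (fst w)) + snd w)"
  have "continuous_map F X (i \<circ> (fst \<circ> fst))"
    using continuous_map_fibre_product(1) continuous_map_fst X.i_cont by (intro continuous_map_compose)
  then have "continuous_map F X m"
    unfolding m_def using X.tvs(2) continuous_map_fibre_product(2)
    by (intro continuous_map_tvs_add) (auto simp: o_def)
  moreover have "linear_on (topspace F) m"
    by (auto simp: linear_on_def m_def F_iff X.i_linear scaleR_add_right)
  ultimately have "sum_map Y (trivial_ext Z Y) E E m"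
    by (auto simp: sum_map_def trivial_ext_def E continuous_linear_def m_def X.i_linear F_iff
        X.p_linear X.i_in X.p_i)
  then show ?thesis
    using assms trivial_extension[OF X.tvs(3,1)] by (auto simp: ext_sum_def)
qed

text \<open>
  The inverse is obtained by changing the sign of \<open>i\<close>. The sum map sends \<open>(x, x')\<close> to
  \<open>(i\<^sup>-\<^sup>1 (x' - x), p x)\<close>, whose first component is continuous because \<open>i\<close> is an embedding.
\<close>

lemma ext_sum_inverse:
  fixes Z :: "'z::real_vector topology" and Y :: "'y::real_vector topology"
    and E :: "('y, 'x::real_vector, 'z) ext"
  assumes "extension Z Y E"
  obtains E' :: "('y, 'x, 'z) ext" where "ext_sum Z Y E' E (trivial_ext Z Y)"
proof -
  obtain X i p where E: "E = (X, i, p)" by (cases E)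
  interpret X: tvs_extension Z Y X i p using assms unfolding E by unfold_locales
  define j where "j = (\<lambda>y. i (- y))"
  have Y_neg: "- y \<in> topspace Y" if "y \<in> topspace Y" for y using that X.sub(1) by (rule subspace_neg[rotated])
  have neg: "continuous_map Y Y (\<lambda>y. - y)"
    using continuous_map_tvs_neg[OF X.tvs(1) continuous_map_id] by simp
  have "extension Z Y (X, j, p)"
  proof (rule extensionI[OF X.tvs])
    show "linear_on (topspace Y) j"
      using X.i_linear Y_neg by (auto simp: linear_on_def j_def) (metis X.i_linear(4) X.i_linear(2) scaleR_minus_right)
    show "inj_on j (topspace Y)"
    proof (rule inj_onI)
      fix x y assume "x \<in> topspace Y" "y \<in> topspace Y" "j x = j y"
      then have "- x = - y" using inj_onD[OF X.i_inj, of "- x" "- y"] Y_neg by (simp add: j_def)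
      then show "x = y" by simp
    qed
    have "j ` topspace Y = i ` topspace Y"
      using Y_neg by (force simp: j_def image_iff)
    then show "j ` topspace Y = {x \<in> topspace X. p x = 0}" by (simp add: X.kernel)
    have "continuous_map Y X (i \<circ> (\<lambda>y. - y))" using neg X.i_cont by (rule continuous_map_compose)
    then show "nbhd_zero Y {y \<in> topspace Y. j y \<in> N}" if "nbhd_zero X N" for N
      using nbhd_zero_continuous[of Y X "i \<circ> (\<lambda>y. - y)" N] that X.zero_in X.i_linear(3)
      by (simp add: j_def)
    show "\<exists>W. nbhd_zero X W \<and> (\<forall>y\<in>topspace Y. j y \<in> W \<longrightarrow> y \<in> N)" if N: "nbhd_zero Y N" for N
    proof -
      have "nbhd_zero Y {y \<in> topspace Y. - y \<in> N}"
        using nbhd_zero_continuous[OF neg] N X.zero_in by simp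
      then obtain W where W: "openin X W" "0 \<in> W"
          "\<And>y. y \<in> topspace Y \<Longrightarrow> i y \<in> W \<Longrightarrow> y \<in> {y \<in> topspace Y. - y \<in> N}"
        by (rule X.i_embedding) blast
      have "y \<in> N" if "y \<in> topspace Y" "j y \<in> W" for y
        using W(3)[of "- y"] that Y_neg by (simp add: j_def)
      then show ?thesis using W by (intro exI[of _ W]) (auto intro: nbhd_zero_open)
    qed
    show "nbhd_zero X {x \<in> topspace X. p x \<in> N}" if "nbhd_zero Z N" for N
      using nbhd_zero_continuous[OF X.p_cont X.p_linear(3) X.zero_in(2) that] .
  qed (auto simp: X.p_lin X.p_onto X.p_nbhd_zero)
  then interpret extension_pair Z Y X j p X i p by unfold_locales
  have diff: "snd w - fst w \<in> topspace X" "p (snd w - fst w) = 0" if "w \<in> topspace F" for w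
    using that X.sub(2) by (auto simp: topspace_fibre_product subspace_diff X.p_linear)
  define h where "h = (\<lambda>x. inv_into (topspace Y) i x)"
  have h_i: "h (i y) = y" if "y \<in> topspace Y" for y
    using that X.i_inj by (simp add: h_def)
  have h: "h (snd w - fst w) \<in> topspace Y" "i (h (snd w - fst w)) = snd w - fst w"
    if w: "w \<in> topspace F" for w
    using X.kernelE[OF diff[OF w]] h_i by metis+
  define d where "d = (\<lambda>w::'x \<times> 'x. h (snd w - fst w))"
  have eq: "d w = y" if "w \<in> topspace F" "y \<in> topspace Y" "i y = snd w - fst w" for w y
    using that h_i by (metis d_def)
  have d_lin: "linear_on (topspace F) d"
    unfolding linear_on_def
  proof (intro conjI ballI allI)
    show "d (v + w) = d v + d w" if "v \<in> topspace F" "w \<in> topspace F" for v w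
      by (rule eq)
        (use that h F_sub X.sub(1) in \<open>auto simp: d_def subspace_add X.i_linear\<close>)
    show "d (r *\<^sub>R v) = r *\<^sub>R d v" if "v \<in> topspace F" for r v
      by (rule eq)
        (use that h F_sub X.sub(1) in \<open>auto simp: d_def subspace_scale X.i_linear scaleR_diff_right\<close>)
  qed
  have "continuous_map F Y d"
  proof (rule continuous_map_at_zero[OF F_tvs X.tvs(1) d_lin])
    show "d ` topspace F \<subseteq> topspace Y" using h by (auto simp: d_def)
    fix N assume "nbhd_zero Y N"
    then obtain W where W: "openin X W" "0 \<in> W" "\<And>y. y \<in> topspace Y \<Longrightarrow> i y \<in> W \<Longrightarrow> y \<in> N"
      by (rule X.i_embedding) blast
    have "continuous_map F X (\<lambda>w. snd w + - fst w)"
      using continuous_map_fibre_product X.tvs(2)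
      by (intro continuous_map_tvs_add continuous_map_tvs_neg)
    then have "nbhd_zero F {w \<in> topspace F. snd w + - fst w \<in> W}"
      by (rule nbhd_zero_continuous)
        (use W F_sub in \<open>auto intro: nbhd_zero_open simp: subspace_0\<close>)
    then show "nbhd_zero F {w \<in> topspace F. d w \<in> N}"
      by (rule nbhd_zero_mono) (use W(3) h in \<open>auto simp: d_def\<close>)
  qed
  moreover have "continuous_map F Z (p \<circ> fst)"
    using continuous_map_fibre_product(1) X.p_cont by (rule continuous_map_compose)
  ultimately have "continuous_map F (prod_topology Y Z) (\<lambda>w. (d w, p (fst w)))"
    by (intro continuous_map_pairedI) (auto simp: o_def)
  moreover have "linear_on (topspace F) (\<lambda>w. (d w, p (fst w)))"
    using linear_onD[OF d_lin F_sub] X.p_linear by (auto simp: linear_on_def F_iff)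
  moreover have "d (j y, i y') = y + y'" if "y \<in> topspace Y" "y' \<in> topspace Y" for y y'
    by (rule eq)
      (use that X.sub in \<open>auto simp: j_def F_iff X.i_in X.p_i subspace_add subspace_neg X.i_linear X.p_linear\<close>)
  ultimately have "sum_map Y (X, j, p) (X, i, p) (trivial_ext Z Y) (\<lambda>w. (d w, p (fst w)))"
    using A.p_i by (auto simp: sum_map_def trivial_ext_def continuous_linear_def)
  then have "ext_sum Z Y (X, j, p) E (trivial_ext Z Y)"
    using A.ext assms trivial_extension[OF X.tvs(3,1)] by (auto simp: ext_sum_def E)
  then show thesis by (rule that)
qed

text \<open>
  Both bracketings are governed by the triple fibre product \<open>?F\<close> of \<open>X1\<close>, \<open>X2\<close>, \<open>X3\<close>. The map
  \<open>t (x1, (x2, x3)) = (x1, mC (x2, x3))\<close> onto the fibre product of \<open>X1\<close> and \<open>XC\<close> is open, because \<open>mC\<close>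
  is open, and \<open>g (x1, (x2, x3)) = mB (mA (x1, x2), x3)\<close> vanishes on its kernel. So \<open>g\<close>
  factors through \<open>t\<close>, and the factor is a sum map for \<open>E1\<close> and \<open>EC\<close>.
\<close>

lemma ext_sum_assoc:
  fixes Z :: "'z::real_vector topology" and Y :: "'y::real_vector topology"
    and E1 :: "('y, 'x1::real_vector, 'z) ext" and E2 :: "('y, 'x2::real_vector, 'z) ext"
    and E3 :: "('y, 'x3::real_vector, 'z) ext" and EA :: "('y, 'a::real_vector, 'z) ext"
    and EB :: "('y, 'b::real_vector, 'z) ext" and EC :: "('y, 'c::real_vector, 'z) ext"
  assumes A: "ext_sum Z Y E1 E2 EA" and C: "ext_sum Z Y E2 E3 EC" and B: "ext_sum Z Y EA E3 EB"
  shows "ext_sum Z Y E1 EC EB"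
proof -
  obtain X1 i1 p1 X2 i2 p2 X3 i3 p3 where
    E: "E1 = (X1, i1, p1)" "E2 = (X2, i2, p2)" "E3 = (X3, i3, p3)"
    by (cases E1, cases E2, cases E3)
  obtain XA iA pA XB iB pB XC iC pC where
    E': "EA = (XA, iA, pA)" "EB = (XB, iB, pB)" "EC = (XC, iC, pC)"
    by (cases EA, cases EB, cases EC)
  obtain mA mB mC where m: "sum_map Y E1 E2 EA mA" "sum_map Y E2 E3 EC mC" "sum_map Y EA E3 EB mB"
    using assms by (auto simp: ext_sum_def)
  interpret A: sum_of_extensions Z Y X1 i1 p1 X2 i2 p2 XA iA pA mA
    using assms m unfolding ext_sum_def E E' by unfold_locales auto
  interpret C: sum_of_extensions Z Y X2 i2 p2 X3 i3 p3 XC iC pC mC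
    using assms m unfolding ext_sum_def E E' by unfold_locales auto
  interpret B: sum_of_extensions Z Y XA iA pA X3 i3 p3 XB iB pB mB
    using assms m unfolding ext_sum_def E E' by unfold_locales auto
  interpret P: extension_pair Z Y X1 i1 p1 XC iC pC ..
  let ?F = "fibre_product X1 p1 C.F (\<lambda>w. p2 (fst w))"
  have F_iff: "(x, w) \<in> topspace ?F \<longleftrightarrow> x \<in> topspace X1 \<and> w \<in> topspace C.F \<and> p1 x = p2 (fst w)" for x w
    by (simp add: topspace_fibre_product)
  have C_in: "fst w \<in> topspace X2" "snd w \<in> topspace X3" "p2 (fst w) = p3 (snd w)"
    if "w \<in> topspace C.F" for w
    using that by (auto simp: topspace_fibre_product)
  have "linear_on (topspace C.F) (\<lambda>w. p2 (fst w))"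
    using A.B.p_linear by (auto simp: linear_on_def C.F_iff)
  then have F_tvs: "tvs ?F"
    using tvs_fibre_product[OF A.A.tvs(2) C.F_tvs A.A.p_lin] by blast
  have F_sub: "subspace (topspace ?F)" using F_tvs by (rule tvs_subspace)
  have F_snd: "snd w \<in> topspace C.F" if "w \<in> topspace ?F" for w
    using that F_iff by (metis prod.collapse)
  define t where "t = (\<lambda>w::'x1 \<times> 'x2 \<times> 'x3. (fst w, mC (snd w)))"
  define g where "g = (\<lambda>w::'x1 \<times> 'x2 \<times> 'x3. mB (mA (fst w, fst (snd w)), snd (snd w)))"
  have f1: "continuous_map ?F X1 fst" and f2: "continuous_map ?F C.F snd"
    by (rule continuous_map_fibre_product)+
  have f3: "continuous_map ?F X2 (\<lambda>w. fst (snd w))" "continuous_map ?F X3 (\<lambda>w. snd (snd w))"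
    using continuous_map_compose[OF f2 continuous_map_fibre_product(1)]
      continuous_map_compose[OF f2 continuous_map_fibre_product(2)] by (simp_all add: o_def)
  have "continuous_map ?F P.F t"
    unfolding t_def
  proof (rule continuous_map_into_fibre_product[OF f1])
    show "continuous_map ?F XC (\<lambda>w. mC (snd w))"
      using continuous_map_compose[OF f2 C.m_cont] by (simp add: o_def)
    show "p1 (fst w) = pC (mC (snd w))" if "w \<in> topspace ?F" for w
      using that C.p_m by (auto simp: topspace_fibre_product)
  qed
  moreover have t_lin: "linear_on (topspace ?F) t"
    unfolding linear_on_def using F_snd by (simp add: t_def C.m_linear)
  ultimately have t: "continuous_linear ?F P.F t" by (simp add: continuous_linear_def)
  define a where "a = (\<lambda>w::'x1 \<times> 'x2 \<times> 'x3. (fst w, fst (snd w)))"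
  have "continuous_map ?F A.F a"
    unfolding a_def using f1 f3(1)
    by (rule continuous_map_into_fibre_product) (auto simp: topspace_fibre_product)
  then have a: "continuous_linear ?F A.F a"
    by (auto simp: continuous_linear_def linear_on_def a_def)
  define b where "b = (\<lambda>w::'x1 \<times> 'x2 \<times> 'x3. (mA (a w), snd (snd w)))"
  have pA: "pA (mA (a w)) = p1 (fst w)" if "w \<in> topspace ?F" for w
    using A.p_m[OF continuous_linear_in[OF a that]] by (simp add: a_def)
  have ma: "continuous_linear ?F XA (\<lambda>w. mA (a w))"
    using a A.m_cl by (rule continuous_linear_compose)
  have "continuous_map ?F B.F b"
    unfolding b_def
    by (rule continuous_map_into_fibre_product[OF _ f3(2)])
      (use ma pA in \<open>auto simp: continuous_linear_def topspace_fibre_product\<close>)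
  then have "continuous_linear ?F B.F b"
    using ma by (auto simp: continuous_linear_def linear_on_def b_def)
  then have "continuous_linear ?F XB (\<lambda>w. mB (b w))"
    using B.m_cl by (rule continuous_linear_compose)
  then have g: "continuous_linear ?F XB g" by (simp add: g_def b_def a_def)
  have b_in: "b w \<in> topspace B.F" if "w \<in> topspace ?F" for w
    using \<open>continuous_linear ?F B.F b\<close> that by (rule continuous_linear_in)
  have t_onto: "t ` topspace ?F = topspace P.F"
  proof
    show "t ` topspace ?F \<subseteq> topspace P.F" using continuous_linear_in[OF t] by blast
    show "topspace P.F \<subseteq> t ` topspace ?F"
    proof
      fix v assume "v \<in> topspace P.F"
      then have v: "fst v \<in> topspace X1" "snd v \<in> mC ` topspace C.F" "p1 (fst v) = pC (snd v)"
        by (auto simp: topspace_fibre_product[of X1] C.m_open(2))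
      then obtain w where w: "w \<in> topspace C.F" "snd v = mC w" by blast
      then have "(fst v, w) \<in> topspace ?F" using v C.p_m by (simp add: F_iff)
      moreover have "t (fst v, w) = v" using w(2) by (simp add: t_def prod_eq_iff)
      ultimately show "v \<in> t ` topspace ?F" by (metis imageI)
    qed
  qed
  have t_open: "open_map ?F P.F t"
  proof (rule open_map_at_zero[OF F_tvs P.F_tvs t_lin])
    show "t ` topspace ?F \<subseteq> topspace P.F" by (simp add: t_onto)
    fix U assume "nbhd_zero ?F U"
    then obtain V W where VW: "openin X1 V" "0 \<in> V" "openin C.F W" "0 \<in> W"
      "\<And>x w. x \<in> V \<Longrightarrow> w \<in> W \<Longrightarrow> p1 x = p2 (fst w) \<Longrightarrow> (x, w) \<in> U"
      by (rule nbhd_zero_fibre_product) blast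
    have "nbhd_zero XC (mC ` W)"
      using open_map_nbhd_zero[OF C.m_open(1) C.m_linear(3)] VW(3,4) by (simp add: nbhd_zero_open)
    then have "nbhd_zero P.F {(x, c). x \<in> V \<and> c \<in> mC ` W \<and> p1 x = pC c}"
      using VW(1,2) A.A.p_linear(3) C.C.p_linear(3)
      by (intro nbhd_zero_fibre_productI) (auto intro: nbhd_zero_open)
    then show "nbhd_zero P.F (t ` U)"
    proof (rule nbhd_zero_mono, clarify)
      fix x w assume xw: "x \<in> V" "w \<in> W" "p1 x = pC (mC w)"
      then have "w \<in> topspace C.F" using openin_subset[OF VW(3)] by blast
      then have "p1 x = p2 (fst w)" using C.p_m xw(3) by simp
      then have "(x, w) \<in> U" using VW(5) xw by blast
      then show "(x, mC w) \<in> t ` U" by (intro image_eqI[of _ _ "(x, w)"]) (auto simp: t_def)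
    qed
  qed
  have ker: "g w = 0" if w: "w \<in> topspace ?F" "t w = 0" for w
  proof -
    have w0: "fst w = 0" "mC (snd w) = 0" using w(2) by (auto simp: t_def zero_prod_def)
    have "snd w \<in> topspace C.F" using w(1) by (auto simp: topspace_fibre_product)
    then obtain y where y: "y \<in> topspace Y" "snd w = (i2 y, i3 (- y))"
      using C.m_kernelE w0(2) by blast
    have "mA (0, i2 y) = iA y"
      using A.m_i[OF A.A.zero_in(1) y(1)] A.A.i_linear(3) by simp
    then have "g w = mB (iA y, i3 (- y))" by (simp add: g_def w0 y(2))
    also have "\<dots> = iB (y + - y)" using y(1) A.A.sub(1) by (intro B.m_i) (auto simp: subspace_neg)
    finally show ?thesis using B.C.i_linear(3) by simp
  qed
  obtain T where T: "continuous_linear P.F XB T" "\<And>w. w \<in> topspace ?F \<Longrightarrow> T (t w) = g w"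
    using continuous_linear_factor[OF F_tvs t t_open t_onto g ker] by blast
  have "T (i1 y, iC y') = iB (y + y')" if y: "y \<in> topspace Y" "y' \<in> topspace Y" for y y'
  proof -
    have "(i1 y, (i2 y', 0)) \<in> topspace ?F"
      using y C.F_axis A.A.i_in A.A.p_i A.B.p_i by (auto simp: F_iff continuous_map_def)
    then have "T (i1 y, iC y') = g (i1 y, (i2 y', 0))"
      using T(2)[of "(i1 y, (i2 y', 0))"] C.m_axis[OF y(2)] by (simp add: t_def)
    also have "\<dots> = iB (y + y')"
      using A.m_i[OF y] B.m_axis y A.A.sub(1) by (simp add: g_def subspace_add)
    finally show ?thesis .
  qed
  moreover have "pB (T v) = p1 (fst v)" if "v \<in> topspace P.F" for v
  proof -
    have "v \<in> t ` topspace ?F" using that by (simp add: t_onto)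
    then obtain w where w: "w \<in> topspace ?F" "v = t w" by blast
    have "pB (g w) = pA (mA (a w))" using B.p_m[OF b_in[OF w(1)]] by (simp add: g_def b_def a_def)
    then show ?thesis using T(2)[OF w(1)] pA[OF w(1)] w(2) by (simp add: t_def)
  qed
  ultimately have "sum_map Y E1 EC EB T"
    using T(1) by (simp add: sum_map_def E E')
  then show ?thesis using assms by (auto simp: ext_sum_def)
qed

section \<open>The group of extension classes\<close>

definition ext_class ::
  "'z::real_vector topology \<Rightarrow> 'y::real_vector topology \<Rightarrow> ('y, 'y \<times> 'z, 'z) ext \<Rightarrow>
   ('y, 'y \<times> 'z, 'z) ext set" where
  "ext_class Z Y E = ext_rel Z Y `` {E}"

lemma mem_ext_class:
  "E' \<in> ext_class Z Y E \<longleftrightarrow> extension Z Y E \<and> extension Z Y E' \<and> ext_equiv Z Y E E'"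
  by (simp add: ext_class_def ext_rel_def)

lemma ext_class_eq_iff:
  "extension Z Y E \<Longrightarrow> extension Z Y E' \<Longrightarrow> ext_class Z Y E = ext_class Z Y E' \<longleftrightarrow> ext_equiv Z Y E E'"
  unfolding ext_class_def using eq_equiv_class_iff[OF equiv_ext_rel, of E Z Y E']
  by (auto simp: ext_rel_def)

lemma ext_classE:
  assumes "a \<in> carrier (Ext_TVS Z Y)"
  obtains E where "extension Z Y E" "a = ext_class Z Y E"
  using assms by (auto simp: Ext_TVS_def ext_class_def elim: quotientE)

lemma ext_class_in: "extension Z Y E \<Longrightarrow> ext_class Z Y E \<in> carrier (Ext_TVS Z Y)"
  by (auto simp: Ext_TVS_def ext_class_def intro: quotientI)

text \<open>
  The product in the group is a union over all representatives and all their Baer sums; uniqueness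
  and invariance of sums collapse it to a single class.
\<close>

lemma ext_sum_class:
  assumes "ext_sum Z Y E1 E2 E"
  shows "ext_class Z Y E1 \<otimes>\<^bsub>Ext_TVS Z Y\<^esub> ext_class Z Y E2 = ext_class Z Y E"
proof -
  have ext: "extension Z Y E1" "extension Z Y E2" "extension Z Y E"
    using assms by (auto simp: ext_sum_def)
  have "(\<Union>E1'\<in>ext_class Z Y E1. \<Union>E2'\<in>ext_class Z Y E2. ext_rel Z Y `` {E. is_baer_sum Z Y E1' E2' E})
      = ext_class Z Y E" (is "?L = _")
  proof (intro equalityI subsetI)
    fix E' assume "E' \<in> ?L"
    then obtain E1' E2' where *: "E1' \<in> ext_class Z Y E1" "E2' \<in> ext_class Z Y E2"
        "E' \<in> ext_rel Z Y `` {E. is_baer_sum Z Y E1' E2' E}" by blast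
    from *(3) obtain D where **: "is_baer_sum Z Y E1' E2' D" "(D, E') \<in> ext_rel Z Y"
      by (rule ImageE) simp
    have D: "extension Z Y E1'" "ext_equiv Z Y E1 E1'" "extension Z Y E2'" "ext_equiv Z Y E2 E2'"
        "is_baer_sum Z Y E1' E2' D" "extension Z Y D" "extension Z Y E'" "ext_equiv Z Y D E'"
      using * ** by (auto simp: mem_ext_class ext_rel_def)
    then have "ext_sum Z Y E1' E2' D" by (simp add: is_baer_sum_iff_ext_sum)
    then have "ext_sum Z Y E1 E2 E'" by (rule ext_sum_cong[OF _ ext(1,2) D(7) D(2,4,8)])
    then have "ext_equiv Z Y E E'" using assms by (intro ext_sum_unique)
    then show "E' \<in> ext_class Z Y E" using ext D by (simp add: mem_ext_class)
  next
    fix E' assume "E' \<in> ext_class Z Y E"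
    then have "E' \<in> ext_rel Z Y `` {E. is_baer_sum Z Y E1 E2 E}"
      using assms ext is_baer_sum_iff_ext_sum[OF ext] by (auto simp: ext_class_def)
    moreover have "E1 \<in> ext_class Z Y E1" "E2 \<in> ext_class Z Y E2"
      using ext by (auto simp: mem_ext_class ext_equiv_refl)
    ultimately show "E' \<in> ?L" by blast
  qed
  then show ?thesis by (simp add: Ext_TVS_def)
qed

lemma ext_sum_ex:
  fixes E1 E2 :: "('y::real_vector, 'y \<times> 'z, 'z::real_vector) ext"
  assumes "extension Z Y E1" "extension Z Y E2"
  obtains E :: "('y, 'y \<times> 'z, 'z) ext" where "ext_sum Z Y E1 E2 E" "extension Z Y E"
proof -
  obtain X1 i1 p1 X2 i2 p2 where E: "E1 = (X1, i1, p1)" "E2 = (X2, i2, p2)"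
    by (cases E1, cases E2)
  interpret extension_pair Z Y X1 i1 p1 X2 i2 p2
    using assms unfolding E by unfold_locales auto
  show thesis using ext_sum_exists that unfolding E by (metis ext_sum_def)
qed

proposition comm_group_Ext_TVS:
  fixes Z :: "'z::real_vector topology" and Y :: "'y::real_vector topology"
  assumes "tvs Z" "tvs Y"
  shows "comm_group (Ext_TVS Z Y)"
proof (rule comm_groupI)
  let ?c = "ext_class Z Y"
  have one: "\<one>\<^bsub>Ext_TVS Z Y\<^esub> = ?c (trivial_ext Z Y)" by (simp add: Ext_TVS_def ext_class_def)
  have triv: "extension Z Y (trivial_ext Z Y)" using assms by (rule trivial_extension)
  show "\<one>\<^bsub>Ext_TVS Z Y\<^esub> \<in> carrier (Ext_TVS Z Y)" using ext_class_in[OF triv] by (simp add: one)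
  fix a assume "a \<in> carrier (Ext_TVS Z Y)"
  then obtain E1 where E1: "extension Z Y E1" "a = ?c E1" by (rule ext_classE)
  show "\<one>\<^bsub>Ext_TVS Z Y\<^esub> \<otimes>\<^bsub>Ext_TVS Z Y\<^esub> a = a"
    using ext_sum_class[OF ext_sum_trivial[OF E1(1)]] by (simp add: E1(2) one)
  obtain E1' :: "('y, 'y \<times> 'z, 'z) ext" where "ext_sum Z Y E1' E1 (trivial_ext Z Y)"
    using ext_sum_inverse[OF E1(1)] by blast
  then show "\<exists>b\<in>carrier (Ext_TVS Z Y). b \<otimes>\<^bsub>Ext_TVS Z Y\<^esub> a = \<one>\<^bsub>Ext_TVS Z Y\<^esub>"
    using ext_sum_class E1(2) one ext_class_in by (metis ext_sum_def)
  fix b assume "b \<in> carrier (Ext_TVS Z Y)"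
  then obtain E2 where E2: "extension Z Y E2" "b = ?c E2" by (rule ext_classE)
  obtain EA :: "('y, 'y \<times> 'z, 'z) ext" where A: "ext_sum Z Y E1 E2 EA" "extension Z Y EA"
    using ext_sum_ex[OF E1(1) E2(1)] .
  show "a \<otimes>\<^bsub>Ext_TVS Z Y\<^esub> b \<in> carrier (Ext_TVS Z Y)"
    using ext_sum_class[OF A(1)] ext_class_in[OF A(2)] by (simp add: E1 E2)
  show "a \<otimes>\<^bsub>Ext_TVS Z Y\<^esub> b = b \<otimes>\<^bsub>Ext_TVS Z Y\<^esub> a"
    using ext_sum_class[OF A(1)] ext_sum_class[OF ext_sum_commute[OF A(1)]] by (simp add: E1 E2)
  fix c assume "c \<in> carrier (Ext_TVS Z Y)"
  then obtain E3 where E3: "extension Z Y E3" "c = ?c E3" by (rule ext_classE)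
  obtain EC :: "('y, 'y \<times> 'z, 'z) ext" where C: "ext_sum Z Y E2 E3 EC" "extension Z Y EC"
    using ext_sum_ex[OF E2(1) E3(1)] .
  obtain EB :: "('y, 'y \<times> 'z, 'z) ext" where B: "ext_sum Z Y EA E3 EB" "extension Z Y EB"
    using ext_sum_ex[OF A(2) E3(1)] .
  show "a \<otimes>\<^bsub>Ext_TVS Z Y\<^esub> b \<otimes>\<^bsub>Ext_TVS Z Y\<^esub> c = a \<otimes>\<^bsub>Ext_TVS Z Y\<^esub> (b \<otimes>\<^bsub>Ext_TVS Z Y\<^esub> c)"
    using ext_sum_class[OF A(1)] ext_sum_class[OF C(1)] ext_sum_class[OF B(1)]
      ext_sum_class[OF ext_sum_assoc[OF A(1) C(1) B(1)]]
    by (simp add: E1 E2 E3)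
qed

section \<open>Restriction of extensions to a subspace\<close>

definition restrict_ext :: "'z set \<Rightarrow> ('y, 'x, 'z) ext \<Rightarrow> ('y, 'x, 'z) ext" where
  "restrict_ext D = (\<lambda>(X, i, p). (subtopology X {x. p x \<in> D}, i, p))"

context tvs_extension
begin

lemma preimage_subspace:
  assumes "subspace D"
  shows "subspace (topspace X \<inter> {x. p x \<in> D})"
  using assms sub(2) by (auto simp: subspace_def p_linear)

end

lemma tvs_subtopology_of_subspace:
  assumes "tvs Z" "subspace D" "D \<subseteq> topspace Z"
  shows "tvs (subtopology Z D)"
  using assms by (intro tvs_subtopology) (auto simp: inf.absorb2)

lemma extension_restrict_ext:
  assumes ext: "extension Z Y E" and D: "subspace D" "D \<subseteq> topspace Z"
  shows "extension (subtopology Z D) Y (restrict_ext D E)"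
proof -
  obtain X i p where E: "E = (X, i, p)" by (cases E)
  interpret tvs_extension Z Y X i p using ext unfolding E by unfold_locales
  let ?S = "{x. p x \<in> D}"
  have D0: "0 \<in> D" using D(1) by (rule subspace_0)
  have S0: "0 \<in> ?S" using D0 by (simp add: p_linear)
  show ?thesis
    unfolding E restrict_ext_def prod.case
  proof (rule extensionI)
    show "tvs Y" "tvs (subtopology X ?S)" "tvs (subtopology Z D)"
      using tvs preimage_subspace[OF D(1)] D by (auto intro: tvs_subtopology tvs_subtopology_of_subspace)
    show "linear_on (topspace Y) i" "inj_on i (topspace Y)" by (rule i_lin i_inj)+
    show "linear_on (topspace (subtopology X ?S)) p" using p_linear by (auto simp: linear_on_def)
    show "p ` topspace (subtopology X ?S) = topspace (subtopology Z D)"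
    proof (intro equalityI subsetI)
      fix z assume "z \<in> topspace (subtopology Z D)"
      then have z: "z \<in> topspace Z" "z \<in> D" by auto
      obtain x where "x \<in> topspace X" "p x = z" using z(1) by (rule liftE)
      then show "z \<in> p ` topspace (subtopology X ?S)" using z(2) by auto
    qed (auto simp: p_in)
    show "i ` topspace Y = {x \<in> topspace (subtopology X ?S). p x = 0}"
      using D0 by (auto simp: kernel)
  next
    fix N assume "nbhd_zero (subtopology X ?S) N"
    then obtain V where V: "nbhd_zero X V" "V \<inter> ?S \<subseteq> N" by (rule nbhd_zero_subtopology)
    have "nbhd_zero Y {y \<in> topspace Y. i y \<in> V}"
      using nbhd_zero_continuous[OF i_cont i_linear(3) zero_in(1) V(1)] .
    then show "nbhd_zero Y {y \<in> topspace Y. i y \<in> N}"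
      by (rule nbhd_zero_mono) (use V(2) p_i D0 in auto)
    have "nbhd_zero Z (p ` V)" using V(1) by (rule p_nbhd_zero)
    then show "nbhd_zero (subtopology Z D) (p ` N)"
      by (rule nbhd_zero_subtopologyI) (use V(2) D0 in auto)
  next
    fix N assume "nbhd_zero Y N"
    then obtain W where W: "openin X W" "0 \<in> W" "\<And>y. y \<in> topspace Y \<Longrightarrow> i y \<in> W \<Longrightarrow> y \<in> N"
      by (rule i_embedding) blast
    have "nbhd_zero (subtopology X ?S) W"
      using nbhd_zero_subtopologyI[OF nbhd_zero_open[OF W(1,2)] _ S0] by blast
    then show "\<exists>W. nbhd_zero (subtopology X ?S) W \<and> (\<forall>y\<in>topspace Y. i y \<in> W \<longrightarrow> y \<in> N)"
      using W(3) by (intro exI[of _ W]) auto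
  next
    fix N assume "nbhd_zero (subtopology Z D) N"
    then obtain V where V: "nbhd_zero Z V" "V \<inter> D \<subseteq> N" by (rule nbhd_zero_subtopology)
    have "nbhd_zero X {x \<in> topspace X. p x \<in> V}"
      using nbhd_zero_continuous[OF p_cont p_linear(3) zero_in(2) V(1)] .
    then show "nbhd_zero (subtopology X ?S) {x \<in> topspace (subtopology X ?S). p x \<in> N}"
      by (rule nbhd_zero_subtopologyI) (use V(2) S0 in auto)
  qed
qed

lemma continuous_linear_restrict:
  assumes "continuous_linear X X' f" "\<And>x. x \<in> topspace X \<Longrightarrow> x \<in> S \<Longrightarrow> f x \<in> S'"
  shows "continuous_linear (subtopology X S) (subtopology X' S') f"
  using assms
  by (auto simp: continuous_linear_def linear_on_def continuous_map_in_subtopology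
      continuous_map_from_subtopology)

lemma ext_equiv_restrict_ext:
  assumes "ext_equiv Z Y E E'"
  shows "ext_equiv (subtopology Z D) Y (restrict_ext D E) (restrict_ext D E')"
proof -
  obtain X i p X' i' p' where E: "E = (X, i, p)" "E' = (X', i', p')"
    by (cases E, cases E')
  obtain T where T: "continuous_linear X X' T" "\<forall>y\<in>topspace Y. T (i y) = i' y"
      "\<forall>x\<in>topspace X. p' (T x) = p x"
    using assms by (auto simp: E ext_equiv_def)
  then have "continuous_linear (subtopology X {x. p x \<in> D}) (subtopology X' {x. p' x \<in> D}) T"
    by (intro continuous_linear_restrict) auto
  then show ?thesis using T(2,3) by (auto simp: E ext_equiv_def restrict_ext_def)
qed

text \<open>
  The fibre product of the restrictions is a subspace of the fibre product, so the same map \<open>m\<close> serves.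
\<close>

lemma ext_sum_restrict_ext:
  assumes sum: "ext_sum Z Y E1 E2 E" and D: "subspace D" "D \<subseteq> topspace Z"
  shows "ext_sum (subtopology Z D) Y (restrict_ext D E1) (restrict_ext D E2) (restrict_ext D E)"
proof -
  obtain X1 i1 p1 X2 i2 p2 X i p where
    E: "E1 = (X1, i1, p1)" "E2 = (X2, i2, p2)" "E = (X, i, p)"
    by (cases E1, cases E2, cases E)
  obtain m where m: "sum_map Y E1 E2 E m" using sum by (auto simp: ext_sum_def)
  interpret sum_of_extensions Z Y X1 i1 p1 X2 i2 p2 X i p m
    using sum m unfolding ext_sum_def E by unfold_locales auto
  let ?S1 = "{x. p1 x \<in> D}" and ?S2 = "{x. p2 x \<in> D}" and ?S = "{x. p x \<in> D}"
  have F: "fibre_product (subtopology X1 ?S1) p1 (subtopology X2 ?S2) p2 = subtopology F (?S1 \<times> ?S2)"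
    by (simp add: fibre_product_def subtopology_subtopology Int_commute flip: subtopology_Times)
  have "continuous_linear (subtopology F (?S1 \<times> ?S2)) (subtopology X ?S) m"
    using p_m by (intro continuous_linear_restrict[OF m_cl]) auto
  then have "sum_map Y (restrict_ext D E1) (restrict_ext D E2) (restrict_ext D E) m"
    using m_i p_m by (auto simp: E restrict_ext_def sum_map_def F)
  then show ?thesis
    using extension_restrict_ext[OF A.ext D] extension_restrict_ext[OF B.ext D]
      extension_restrict_ext[OF C.ext D] by (auto simp: ext_sum_def E)
qed

section \<open>Injectivity of restriction\<close>

text \<open>
  At a point \<open>t\<close> outside \<open>S\<close>, the image under \<open>f\<close> of the trace on \<open>S\<close> of the neighbourhoods of \<open>t\<close>
  is a Cauchy filter, because \<open>f\<close> is uniformly continuous, and so has a limit in \<open>Y\<close>. In a regular space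
  these limits form a continuous extension, which is linear because linearity is a closed condition.
\<close>

lemma continuous_linear_extension:
  assumes X: "tvs X" and S: "subspace S" "S \<subseteq> topspace X" "X closure_of S = topspace X"
    and Y: "tvs Y" "regular_space Y" "complete_tvs Y"
    and f: "continuous_linear (subtopology X S) Y f"
  obtains g where "continuous_linear X Y g" "\<And>x. x \<in> S \<Longrightarrow> g x = f x"
proof -
  have top: "topspace (subtopology X S) = S" using S(2) by auto
  have f_cont: "continuous_map (subtopology X S) Y f" and f_lin: "linear_on S f"
    using f top by (auto simp: continuous_linear_def)
  note f_linear = linear_onD[OF f_lin S(1)]
  have f_in: "f x \<in> topspace Y" if "x \<in> S" for x
    using continuous_linear_in[OF f] that top by blast
  have sX: "subspace (topspace X)" using X by (rule tvs_subspace)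
  have lim: "\<exists>l. limitin Y f l (atin_within X t S)" if t: "t \<in> topspace X - S" for t
  proof -
    let ?A = "atin_within X t S"
    have "?A \<noteq> bot"
    proof
      assume "?A = bot"
      then have "eventually (\<lambda>x. False) ?A" by simp
      then obtain T where T: "openin X T" "t \<in> T" "\<forall>x\<in>T. \<not> (x \<in> S \<and> x \<noteq> t)"
        using t by (auto simp: eventually_atin_within)
      moreover have "t \<in> X closure_of S" using t S(3) by simp
      ultimately obtain y where "y \<in> S" "y \<in> T" by (auto simp: in_closure_of)
      then show False using T(3) t by blast
    qed
    moreover have in_S: "eventually (\<lambda>x. x \<in> S) ?A"
      using t by (auto simp: eventually_atin_within)
    moreover have "\<exists>A. eventually (\<lambda>x. f x \<in> A) ?A \<and> (\<forall>x\<in>A. \<forall>y\<in>A. x - y \<in> U)"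
      if U: "openin Y U" "0 \<in> U" for U
    proof -
      have "nbhd_zero (subtopology X S) {x \<in> topspace (subtopology X S). f x \<in> U}"
        by (rule nbhd_zero_continuous[OF f_cont])
          (use U S top in \<open>auto simp: f_linear subspace_0 intro: nbhd_zero_open\<close>)
      then obtain V where V: "nbhd_zero X V" "V \<inter> S \<subseteq> {x \<in> topspace (subtopology X S). f x \<in> U}"
        by (rule nbhd_zero_subtopology)
      obtain V' where V': "openin X V'" "0 \<in> V'" "balanced_set V'"
          "\<And>x y. x \<in> V' \<Longrightarrow> y \<in> V' \<Longrightarrow> x + y \<in> V"
        using balanced_half_nbhd_zero[OF X V(1)] by metis
      have "- t \<in> topspace X" using t sX by (simp add: subspace_neg)
      then have "openin X {w \<in> topspace X. - t + w \<in> V'}"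
        using openin_continuous_map_preimage[OF continuous_map_translation[OF X] V'(1)] by blast
      then have "eventually (\<lambda>x. x \<in> S \<and> - t + x \<in> V') ?A"
        using t V'(2) unfolding eventually_atin_within
        by (intro disjI2 exI[of _ "{w \<in> topspace X. - t + w \<in> V'}"]) auto
      then have "eventually (\<lambda>x. f x \<in> f ` {x \<in> S. - t + x \<in> V'}) ?A"
        by (rule eventually_mono) blast
      moreover have "f x - f y \<in> U"
        if "x \<in> S" "- t + x \<in> V'" "y \<in> S" "- t + y \<in> V'" for x y
      proof -
        have "(- t + x) + - (- t + y) \<in> V" using V'(4) balanced_neg[OF V'(3)] that by blast
        moreover have "x - y \<in> S" using that S(1) by (simp add: subspace_diff)
        ultimately have "f (x - y) \<in> U" using V(2) by auto
        then show ?thesis using f_linear(5) that by simp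
      qed
      ultimately show ?thesis by (intro exI[of _ "f ` {x \<in> S. - t + x \<in> V'}"]) auto
    qed
    ultimately have "cauchy_filter_tvs Y (filtermap f ?A)"
      unfolding cauchy_filter_tvs_def
      by (auto simp: filtermap_bot_iff le_principal eventually_filtermap elim: eventually_mono intro: f_in)
    then obtain l where "limitin Y (\<lambda>x. x) l (filtermap f ?A)"
      using Y(3) unfolding complete_tvs_def by blast
    then show ?thesis by (auto simp: limitin_def eventually_filtermap)
  qed
  obtain g where g: "continuous_map (subtopology X (topspace X)) Y g" "\<And>x. x \<in> S \<Longrightarrow> g x = f x"
    using continuous_map_extension_pointwise_alt[OF Y(2) S(2) _ f_cont lim] S(3) by auto
  then have g_cont: "continuous_map X Y g" by simp
  have HY: "Hausdorff_space Y" using Y(1) by (simp add: tvs_def)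
  let ?XX = "prod_topology X X"
  have fst_snd: "continuous_map ?XX X fst" "continuous_map ?XX X snd"
    by (simp_all add: continuous_map_fst continuous_map_snd)
  have "g (fst w + snd w) = g (fst w) + g (snd w)" if w: "w \<in> ?XX closure_of (S \<times> S)" for w
  proof (rule forall_in_closure_of_eq[OF w HY, where f = "\<lambda>w. g (fst w + snd w)"])
    show "continuous_map ?XX Y (\<lambda>w. g (fst w + snd w))"
      using continuous_map_compose[OF continuous_map_tvs_add[OF X fst_snd] g_cont] by (simp add: o_def)
    show "continuous_map ?XX Y (\<lambda>w. g (fst w) + g (snd w))"
      using continuous_map_compose[OF fst_snd(1) g_cont] continuous_map_compose[OF fst_snd(2) g_cont]
      by (intro continuous_map_tvs_add[OF Y(1)]) (simp_all add: o_def)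
    show "g (fst v + snd v) = g (fst v) + g (snd v)" if "v \<in> S \<times> S" for v
      using that S(1) g(2) f_linear(1) by (auto simp: subspace_add)
  qed
  moreover have "?XX closure_of (S \<times> S) = topspace X \<times> topspace X"
    by (simp add: closure_of_Times S(3))
  ultimately have add: "g (x + y) = g x + g y" if "x \<in> topspace X" "y \<in> topspace X" for x y
    using that by (metis SigmaI fst_conv snd_conv)
  have scale: "g (r *\<^sub>R x) = r *\<^sub>R g x" if "x \<in> topspace X" for r x
  proof (rule forall_in_closure_of_eq[of x X S Y "\<lambda>x. g (r *\<^sub>R x)"])
    show "continuous_map X Y (\<lambda>x. g (r *\<^sub>R x))"
      using continuous_map_compose[OF continuous_map_tvs_scale[OF X continuous_map_id, of r] g_cont]
      by (simp add: o_def)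
    show "continuous_map X Y (\<lambda>x. r *\<^sub>R g x)"
      using continuous_map_tvs_scale[OF Y(1) g_cont] .
    show "g (r *\<^sub>R y) = r *\<^sub>R g y" if "y \<in> S" for y
      using that S(1) g(2) f_linear(2) by (auto simp: subspace_scale)
  qed (use that S(3) HY in auto)
  have "continuous_linear X Y g"
    using g_cont add scale by (simp add: continuous_linear_def linear_on_def)
  then show thesis using that g(2) by blast
qed

text \<open>
  A splitting over \<open>D\<close> is a continuous linear retraction \<open>fst \<circ> T\<close> from \<open>p\<^sup>-\<^sup>1(D)\<close> to \<open>Y\<close>. The subspace
  \<open>p\<^sup>-\<^sup>1(D)\<close> is dense because \<open>p\<close> is open, so the retraction extends to a retraction \<open>g\<close> of \<open>X\<close>,
  and \<open>x \<mapsto> (g x, p x)\<close> is an equivalence with the trivial extension.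
\<close>

lemma trivial_on_dense_imp_trivial:
  assumes ext: "extension Z Y E"
    and D: "subspace D" "D \<subseteq> topspace Z" "Z closure_of D = topspace Z"
    and Y: "regular_space Y" "complete_tvs Y"
    and triv: "ext_equiv (subtopology Z D) Y (restrict_ext D E) (trivial_ext (subtopology Z D) Y)"
  shows "ext_equiv Z Y E (trivial_ext Z Y)"
proof -
  obtain X i p where E: "E = (X, i, p)" by (cases E)
  interpret tvs_extension Z Y X i p using ext unfolding E by unfold_locales
  let ?S = "topspace X \<inter> {x. p x \<in> D}"
  have XS: "subtopology X {x. p x \<in> D} = subtopology X ?S" by (simp add: subtopology_restrict)
  have dense: "X closure_of ?S = topspace X"
  proof (intro equalityI subsetI)
    fix x assume x: "x \<in> topspace X"
    have "\<exists>y. y \<in> ?S \<and> y \<in> U" if U: "x \<in> U" "openin X U" for U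
    proof -
      have "openin Z (p ` U)" using p_open U(2) by (simp add: open_map_def)
      moreover have "p x \<in> p ` U" "p x \<in> Z closure_of D" using U(1) p_in[OF x] D(3) by auto
      ultimately obtain z where "z \<in> D" "z \<in> p ` U" by (auto simp: in_closure_of)
      then show ?thesis using openin_subset[OF U(2)] by auto
    qed
    then show "x \<in> X closure_of ?S" using x by (auto simp: in_closure_of)
  qed (use closure_of_subset_topspace in fast)
  obtain T where T: "continuous_linear (subtopology X ?S) (prod_topology Y (subtopology Z D)) T"
      "\<And>y. y \<in> topspace Y \<Longrightarrow> T (i y) = (y, 0)"
    using triv by (auto simp: E ext_equiv_def restrict_ext_def trivial_ext_def XS)
  have "continuous_linear (prod_topology Y (subtopology Z D)) Y fst"
    by (auto simp: continuous_linear_def linear_on_def continuous_map_fst)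
  with T(1) have "continuous_linear (subtopology X ?S) Y (\<lambda>x. fst (T x))"
    by (rule continuous_linear_compose)
  then obtain g where g: "continuous_linear X Y g" "\<And>x. x \<in> ?S \<Longrightarrow> g x = fst (T x)"
    using continuous_linear_extension[OF tvs(2) preimage_subspace[OF D(1)] _ dense tvs(1) Y] by blast
  have "g (i y) = y" if "y \<in> topspace Y" for y
    using g(2)[of "i y"] T(2) that i_in p_i D(1) by (simp add: subspace_0)
  moreover have "continuous_map X (prod_topology Y Z) (\<lambda>x. (g x, p x))"
    using g(1) p_cont by (intro continuous_map_pairedI) (auto simp: continuous_linear_def)
  then have "continuous_linear X (prod_topology Y Z) (\<lambda>x. (g x, p x))"
    using g(1) p_linear by (auto simp: continuous_linear_def linear_on_def)
  ultimately show ?thesis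
    using p_i by (auto simp: E ext_equiv_def trivial_ext_def intro!: exI[of _ "\<lambda>x. (g x, p x)"])
qed

section \<open>Surjectivity of restriction\<close>

text \<open>
  The strings of the theory of topological vector spaces. They stand in for a continuous F-seminorm:
  \<open>U k\<close> plays the ball of radius \<open>2\<^sup>-\<^sup>k\<close>.
\<close>

definition zero_string :: "'a::real_vector topology \<Rightarrow> (nat \<Rightarrow> 'a set) \<Rightarrow> bool" where
  "zero_string X U \<longleftrightarrow> (\<forall>k. openin X (U k) \<and> 0 \<in> U k \<and> balanced_set (U k) \<and>
     (\<forall>x\<in>U (Suc k). \<forall>y\<in>U (Suc k). x + y \<in> U k))"

lemma zero_stringD:
  assumes "zero_string X U"
  shows "openin X (U k)" "0 \<in> U k" "balanced_set (U k)" "nbhd_zero X (U k)"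
    "x \<in> U (Suc k) \<Longrightarrow> y \<in> U (Suc k) \<Longrightarrow> x + y \<in> U k"
    "x \<in> U k \<Longrightarrow> - x \<in> U k"
    "x \<in> U (Suc k) \<Longrightarrow> y \<in> U (Suc k) \<Longrightarrow> x - y \<in> U k"
proof -
  show *: "openin X (U k)" "0 \<in> U k" "balanced_set (U k)"
    "x \<in> U (Suc k) \<Longrightarrow> y \<in> U (Suc k) \<Longrightarrow> x + y \<in> U k" for k x y
    using assms by (auto simp: zero_string_def)
  show "nbhd_zero X (U k)" using *(1,2) by (rule nbhd_zero_open)
  show neg: "x \<in> U k \<Longrightarrow> - x \<in> U k" for k x using *(3) by (rule balanced_neg)
  show "x \<in> U (Suc k) \<Longrightarrow> y \<in> U (Suc k) \<Longrightarrow> x - y \<in> U k"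
    using *(4)[of x k "- y"] neg by simp
qed

lemma zero_string_antimono:
  assumes "zero_string X U" "m \<le> n"
  shows "U n \<subseteq> U m"
proof (rule lift_Suc_antimono_le[OF _ assms(2)])
  show "U (Suc k) \<subseteq> U k" for k
    using zero_stringD(5)[OF assms(1), of _ k 0] zero_stringD(2)[OF assms(1)] by auto
qed

text \<open>
  A dilation by \<open>2\<^sup>n\<close> costs \<open>n\<close> indices.
\<close>

lemma zero_string_scale:
  assumes U: "zero_string X U"
  obtains l where "\<And>x. x \<in> U l \<Longrightarrow> r *\<^sub>R x \<in> U k"
proof -
  have double: "x \<in> U (k + n) \<Longrightarrow> (2 ^ n) *\<^sub>R x \<in> U k" for x n
  proof (induction n arbitrary: x)
    case (Suc n)
    then have "x + x \<in> U (k + n)" using zero_stringD(5)[OF U, of x "k + n" x] by simp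
    then have "(2 ^ n) *\<^sub>R (x + x) \<in> U k" by (rule Suc.IH)
    moreover have "(2 ^ n) *\<^sub>R (x + x) = (2 ^ Suc n) *\<^sub>R x"
      by (simp add: scaleR_add_right flip: scaleR_add_left)
    ultimately show ?case by simp
  qed simp
  obtain n :: nat where n: "\<bar>r\<bar> < 2 ^ n" using real_arch_pow[of 2 "\<bar>r\<bar>"] by auto
  have "r *\<^sub>R x \<in> U k" if "x \<in> U (k + n)" for x
  proof -
    have "\<bar>r / 2 ^ n\<bar> \<le> 1" using n by (simp add: abs_divide)
    then have "(r / 2 ^ n) *\<^sub>R ((2 ^ n) *\<^sub>R x) \<in> U k"
      using double[OF that] zero_stringD(3)[OF U, of k] unfolding balanced_set_def by blast
    then show ?thesis by simp
  qed
  then show thesis by (rule that)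
qed

lemma zero_string_exists:
  assumes X: "tvs X" and N: "\<And>k. nbhd_zero X (N k)"
  obtains U where "zero_string X U" "\<And>k. U (Suc k) \<subseteq> N k"
proof -
  let ?P = "\<lambda>(k::nat) U. openin X U \<and> 0 \<in> U \<and> balanced_set U"
  let ?Q = "\<lambda>k U U'. \<forall>x\<in>U'. \<forall>y\<in>U'. x + y \<in> U \<inter> N k"
  have "\<exists>U. \<forall>k. ?P k (U k) \<and> ?Q k (U k) (U (Suc k))"
  proof (rule dependent_nat_choice)
    show "\<exists>U. ?P 0 U" using balanced_nbhd_zero[OF X N[of 0]] by metis
    fix U k assume "?P k U"
    then have "nbhd_zero X (U \<inter> N k)" by (intro nbhd_zero_Int N) (auto intro: nbhd_zero_open)
    then obtain U' where "openin X U'" "0 \<in> U'" "balanced_set U'"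
        "\<And>x y. x \<in> U' \<Longrightarrow> y \<in> U' \<Longrightarrow> x + y \<in> U \<inter> N k"
      using balanced_half_nbhd_zero[OF X] by metis
    then show "\<exists>U'. ?P (Suc k) U' \<and> ?Q k U U'" by blast
  qed
  then obtain U where U: "\<And>k. ?P k (U k)" "\<And>k. ?Q k (U k) (U (Suc k))" by blast
  show thesis
  proof (rule that[of U])
    show "zero_string X U" using U by (auto simp: zero_string_def)
    show "U (Suc k) \<subseteq> N k" for k
    proof
      fix x assume "x \<in> U (Suc k)"
      then have "x + 0 \<in> U k \<inter> N k" using U by blast
      then show "x \<in> N k" by simp
    qed
  qed
qed

lemma countable_zero_basis:
  assumes "tvs Y" "metrizable_space Y"
  obtains N where "\<And>k::nat. nbhd_zero Y (N k)" "\<And>M. nbhd_zero Y M \<Longrightarrow> \<exists>k. N k \<subseteq> M"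
proof -
  have "0 \<in> topspace Y" using assms(1) by (simp add: tvs_def subspace_0)
  then obtain \<B> where \<B>: "countable \<B>" "\<And>V. V \<in> \<B> \<Longrightarrow> openin Y V"
      "\<And>U. openin Y U \<and> 0 \<in> U \<Longrightarrow> \<exists>V\<in>\<B>. 0 \<in> V \<and> V \<subseteq> U"
    using metrizable_imp_first_countable[OF assms(2)] unfolding first_countable_def by metis
  let ?C = "{V \<in> \<B>. 0 \<in> V}"
  have "?C \<noteq> {}" using \<B>(3)[of "topspace Y"] \<open>0 \<in> topspace Y\<close> by auto
  moreover have "countable ?C" using \<B>(1) by simp
  ultimately have range: "range (from_nat_into ?C) = ?C" by (rule range_from_nat_into)
  show thesis
  proof (rule that)
    show "nbhd_zero Y (from_nat_into ?C k)" for k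
    proof -
      have "from_nat_into ?C k \<in> ?C" using \<open>?C \<noteq> {}\<close> by (rule from_nat_into)
      then show ?thesis using \<B>(2) by (simp add: nbhd_zero_open)
    qed
    show "\<exists>k. from_nat_into ?C k \<subseteq> M" if M: "nbhd_zero Y M" for M
    proof -
      obtain W where "openin Y W" "0 \<in> W" "W \<subseteq> M" using M by (auto simp: nbhd_zero_def)
      then obtain V where V: "V \<in> \<B>" "0 \<in> V" "V \<subseteq> W" using \<B>(3)[of W] by metis
      then have "V \<in> range (from_nat_into ?C)" by (simp add: range)
      then obtain k where "V = from_nat_into ?C k" by (rule rangeE)
      then have "from_nat_into ?C k \<subseteq> M" using V(3) \<open>W \<subseteq> M\<close> by simp
      then show ?thesis by (rule exI)
    qed
  qed
qed

lemma balanced_shrink: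
  assumes "balanced_set B" "e *\<^sub>R x \<in> B" "0 \<le> r" "r \<le> e" "0 < e"
  shows "r *\<^sub>R x \<in> B"
proof -
  have "\<bar>r / e\<bar> \<le> 1" using assms by (simp add: abs_divide)
  then have "(r / e) *\<^sub>R (e *\<^sub>R x) \<in> B" using assms(1,2) unfolding balanced_set_def by blast
  then show ?thesis using assms(5) by simp
qed

text \<open>
  An extension of the dense subspace \<open>D\<close>, with a string \<open>U\<close> in \<open>X\<close> that induces the topology of \<open>Y\<close>,
  and a string \<open>G\<close> in \<open>Z\<close> fine enough to lift small elements of \<open>D\<close> to small elements of \<open>X\<close>.
\<close>

locale dense_extension = X: tvs_extension "subtopology Z D" Y X i p
  for Z :: "'z::real_vector topology" and D :: "'z set" and Y :: "'y::real_vector topology"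
    and X :: "'x::real_vector topology" and i :: "'y \<Rightarrow> 'x" and p :: "'x \<Rightarrow> 'z" +
  fixes U :: "nat \<Rightarrow> 'x set" and G :: "nat \<Rightarrow> 'z set"
  assumes Z: "tvs Z" and D: "subspace D" "D \<subseteq> topspace Z" "Z closure_of D = topspace Z"
    and U: "zero_string X U" and U_base: "\<And>M. nbhd_zero Y M \<Longrightarrow> \<exists>k. \<forall>y\<in>topspace Y. i y \<in> U k \<longrightarrow> y \<in> M"
    and G: "zero_string Z G" and G_lift: "\<And>k. G (Suc k) \<inter> D \<subseteq> p ` U k"
begin

lemmas UD = zero_stringD[OF U] and GD = zero_stringD[OF G]

lemma ZD_top: "topspace (subtopology Z D) = D"
  using D(2) by auto

lemma p_in_D: "x \<in> topspace X \<Longrightarrow> p x \<in> D"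
  using X.p_in ZD_top by blast

lemma U_in: "x \<in> U k \<Longrightarrow> x \<in> topspace X"
  using openin_subset[OF UD(1)] by blast

lemma U_mono: "m \<le> n \<Longrightarrow> x \<in> U n \<Longrightarrow> x \<in> U m"
  using zero_string_antimono[OF U] by blast

lemma G_mono: "m \<le> n \<Longrightarrow> x \<in> G n \<Longrightarrow> x \<in> G m"
  using zero_string_antimono[OF G] by blast

text \<open>
  Such a sequence represents a point over \<open>z\<close> of the completion of \<open>X\<close> for the vector topology with
  base \<open>U\<close> at zero.
\<close>

definition approximates :: "(nat \<Rightarrow> 'x) \<Rightarrow> 'z \<Rightarrow> bool" where
  "approximates c z \<longleftrightarrow> (\<forall>n. c n \<in> topspace X) \<and>
     (\<forall>k. \<exists>M. \<forall>m\<ge>M. \<forall>n\<ge>M. c m - c n \<in> U k) \<and>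
     (\<forall>k. \<exists>M. \<forall>n\<ge>M. z - p (c n) \<in> G k)"

text \<open>
  Approximate \<open>z\<close> by \<open>d n \<in> D\<close>. The increments \<open>d (Suc n) - d n\<close> are so small that they lift to
  elements of \<open>U (Suc n)\<close>; the partial sums of these lifts form the Cauchy sequence.
\<close>

lemma approximation_exists:
  assumes z: "z \<in> topspace Z"
  obtains c where "approximates c z"
proof -
  \<comment> \<open>Subtracting two consecutive errors costs one index of \<open>G\<close> and lifting to \<open>X\<close> another; as the
    increment from \<open>n\<close> is to be lifted into \<open>U (Suc n)\<close>, the error must lie in \<open>G (n + 3)\<close>.\<close>
  have "\<exists>d\<in>D. z - d \<in> G (n + 3)" for n
  proof -
    have sZ: "subspace (topspace Z)" using Z by (rule tvs_subspace)
    have "- z \<in> topspace Z" using z sZ by (simp add: subspace_neg)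
    let ?T = "{w \<in> topspace Z. - z + w \<in> G (n + 3)}"
    have "openin Z ?T"
      using \<open>- z \<in> topspace Z\<close>
      by (rule openin_continuous_map_preimage[OF continuous_map_translation[OF Z] GD(1)])
    moreover have "z \<in> ?T" using z GD(2) by simp
    moreover have "z \<in> Z closure_of D" using z D(3) by simp
    then have "\<And>T. z \<in> T \<and> openin Z T \<Longrightarrow> \<exists>d. d \<in> D \<and> d \<in> T" by (simp add: in_closure_of)
    ultimately have "\<exists>d. d \<in> D \<and> d \<in> ?T" by (metis (no_types))
    then obtain d where "d \<in> D" "d \<in> ?T" by (elim exE conjE)
    then show ?thesis using GD(6)[of "- z + d" "n + 3"] by (intro bexI[of _ d]) auto
  qed
  then obtain d where d: "\<And>n. d n \<in> D" "\<And>n. z - d n \<in> G (n + 3)" by metis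
  have "\<exists>c. \<forall>n. (c n \<in> topspace X \<and> p (c n) = d n) \<and> c (Suc n) - c n \<in> U (Suc n)"
  proof (rule dependent_nat_choice)
    have "d 0 \<in> topspace (subtopology Z D)" using d(1) ZD_top by simp
    then show "\<exists>x. x \<in> topspace X \<and> p x = d 0" by (metis X.liftE)
    fix x n assume x: "x \<in> topspace X \<and> p x = d n"
    have "(z - d n) - (z - d (Suc n)) \<in> G (Suc (Suc n))"
      using d(2)[of n] d(2)[of "Suc n"] G_mono[of "Suc (Suc (Suc n))" "Suc n + 3"]
      by - (rule GD(7), auto simp: numeral_3_eq_3)
    then have "d (Suc n) - d n \<in> G (Suc (Suc n)) \<inter> D" using d(1) D(1) by (simp add: subspace_diff)
    then obtain u where u: "u \<in> U (Suc n)" "p u = d (Suc n) - d n" using G_lift by fastforce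
    have "x + u \<in> topspace X" "p (x + u) = d (Suc n)"
      using x u U_in X.sub(2) by (auto simp: subspace_add X.p_linear)
    then show "\<exists>y. (y \<in> topspace X \<and> p y = d (Suc n)) \<and> y - x \<in> U (Suc n)"
      using u(1) by (intro exI[of _ "x + u"]) auto
  qed
  then obtain c where c: "\<And>n. c n \<in> topspace X" "\<And>n. p (c n) = d n"
      "\<And>n. c (Suc n) - c n \<in> U (Suc n)" by blast
  have step: "c (n + j) - c n \<in> U n" for n j
  proof (induction j arbitrary: n)
    case 0
    show ?case by (simp add: UD(2))
  next
    case (Suc j)
    have "(c (Suc n + j) - c (Suc n)) + (c (Suc n) - c n) \<in> U n"
      using UD(5) Suc.IH c(3) by blast
    then show ?case by simp
  qed
  have "c m - c n \<in> U k" if "m \<ge> Suc k" "n \<ge> Suc k" for m n k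
  proof -
    have "c m - c (Suc k) \<in> U (Suc k)" "c n - c (Suc k) \<in> U (Suc k)"
      using step[of "Suc k" "m - Suc k"] step[of "Suc k" "n - Suc k"] that by auto
    then have "(c m - c (Suc k)) - (c n - c (Suc k)) \<in> U k" by (rule UD(7))
    then show ?thesis by simp
  qed
  moreover have "z - p (c n) \<in> G k" if "n \<ge> k" for n k
    using G_mono[of k "n + 3"] d(2) c(2) that by simp
  ultimately have "approximates c z" using c(1) unfolding approximates_def by blast
  then show thesis by (rule that)
qed

lemma approximates_add:
  assumes "approximates c z" "approximates c' z'"
  shows "approximates (\<lambda>n. c n + c' n) (z + z')"
  unfolding approximates_def
proof (intro conjI allI)
  have c: "c n \<in> topspace X" "c' n \<in> topspace X" for n
    using assms by (auto simp: approximates_def)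
  show "c n + c' n \<in> topspace X" for n using c X.sub(2) by (simp add: subspace_add)
  fix k
  obtain M M' where M: "\<forall>m\<ge>M. \<forall>n\<ge>M. c m - c n \<in> U (Suc k)" "\<forall>m\<ge>M'. \<forall>n\<ge>M'. c' m - c' n \<in> U (Suc k)"
    using assms unfolding approximates_def by metis
  have "(c m + c' m) - (c n + c' n) \<in> U k" if "m \<ge> max M M'" "n \<ge> max M M'" for m n
  proof -
    have "(c m - c n) + (c' m - c' n) \<in> U k" using M that by (intro UD(5)) auto
    then show ?thesis by (simp add: algebra_simps)
  qed
  then show "\<exists>M. \<forall>m\<ge>M. \<forall>n\<ge>M. c m + c' m - (c n + c' n) \<in> U k" by blast
  obtain M M' where M: "\<forall>n\<ge>M. z - p (c n) \<in> G (Suc k)" "\<forall>n\<ge>M'. z' - p (c' n) \<in> G (Suc k)"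
    using assms unfolding approximates_def by metis
  have "(z + z') - p (c n + c' n) \<in> G k" if "n \<ge> max M M'" for n
  proof -
    have "(z - p (c n)) + (z' - p (c' n)) \<in> G k" using M that by (intro GD(5)) auto
    then show ?thesis using c by (simp add: X.p_linear algebra_simps)
  qed
  then show "\<exists>M. \<forall>n\<ge>M. z + z' - p (c n + c' n) \<in> G k" by blast
qed

lemma approximates_scale:
  assumes "approximates c z"
  shows "approximates (\<lambda>n. r *\<^sub>R c n) (r *\<^sub>R z)"
  unfolding approximates_def
proof (intro conjI allI)
  have c: "c n \<in> topspace X" for n using assms by (auto simp: approximates_def)
  show "r *\<^sub>R c n \<in> topspace X" for n using c X.sub(2) by (simp add: subspace_scale)
  fix k
  obtain l where l: "\<And>x. x \<in> U l \<Longrightarrow> r *\<^sub>R x \<in> U k" using zero_string_scale[OF U] by blast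
  obtain M where M: "\<forall>m\<ge>M. \<forall>n\<ge>M. c m - c n \<in> U l" using assms unfolding approximates_def by metis
  then show "\<exists>M. \<forall>m\<ge>M. \<forall>n\<ge>M. r *\<^sub>R c m - r *\<^sub>R c n \<in> U k"
    using l by (metis scaleR_diff_right)
  obtain l' where l': "\<And>x. x \<in> G l' \<Longrightarrow> r *\<^sub>R x \<in> G k" using zero_string_scale[OF G] by blast
  obtain M' where M': "\<forall>n\<ge>M'. z - p (c n) \<in> G l'" using assms unfolding approximates_def by metis
  have "r *\<^sub>R z - p (r *\<^sub>R c n) \<in> G k" if "n \<ge> M'" for n
    using l'[of "z - p (c n)"] M' that c by (simp add: X.p_linear scaleR_diff_right)
  then show "\<exists>M. \<forall>n\<ge>M. r *\<^sub>R z - p (r *\<^sub>R c n) \<in> G k" by blast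
qed

lemma approximates_const:
  assumes "x \<in> topspace X"
  shows "approximates (\<lambda>n. x) (p x)"
  using assms UD(2) GD(2) by (simp add: approximates_def)

text \<open>
  Choose the approximating sequences on the vectors of a basis of \<open>Z\<close> that extends a basis of
  \<open>D\<close>, taking the constant values of a section on the latter, and extend each \<open>c n\<close> linearly.
\<close>

lemma linear_approximation:
  obtains s :: "'z \<Rightarrow> 'x" and c :: "nat \<Rightarrow> 'z \<Rightarrow> 'x" where
    "linear s" "\<And>z. z \<in> D \<Longrightarrow> s z \<in> topspace X" "\<And>z. z \<in> D \<Longrightarrow> p (s z) = z"
    "\<And>n. linear (c n)" "\<And>n z. z \<in> D \<Longrightarrow> c n z = s z"
    "\<And>z. z \<in> topspace Z \<Longrightarrow> approximates (\<lambda>n. c n z) z"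
proof -
  have sZ: "subspace (topspace Z)" using Z by (rule tvs_subspace)
  obtain s where s: "linear s" "\<And>z. z \<in> D \<Longrightarrow> s z \<in> topspace X" "\<And>z. z \<in> D \<Longrightarrow> p (s z) = z"
    using linear_section_exists[OF X.sub(2) D(1) X.p_lin] X.p_onto ZD_top by metis
  obtain B1 where B1: "B1 \<subseteq> D" "independent B1" "D \<subseteq> span B1"
    using maximal_independent_subset[of D] by blast
  obtain B2 where B2: "B1 \<subseteq> B2" "B2 \<subseteq> topspace Z" "independent B2" "topspace Z \<subseteq> span B2"
    using maximal_independent_subset_extend[of B1 "topspace Z"] B1 D(2) by blast
  have "\<exists>c. approximates c b" if "b \<in> B2" for b
    using approximation_exists[of b] that B2(2) by blast
  then obtain C where C: "\<And>b. b \<in> B2 \<Longrightarrow> approximates (C b) b" by metis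
  have "\<exists>f. linear f \<and> (\<forall>b\<in>B2. f b = (if b \<in> B1 then s b else C b n))" for n
    by (rule linear_independent_extend[OF B2(3)])
  then obtain c where c: "\<And>n. linear (c n)"
      "\<And>n b. b \<in> B2 \<Longrightarrow> c n b = (if b \<in> B1 then s b else C b n)" by metis
  have cs: "c n z = s z" if "z \<in> D" for n z
    using linear_eq_on_span[OF c(1) s(1), of B1] c(2) B1(3) B2(1) that by (metis subsetD)
  have "approximates (\<lambda>n. c n z) z" if "z \<in> span B2" for z
    using that
  proof (induction rule: span_induct_alt)
    case base
    show ?case using approximates_const[OF X.zero_in(2)] linear_0[OF c(1)] X.p_linear(3) by simp
  next
    case (step r b z)
    have "approximates (\<lambda>n. c n b) b"
    proof (cases "b \<in> B1")
      case True
      then have "b \<in> D" using B1(1) by blast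
      then show ?thesis using approximates_const[OF s(2)] s(3) cs by simp
    next
      case False
      then show ?thesis using C[of b] c(2) step(1) by simp
    qed
    then have "approximates (\<lambda>n. r *\<^sub>R c n b + c n z) (r *\<^sub>R b + z)"
      using step.IH by (intro approximates_add approximates_scale)
    then show ?case by (simp add: linear_add[OF c(1)] linear_scale[OF c(1)])
  qed
  then have lim: "approximates (\<lambda>n. c n z) z" if "z \<in> topspace Z" for z
    using that B2(4) by blast
  show thesis by (rule that[OF s c(1) cs lim])
qed

text \<open>
  The string \<open>U\<close> and the topology of \<open>Z\<close> together recover the topology of \<open>X\<close>. If \<open>x\<close> is small for
  \<open>U\<close> and \<open>p x\<close> is small, then lift \<open>p x\<close> to a small \<open>u\<close>; the difference \<open>x - u\<close> is in the image
  of \<open>Y\<close> and small for \<open>U\<close>, hence small, because \<open>U\<close> induces the topology of \<open>Y\<close>.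
\<close>

lemma U_base_of_topology:
  assumes "nbhd_zero X Q"
  obtains k H where "nbhd_zero Z H" "\<And>x. x \<in> U k \<Longrightarrow> p x \<in> H \<Longrightarrow> x \<in> Q"
proof -
  obtain Q' where Q': "openin X Q'" "0 \<in> Q'" "balanced_set Q'"
      "\<And>x y. x \<in> Q' \<Longrightarrow> y \<in> Q' \<Longrightarrow> x + y \<in> Q"
    using balanced_half_nbhd_zero[OF X.tvs(2) assms] by metis
  have "nbhd_zero Y {y \<in> topspace Y. i y \<in> Q'}"
    using nbhd_zero_continuous[OF X.i_cont X.i_linear(3) X.zero_in(1)] Q' by (simp add: nbhd_zero_open)
  then obtain k where k: "\<And>y. y \<in> topspace Y \<Longrightarrow> i y \<in> U k \<Longrightarrow> i y \<in> Q'"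
    using U_base by blast
  have "nbhd_zero X (Q' \<inter> U (Suc k))"
    using Q'(1,2) UD(4) by (intro nbhd_zero_Int) (auto intro: nbhd_zero_open)
  then have "nbhd_zero (subtopology Z D) (p ` (Q' \<inter> U (Suc k)))" by (rule X.p_nbhd_zero)
  then obtain H where H: "nbhd_zero Z H" "H \<inter> D \<subseteq> p ` (Q' \<inter> U (Suc k))"
    by (rule nbhd_zero_subtopology)
  have "x \<in> Q" if x: "x \<in> U (Suc k)" "p x \<in> H" for x
  proof -
    have xX: "x \<in> topspace X" using x(1) by (rule U_in)
    then obtain u where u: "u \<in> Q'" "u \<in> U (Suc k)" "p x = p u"
      using H(2) x(2) p_in_D by blast
    have "x - u \<in> topspace X" "p (x - u) = 0"
      using xX U_in[OF u(2)] u(3) X.sub(2) by (auto simp: subspace_diff X.p_linear)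
    then obtain y where y: "y \<in> topspace Y" "x - u = i y" by (rule X.kernelE)
    have "i y \<in> Q'" using k[OF y(1)] UD(7)[OF x(1) u(2)] y(2) by simp
    then have "u + i y \<in> Q" using Q'(4) u(1) by blast
    then show ?thesis by (simp flip: y(2))
  qed
  then show thesis using that H(1) by blast
qed

text \<open>
  Each \<open>(y, z)\<close> stands for the Cauchy sequence \<open>f n (y, z) = i y + c n z\<close> in \<open>X\<close>, and \<open>V k\<close> consists
  of the pairs whose sequence is eventually in \<open>U k\<close>. Boundedness of Cauchy sequences makes the \<open>V k\<close>
  absorbing.
\<close>

lemma extension_to_closure:
  obtains E :: "('y, 'y \<times> 'z, 'z) ext" where
    "extension Z Y E" "ext_equiv (subtopology Z D) Y (restrict_ext D E) (X, i, p)"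
proof -
  obtain s c where s: "linear s" "\<And>z. z \<in> D \<Longrightarrow> s z \<in> topspace X" "\<And>z. z \<in> D \<Longrightarrow> p (s z) = z"
    and c: "\<And>n. linear (c n)" "\<And>n z. z \<in> D \<Longrightarrow> c n z = s z"
      "\<And>z. z \<in> topspace Z \<Longrightarrow> approximates (\<lambda>n. c n z) z"
    using linear_approximation by blast
  have sZ: "subspace (topspace Z)" using Z by (rule tvs_subspace)
  have c_in: "c n z \<in> topspace X" if "z \<in> topspace Z" for n z
    using c(3)[OF that] by (simp add: approximates_def)
  have c_cauchy: "\<exists>M. \<forall>m\<ge>M. \<forall>n\<ge>M. c m z - c n z \<in> U k" if "z \<in> topspace Z" for z k
    using c(3)[OF that] by (simp add: approximates_def)
  have c_lim: "\<exists>M. \<forall>n\<ge>M. z - p (c n z) \<in> G k" if "z \<in> topspace Z" for z k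
    using c(3)[OF that] by (simp add: approximates_def)
  let ?S = "topspace Y \<times> topspace Z"
  have sS: "subspace ?S" using X.sub(1) sZ by (rule subspace_Times)
  define f where "f = (\<lambda>n (y, z). i y + c n z)"
  have f_lin: "linear_on ?S (f n)" for n
    by (auto simp: linear_on_def f_def X.i_linear linear_add[OF c(1)] linear_scale[OF c(1)] scaleR_add_right)
  note f_linear = linear_onD[OF f_lin sS]
  define V where "V = (\<lambda>k. {v \<in> ?S. \<exists>M. \<forall>n\<ge>M. f n v \<in> U k})"
  have V_mono: "V n \<subseteq> V m" if "m \<le> n" for m n
    using U_mono[OF that] unfolding V_def by blast
  define \<B> where "\<B> = {{v \<in> V k. snd v \<in> W} | k W. openin Z W \<and> 0 \<in> W \<and> balanced_set W}"
  have \<B>I: "{v \<in> V k. snd v \<in> W} \<in> \<B>" if "openin Z W" "0 \<in> W" "balanced_set W" for k W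
    using that by (auto simp: \<B>_def)
  have \<B>E: "\<exists>k W. B = {v \<in> V k. snd v \<in> W} \<and> openin Z W \<and> 0 \<in> W \<and> balanced_set W" if "B \<in> \<B>" for B
    using that by (auto simp: \<B>_def)
  have Z_basis: "\<exists>W. openin Z W \<and> 0 \<in> W \<and> balanced_set W \<and> W \<subseteq> N" if "nbhd_zero Z N" for N
    using balanced_nbhd_zero[OF Z that] by metis
  have V0: "0 \<in> V k" for k
    using sS UD(2) f_linear(3) unfolding V_def by (simp add: subspace_0)
  have V_balanced: "balanced_set (V k)" for k
    unfolding balanced_set_def
  proof (intro allI ballI impI)
    fix r :: real and v assume v: "v \<in> V k" and r: "\<bar>r\<bar> \<le> 1"
    then obtain M where "v \<in> ?S" "\<forall>n\<ge>M. f n v \<in> U k" unfolding V_def by blast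
    moreover from this have "\<forall>n\<ge>M. f n (r *\<^sub>R v) \<in> U k"
      using r UD(3)[of k] f_linear(2) unfolding balanced_set_def by simp
    ultimately show "r *\<^sub>R v \<in> V k" using sS unfolding V_def by (auto intro: subspace_scale)
  qed
  have V_absorbing: "\<exists>e>0. e *\<^sub>R v \<in> V k" if v: "v \<in> ?S" for v k
  proof -
    obtain y z where yz: "v = (y, z)" "y \<in> topspace Y" "z \<in> topspace Z" using v by blast
    obtain M where M: "\<forall>m\<ge>M. \<forall>n\<ge>M. c m z - c n z \<in> U (Suc k)" using c_cauchy[OF yz(3)] by blast
    have "f M v \<in> topspace X"
      using yz c_in X.i_in X.sub(2) by (simp add: f_def subspace_add)
    then obtain e where e: "e > 0" "e *\<^sub>R f M v \<in> U (Suc k)"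
      using nbhd_zero_absorbing[OF X.tvs(2) UD(4)] by blast
    define r where "r = min e 1"
    have r: "0 < r" "r \<le> e" "\<bar>r\<bar> \<le> 1" using e(1) by (auto simp: r_def)
    have "f n (r *\<^sub>R v) \<in> U k" if "n \<ge> M" for n
    proof -
      have "r *\<^sub>R f M v \<in> U (Suc k)"
        using r e by (intro balanced_shrink[OF UD(3) e(2)]) auto
      moreover have "r *\<^sub>R (c n z - c M z) \<in> U (Suc k)"
        using M that r(3) UD(3)[of "Suc k"] unfolding balanced_set_def by simp
      ultimately have "r *\<^sub>R f M v + r *\<^sub>R (c n z - c M z) \<in> U k" by (rule UD(5))
      moreover have "f n v = f M v + (c n z - c M z)" by (simp add: f_def yz(1))
      ultimately show ?thesis using f_linear(2)[OF v] by (simp flip: scaleR_add_right)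
    qed
    then have "r *\<^sub>R v \<in> V k" using subspace_scale[OF sS v] unfolding V_def by blast
    then show ?thesis using r(1) by blast
  qed
  have V_add: "v + w \<in> V k" if v: "v \<in> V (Suc k)" and w: "w \<in> V (Suc k)" for v w k
  proof -
    obtain M M' where M: "v \<in> ?S" "\<forall>n\<ge>M. f n v \<in> U (Suc k)" "w \<in> ?S" "\<forall>n\<ge>M'. f n w \<in> U (Suc k)"
      using v w unfolding V_def by blast
    have "f n (v + w) \<in> U k" if "n \<ge> max M M'" for n
      using M that f_linear(1)[OF M(1,3)] by (simp add: UD(5))
    then show ?thesis using subspace_add[OF sS M(1,3)] unfolding V_def by blast
  qed
  have "zero_base ?S \<B>"
    unfolding zero_base_def
  proof (intro conjI ballI)
    show "\<B> \<noteq> {}" using \<B>I[OF GD(1-3)] by blast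
  next
    fix B B' assume BB': "B \<in> \<B>" "B' \<in> \<B>"
    obtain k W where B: "B = {v \<in> V k. snd v \<in> W}" "openin Z W" "0 \<in> W" "balanced_set W"
      using \<B>E[OF BB'(1)] by (elim exE conjE)
    obtain k' W' where B': "B' = {v \<in> V k'. snd v \<in> W'}" "openin Z W'" "0 \<in> W'" "balanced_set W'"
      using \<B>E[OF BB'(2)] by (elim exE conjE)
    have "{v \<in> V (max k k'). snd v \<in> W \<inter> W'} \<in> \<B>"
      using B B' by (intro \<B>I) (auto simp: balanced_set_def)
    moreover have "{v \<in> V (max k k'). snd v \<in> W \<inter> W'} \<subseteq> B \<inter> B'"
      using V_mono[of k "max k k'"] V_mono[of k' "max k k'"] by (auto simp: B(1) B'(1))
    ultimately show "\<exists>A\<in>\<B>. A \<subseteq> B \<inter> B'" by blast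
  next
    fix B assume BB: "B \<in> \<B>"
    obtain k W where B: "B = {v \<in> V k. snd v \<in> W}" "openin Z W" "0 \<in> W" "balanced_set W"
      using \<B>E[OF BB] by (elim exE conjE)
    show "0 \<in> B" using V0 B(3) by (simp add: B(1))
    show "B \<subseteq> ?S" by (auto simp: B(1) V_def)
    show "balanced_set B"
      using V_balanced[of k] B(4) by (auto simp: B(1) balanced_set_def)
    show "\<exists>e>0. e *\<^sub>R v \<in> B" if v: "v \<in> ?S" for v
    proof -
      obtain e where e: "e > 0" "e *\<^sub>R v \<in> V k" using V_absorbing[OF v] by blast
      have "snd v \<in> topspace Z" using v by auto
      then obtain e' where e': "e' > 0" "e' *\<^sub>R snd v \<in> W"
        using nbhd_zero_absorbing[OF Z nbhd_zero_open[OF B(2,3)]] by blast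
      have "min e e' *\<^sub>R v \<in> V k" "min e e' *\<^sub>R snd v \<in> W"
        using balanced_shrink[OF V_balanced e(2)] balanced_shrink[OF B(4) e'(2)] e(1) e'(1) by auto
      then show ?thesis using e(1) e'(1) by (intro exI[of _ "min e e'"]) (auto simp: B(1))
    qed
    obtain W' where W': "openin Z W'" "0 \<in> W'" "balanced_set W'"
        "\<And>x y. x \<in> W' \<Longrightarrow> y \<in> W' \<Longrightarrow> x + y \<in> W"
      using balanced_half_nbhd_zero[OF Z nbhd_zero_open[OF B(2,3)]] by metis
    show "\<exists>C\<in>\<B>. \<forall>x\<in>C. \<forall>y\<in>C. x + y \<in> B"
      using V_add W'(4) by (intro bexI[OF _ \<B>I[OF W'(1-3), of "Suc k"]]) (auto simp: B(1))
  qed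
  then obtain P where P: "extension Z Y (P, \<lambda>y. (y, 0), snd)" "topspace P = ?S"
    "\<And>U. nbhd_zero P U \<longleftrightarrow> (\<exists>B\<in>\<B>. B \<subseteq> U)"
  proof (rule extension_of_zero_base[OF Z X.tvs(1)])
    fix B assume BB: "B \<in> \<B>"
    obtain k W where B: "B = {v \<in> V k. snd v \<in> W}" "openin Z W" "0 \<in> W" "balanced_set W"
      using \<B>E[OF BB] by (elim exE conjE)
    have "nbhd_zero Y {y \<in> topspace Y. i y \<in> U k}"
      using nbhd_zero_continuous[OF X.i_cont X.i_linear(3) X.zero_in(1) UD(4)] .
    then show "nbhd_zero Y {y \<in> topspace Y. (y, 0) \<in> B}"
      by (rule nbhd_zero_mono)
        (use sZ B(3) in \<open>auto simp: B(1) V_def f_def linear_0[OF c(1)] subspace_0\<close>)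
    \<comment> \<open>For \<open>z\<close> small, \<open>p (c n z)\<close> is a small element of \<open>D\<close> when \<open>n\<close> is large, and lifts to a small \<open>u\<close>.
      Then \<open>u\<close> differs from \<open>c n z\<close> by some \<open>i y\<close>, and \<open>(y, z)\<close> is in \<open>V k\<close> because the \<open>c m z\<close> with
      \<open>m \<ge> n\<close> are close to \<open>c n z\<close>.\<close>
    have "nbhd_zero Z (G (k + 3) \<inter> W)"
      using GD(4) B(2,3) by (intro nbhd_zero_Int) (auto intro: nbhd_zero_open)
    then show "nbhd_zero Z (snd ` B)"
    proof (rule nbhd_zero_mono, intro subsetI)
      fix z assume "z \<in> G (k + 3) \<inter> W"
      then have z: "z \<in> G (Suc (Suc (Suc k)))" "z \<in> W" "z \<in> topspace Z"
        using openin_subset[OF B(2)] by (auto simp: numeral_3_eq_3)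
      obtain M where M: "\<forall>m\<ge>M. \<forall>n\<ge>M. c m z - c n z \<in> U (Suc k)" using c_cauchy[OF z(3)] by blast
      obtain M' where M': "\<forall>n\<ge>M'. z - p (c n z) \<in> G (Suc (Suc (Suc k)))" using c_lim[OF z(3)] by blast
      define n where "n = max M M'"
      have cX: "c n z \<in> topspace X" using c_in[OF z(3)] .
      have "z - (z - p (c n z)) \<in> G (Suc (Suc k))" using M' z(1) by - (rule GD(7), auto simp: n_def)
      then have "p (c n z) \<in> G (Suc (Suc k)) \<inter> D" using p_in_D[OF cX] by simp
      then obtain u where u: "u \<in> U (Suc k)" "p (c n z) = p u" using G_lift by blast
      have "u - c n z \<in> topspace X" "p (u - c n z) = 0"
        using cX U_in[OF u(1)] u(2) X.sub(2) by (auto simp: subspace_diff X.p_linear)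
      then obtain y where y: "y \<in> topspace Y" "u - c n z = i y" by (rule X.kernelE)
      have "f m (y, z) \<in> U k" if "m \<ge> n" for m
      proof -
        have "u + (c m z - c n z) \<in> U k" using M that u(1) by (intro UD(5)) (auto simp: n_def)
        then show ?thesis by (simp add: f_def algebra_simps flip: y(2))
      qed
      then have "(y, z) \<in> B" using y(1) z by (auto simp: B(1) V_def)
      then show "z \<in> snd ` B" by force
    qed
  next
    fix N assume "nbhd_zero Y N"
    then obtain k where k: "\<And>y. y \<in> topspace Y \<Longrightarrow> i y \<in> U k \<Longrightarrow> y \<in> N" using U_base by blast
    have "y \<in> N" if "(y, 0) \<in> V k" for y
      using that k by (auto simp: V_def f_def linear_0[OF c(1)])
    then show "\<exists>B\<in>\<B>. \<forall>y. (y, 0) \<in> B \<longrightarrow> y \<in> N"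
      by (intro bexI[OF _ \<B>I[OF GD(1-3), of k]]) auto
  next
    fix N assume "nbhd_zero Z N"
    then obtain W where "openin Z W" "0 \<in> W" "balanced_set W" "W \<subseteq> N" using Z_basis by blast
    then show "\<exists>B\<in>\<B>. snd ` B \<subseteq> N" using \<B>I[of W 0] by (intro bexI[OF _ \<B>I[of W 0]]) auto
  qed blast
  interpret P: tvs_extension Z Y P "\<lambda>y. (y, 0)" snd using P(1) by unfold_locales
  let ?E = "(P, \<lambda>y. (y, 0), snd) :: ('y, 'y \<times> 'z, 'z) ext"
  let ?PD = "subtopology P {v. snd v \<in> D}"
  have "extension (subtopology Z D) Y (restrict_ext D ?E)"
    using extension_restrict_ext[OF P(1) D(1,2)] .
  then have PD_tvs: "tvs ?PD" by (simp add: restrict_ext_def extension_def)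
  \<comment> \<open>Over \<open>D\<close> the sequences are constant, so the sets \<open>V k\<close> are there the preimages of the \<open>U k\<close> under
    the linear isomorphism \<open>T\<close>.\<close>
  have PD_top: "topspace ?PD = topspace Y \<times> D" using D(2) by (auto simp: P(2))
  define T where "T = (\<lambda>(y, z). i y + s z)"
  have T_lin: "linear_on (topspace ?PD) T"
    unfolding PD_top
    by (auto simp: linear_on_def T_def X.i_linear linear_add[OF s(1)] linear_scale[OF s(1)] scaleR_add_right)
  have "continuous_map ?PD X T"
  proof (rule continuous_map_at_zero[OF PD_tvs X.tvs(2) T_lin])
    show "T ` topspace ?PD \<subseteq> topspace X"
      unfolding PD_top using s(2) X.i_in X.sub(2) by (auto simp: T_def subspace_add)
    fix Q assume "nbhd_zero X Q"
    then obtain k H where kH: "nbhd_zero Z H" "\<And>x. x \<in> U k \<Longrightarrow> p x \<in> H \<Longrightarrow> x \<in> Q"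
      by (rule U_base_of_topology) blast
    obtain W where W: "openin Z W" "0 \<in> W" "balanced_set W" "W \<subseteq> H" using Z_basis[OF kH(1)] by blast
    have "nbhd_zero P {v \<in> V k. snd v \<in> W}" unfolding P(3) using \<B>I[OF W(1-3)] by blast
    then show "nbhd_zero ?PD {v \<in> topspace ?PD. T v \<in> Q}"
    proof (rule nbhd_zero_subtopologyI)
      show "0 \<in> {v. snd v \<in> D}" using D(1) by (simp add: subspace_0)
      show "{v \<in> V k. snd v \<in> W} \<inter> {v. snd v \<in> D} \<subseteq> {v \<in> topspace ?PD. T v \<in> Q}"
      proof clarify
        fix y z assume yz: "(y, z) \<in> V k" "snd (y, z) \<in> W" "snd (y, z) \<in> D"
        then have y: "y \<in> topspace Y" by (auto simp: V_def)
        obtain n where "f n (y, z) \<in> U k" using yz(1) by (auto simp: V_def)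
        then have "T (y, z) \<in> U k" using c(2) yz(3) by (simp add: f_def T_def)
        moreover have "p (T (y, z)) = z" using y yz(3) s X.i_in X.p_i by (simp add: T_def X.p_linear)
        ultimately have "T (y, z) \<in> Q" using kH(2) W(4) yz(2) by auto
        then show "(y, z) \<in> topspace ?PD \<and> T (y, z) \<in> Q" using y yz(3) PD_top by simp
      qed
    qed
  qed
  then have "continuous_linear ?PD X T" using T_lin by (simp add: continuous_linear_def)
  moreover have "T (y, 0) = i y" for y by (simp add: T_def linear_0[OF s(1)])
  moreover have "p (T v) = snd v" if "v \<in> topspace ?PD" for v
    using that unfolding PD_top using s X.i_in X.p_i by (auto simp: T_def X.p_linear)
  ultimately have "ext_equiv (subtopology Z D) Y (restrict_ext D ?E) (X, i, p)"
    by (auto simp: ext_equiv_def restrict_ext_def intro!: exI[of _ T])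
  then show thesis using that P(1) by blast
qed

end

text \<open>
  As \<open>Y\<close> is first countable, one string suffices to induce its topology from \<open>X\<close>.
\<close>

lemma restriction_surjective:
  fixes Z :: "'z::real_vector topology" and Y :: "'y::real_vector topology"
    and E :: "('y, 'x::real_vector, 'z) ext"
  assumes Z: "tvs Z" and Y: "metrizable_space Y"
    and D: "subspace D" "D \<subseteq> topspace Z" "Z closure_of D = topspace Z"
    and E: "extension (subtopology Z D) Y E"
  obtains E' :: "('y, 'y \<times> 'z, 'z) ext" where
    "extension Z Y E'" "ext_equiv (subtopology Z D) Y (restrict_ext D E') E"
proof -
  obtain X i p where E_eq: "E = (X, i, p)" by (cases E)
  interpret X: tvs_extension "subtopology Z D" Y X i p using E unfolding E_eq by unfold_locales
  obtain N where N: "\<And>k::nat. nbhd_zero Y (N k)" "\<And>M. nbhd_zero Y M \<Longrightarrow> \<exists>k. N k \<subseteq> M"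
    using countable_zero_basis[OF X.tvs(1) Y] by metis
  have "\<exists>W. nbhd_zero X W \<and> (\<forall>y\<in>topspace Y. i y \<in> W \<longrightarrow> y \<in> N k)" for k
    using X.i_embedding[OF N(1)] nbhd_zero_open by metis
  then obtain W where W: "\<And>k. nbhd_zero X (W k)" "\<And>k y. y \<in> topspace Y \<Longrightarrow> i y \<in> W k \<Longrightarrow> y \<in> N k"
    by metis
  obtain U where U: "zero_string X U" "\<And>k. U (Suc k) \<subseteq> W k"
    using zero_string_exists[of X W, OF X.tvs(2) W(1)] by metis
  have "\<exists>H. nbhd_zero Z H \<and> H \<inter> D \<subseteq> p ` U k" for k
    using nbhd_zero_subtopology[OF X.p_nbhd_zero[OF zero_stringD(4)[OF U(1)]]] by metis
  then obtain H where H: "\<And>k. nbhd_zero Z (H k)" "\<And>k. H k \<inter> D \<subseteq> p ` U k" by metis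
  obtain G where G: "zero_string Z G" "\<And>k. G (Suc k) \<subseteq> H k"
    using zero_string_exists[of Z H, OF Z H(1)] by metis
  have "\<exists>k. \<forall>y\<in>topspace Y. i y \<in> U k \<longrightarrow> y \<in> M" if "nbhd_zero Y M" for M
  proof -
    obtain k where "N k \<subseteq> M" using N(2)[OF \<open>nbhd_zero Y M\<close>] by blast
    then show ?thesis using U(2)[of k] W(2) by blast
  qed
  then interpret dense_extension Z D Y X i p U G
    using Z D U G H(2) by unfold_locales blast+
  show thesis using extension_to_closure that unfolding E_eq by blast
qed

section \<open>The isomorphism\<close>

text \<open>
  The set is closed under equivalence because \<open>restrict_ext\<close> need not map a class onto a class.
\<close>

definition restrict_class ::
  "'z::real_vector topology \<Rightarrow> 'y::real_vector topology \<Rightarrow> 'z set \<Rightarrow>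
   ('y, 'y \<times> 'z, 'z) ext set \<Rightarrow> ('y, 'y \<times> 'z, 'z) ext set" where
  "restrict_class Z Y D a = ext_rel (subtopology Z D) Y `` (restrict_ext D ` a)"

lemma restrict_class:
  assumes E: "extension Z Y E" and D: "subspace D" "D \<subseteq> topspace Z"
  shows "restrict_class Z Y D (ext_class Z Y E) = ext_class (subtopology Z D) Y (restrict_ext D E)"
proof (intro equalityI subsetI)
  let ?R = "restrict_ext D" and ?Z = "subtopology Z D"
  fix F assume "F \<in> restrict_class Z Y D (ext_class Z Y E)"
  then obtain E' where E': "E' \<in> ext_class Z Y E" "(?R E', F) \<in> ext_rel ?Z Y"
    unfolding restrict_class_def by (auto simp del: split_paired_Ex)
  have "ext_equiv ?Z Y (?R E) (?R E')"
    using E'(1) by (auto simp: mem_ext_class intro: ext_equiv_restrict_ext)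
  moreover have "ext_equiv ?Z Y (?R E') F" "extension ?Z Y F"
    using E'(2) by (auto simp: ext_rel_def)
  ultimately show "F \<in> ext_class ?Z Y (?R E)"
    using extension_restrict_ext[OF E D] unfolding mem_ext_class by (blast intro: ext_equiv_trans)
next
  fix F assume "F \<in> ext_class (subtopology Z D) Y (restrict_ext D E)"
  moreover have "E \<in> ext_class Z Y E" using E by (simp add: mem_ext_class ext_equiv_refl)
  ultimately show "F \<in> restrict_class Z Y D (ext_class Z Y E)"
    unfolding restrict_class_def by (auto simp: ext_class_def[of "subtopology Z D"])
qed

theorem theorem12:
  fixes Z :: "'z::real_vector topology" and Y :: "'y::real_vector topology" and D :: "'z set"
  assumes "tvs Z"
    and "tvs Y" and "metrizable_space Y" and "complete_tvs Y"
    and "subspace D" and "D \<subseteq> topspace Z" and "Z closure_of D = topspace Z"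
  shows "comm_group (Ext_TVS Z Y) \<and> comm_group (Ext_TVS (subtopology Z D) Y) \<and>
         Ext_TVS Z Y \<cong> Ext_TVS (subtopology Z D) Y"
proof (intro conjI)
  let ?Z = "subtopology Z D"
  let ?G = "Ext_TVS Z Y" and ?H = "Ext_TVS ?Z Y" and ?h = "restrict_class Z Y D"
  have D: "subspace D" "D \<subseteq> topspace Z" "Z closure_of D = topspace Z" using assms by auto
  have ZD: "tvs ?Z" using tvs_subtopology_of_subspace assms(1) D(1,2) .
  show G: "comm_group ?G" using assms(1,2) by (rule comm_group_Ext_TVS)
  show H: "comm_group ?H" using ZD assms(2) by (rule comm_group_Ext_TVS)
  have one: "\<one>\<^bsub>?G\<^esub> = ext_class Z Y (trivial_ext Z Y)" "\<one>\<^bsub>?H\<^esub> = ext_class ?Z Y (trivial_ext ?Z Y)"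
    by (simp_all add: Ext_TVS_def ext_class_def)
  have "?h \<in> hom ?G ?H"
  proof (rule homI)
    fix a assume "a \<in> carrier ?G"
    then obtain E1 where E1: "extension Z Y E1" "a = ext_class Z Y E1" by (rule ext_classE)
    show "?h a \<in> carrier ?H"
      using restrict_class[OF E1(1) D(1,2)] ext_class_in[OF extension_restrict_ext[OF E1(1) D(1,2)]] E1(2)
      by simp
    fix b assume "b \<in> carrier ?G"
    then obtain E2 where E2: "extension Z Y E2" "b = ext_class Z Y E2" by (rule ext_classE)
    obtain E :: "('y, 'y \<times> 'z, 'z) ext" where E: "ext_sum Z Y E1 E2 E" "extension Z Y E"
      using ext_sum_ex[OF E1(1) E2(1)] .
    show "?h (a \<otimes>\<^bsub>?G\<^esub> b) = ?h a \<otimes>\<^bsub>?H\<^esub> ?h b"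
      using ext_sum_class[OF E(1)] ext_sum_class[OF ext_sum_restrict_ext[OF E(1) D(1,2)]]
        restrict_class[OF E1(1) D(1,2)] restrict_class[OF E2(1) D(1,2)] restrict_class[OF E(2) D(1,2)]
        E1(2) E2(2) by simp
  qed
  then interpret group_hom ?G ?H ?h
    using G H by (intro group_hom.intro group_hom_axioms.intro comm_group.axioms(2))
  have "a = \<one>\<^bsub>?G\<^esub>" if a: "a \<in> carrier ?G" "?h a = \<one>\<^bsub>?H\<^esub>" for a
  proof -
    obtain E where E: "extension Z Y E" "a = ext_class Z Y E" using a(1) by (rule ext_classE)
    have "ext_equiv ?Z Y (restrict_ext D E) (trivial_ext ?Z Y)"
      using a(2) restrict_class[OF E(1) D(1,2)] E(2) one(2)
        ext_class_eq_iff[OF extension_restrict_ext[OF E(1) D(1,2)] trivial_extension[OF ZD assms(2)]]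
      by simp
    then have "ext_equiv Z Y E (trivial_ext Z Y)"
      using trivial_on_dense_imp_trivial[OF E(1) D metrizable_imp_regular_space[OF assms(3)] assms(4)] by blast
    then show ?thesis
      using ext_class_eq_iff[OF E(1) trivial_extension[OF assms(1,2)]] E(2) one(1) by simp
  qed
  moreover have "carrier ?H \<subseteq> ?h ` carrier ?G"
  proof
    fix b assume "b \<in> carrier ?H"
    then obtain E where E: "extension ?Z Y E" "b = ext_class ?Z Y E" by (rule ext_classE)
    obtain E' :: "('y, 'y \<times> 'z, 'z) ext" where E': "extension Z Y E'" "ext_equiv ?Z Y (restrict_ext D E') E"
      using restriction_surjective[OF assms(1,3) D E(1)] .
    have "?h (ext_class Z Y E') = b"
      using restrict_class[OF E'(1) D(1,2)] E'(2) E(2)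
        ext_class_eq_iff[OF extension_restrict_ext[OF E'(1) D(1,2)] E(1)] by simp
    then show "b \<in> ?h ` carrier ?G" using ext_class_in[OF E'(1)] by blast
  qed
  ultimately have "?h \<in> iso ?G ?H" by (simp add: iso_iff)
  then show "?G \<cong> ?H" by (rule is_isoI)
qed

end
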